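(* Let $G(x)=(G_1(x),G_2(x))$, $x\ge 0$, where $G_1,G_2$ are continuous functions such that $G_1(x)>0$, $G_2(x)>0$ for $x>0$ and $\frac{G_2(x)}{G_1(x)}\in C^1(0,+\infty)$. Let the L\'evy martingale $Z(t)=(Z_1(t),Z_2(t))$ have independent coordinates of infinite variation, with nonnegative jumps, and with Laplace exponents varying regularly at $0$ with indices $\alpha_1,\alpha_2$, respectively, where $2\ge\alpha_1\ge\alpha_2>1$. I) If $\tilde J_\mu$ is of the form $$\tilde J_\mu(b)=\eta_1b^{\alpha_1},\qquad b\ge0,\quad\text{with } \eta_1>0,$$ then $(G,Z)$ is a generating pair if and only if one of the following two cases holds: a) $$G(x)=c_0\,x^{1/\alpha_1}\cdot\begin{pmatrix}\bar G_1\\ \bar G_2\end{pmatrix},\qquad x\ge0,$$ where $c_0>0$, $\bar G_1>0$, $\bar G_2>0$ are constants, and the process $\bar G_1Z_1(t)+\bar G_2Z_2(t)$, $t\ge0$, is $\alpha_1$-stable. b) $G(x)$ is such that $$c_1G_1^{\alpha_1}(x)+c_2G_2^{\alpha_1}(x)=\eta_1x,\qquad x\ge0,$$ with some constants $c_1,c_2>0$, and $Z_1,Z_2$ are $\alpha_1$-stable processes. II) If $\tilde J_\mu$ is of the form $$\tilde J_\mu(b)=\eta_1b^{\alpha_1}+\eta_2b^{\alpha_2},\qquad b\ge0,\quad\text{with } \eta_1,\eta_2>0,\ 2\ge\alpha_1>\alpha_2>1,$$ then $(G,Z)$ is a generating pair if and only if $$G_1(x)=\Big(\frac{\eta_1}{c_1}x\Big)^{1/\alpha_1},\qquad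 G_2(x)=\Big(\frac{\eta_2}{c_2}x\Big)^{1/\alpha_2},\qquad x\ge0,$$ with $c_1,c_2>0$, and $Z_1$ is $\alpha_1$-stable, $Z_2$ is $\alpha_2$-stable.
   Context: A L\'evy martingale is a L\'evy process which is a martingale. The Laplace exponent $J_i$ of $Z_i$ is defined by $\mathbb{E}[e^{-bZ_i(t)}]=e^{tJ_i(b)}$, $b\ge0$. It varies regularly at $0$ with index $\alpha_i$ if $\lim_{x\to0^+}J_i(bx)/J_i(x)=b^{\alpha_i}$ for all $b>0$. A $2$-stable process is a Wiener process; an $\alpha$-stable process with $\alpha\in(1,2)$ has here positive jumps only. Let $Q$ be the covariance matrix of the Wiener part of $Z$, $\nu$ the L\'evy measure of $Z$, and $\nu_{G(x)}(A):=\nu\{y\in\mathbb{R}^2:\langle G(x),y\rangle\in A\}$ for Borel $A\subseteq\mathbb{R}$. The pair $(G,Z)$ is called a generating pair if $\int_{(0,+\infty)}v\,\nu_{G(0)}(dv)<+\infty$ and there are a constant $c\ge0$ and a measure $\mu$ on $(0,+\infty)$ with $\int_{(0,+\infty)}(v\wedge v^2)\,\mu(dv)<+\infty$ such that for all $x\ge0$ $$\tfrac12\langle QG(x),G(x)\rangle=cx,\qquad \nu_{G(x)}(dv)|_{(0,+\infty)}=\nu_{G(0)}(dv)|_{(0,+\infty)}+x\,\mu(dv).$$ With these $c$ and $\mu$, $\tilde J_\mu(b):=cb^2+\int_0^{+\infty}(e^{-bv}-1+bv)\,\mu(dv)$, $b\ge0$. In the present setting generating pairs are such that $J_1(bG_1(x))+J_2(bG_2(x))=x\tilde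 J_\mu(b)$ for $b,x\ge0$, and $\tilde J_\mu$ takes one of the two forms considered in I) and II).
   Formalization: In case I b) the constants c_1, c_2 are required to be the coefficients of the Laplace exponents, J_i(b) = c_i b^{α_1} for b ≥ 0; with unrelated constants c_1, c_2 > 0 the "if" direction is false. *)

theory Defs
  imports "HOL-Probability.Probability"
begin

text \<open>
  A stochastic process is a family \<open>X :: real \<Rightarrow> 'w \<Rightarrow> 'b\<close>; only times \<open>t \<ge> 0\<close> are ever used.
\<close>

definition process_algebra ::
  "'w measure \<Rightarrow> (real \<Rightarrow> 'w \<Rightarrow> 'b::topological_space) \<Rightarrow> real set \<Rightarrow> 'w measure" where
  "process_algebra M X T =
     sigma (space M) (\<Union>t\<in>T. {X t -` A \<inter> space M | A. A \<in> sets borel})"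

definition indep_processes ::
  "'w measure \<Rightarrow> (real \<Rightarrow> 'w \<Rightarrow> 'b::topological_space) \<Rightarrow> (real \<Rightarrow> 'w \<Rightarrow> 'c::topological_space) \<Rightarrow> bool" where
  "indep_processes M X Y \<longleftrightarrow>
     prob_space.indep_set M (sets (process_algebra M X {0..})) (sets (process_algebra M Y {0..}))"

definition cadlag :: "(real \<Rightarrow> 'b::topological_space) \<Rightarrow> bool" where
  "cadlag f \<longleftrightarrow> (\<forall>t\<ge>0. (f \<longlongrightarrow> f t) (at_right t)) \<and> (\<forall>t>0. \<exists>l. (f \<longlongrightarrow> l) (at_left t))"

definition levy_process ::
  "'w measure \<Rightarrow> (real \<Rightarrow> 'w \<Rightarrow> 'b::euclidean_space) \<Rightarrow> bool" where
  "levy_process M X \<longleftrightarrow>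
     prob_space M \<and>
     (\<forall>t\<ge>0. X t \<in> borel_measurable M) \<and>
     (AE \<omega> in M. X 0 \<omega> = 0) \<and>
     (\<forall>n. \<forall>\<tau>::nat \<Rightarrow> real. 0 \<le> \<tau> 0 \<and> mono \<tau> \<longrightarrow>
        prob_space.indep_vars M (\<lambda>_. borel) (\<lambda>k \<omega>. X (\<tau> (Suc k)) \<omega> - X (\<tau> k) \<omega>) {..<n}) \<and>
     (\<forall>s\<ge>0. \<forall>h\<ge>0. distr M borel (\<lambda>\<omega>. X (s + h) \<omega> - X s \<omega>) = distr M borel (X h)) \<and>
     (AE \<omega> in M. cadlag (\<lambda>t. X t \<omega>))"

text \<open>Martingale with respect to the natural filtration; conditional expectations are taken
  coordinatewise.\<close>

definition martingale_process ::
  "'w measure \<Rightarrow> (real \<Rightarrow> 'w \<Rightarrow> 'b::euclidean_space) \<Rightarrow> bool" where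
  "martingale_process M X \<longleftrightarrow>
     (\<forall>t\<ge>0. integrable M (X t)) \<and>
     (\<forall>s\<ge>0. \<forall>t\<ge>s. \<forall>e\<in>Basis.
        AE \<omega> in M. real_cond_exp M (process_algebra M X {0..s}) (\<lambda>\<omega>. X t \<omega> \<bullet> e) \<omega> = X s \<omega> \<bullet> e)"

definition levy_martingale ::
  "'w measure \<Rightarrow> (real \<Rightarrow> 'w \<Rightarrow> 'b::euclidean_space) \<Rightarrow> bool" where
  "levy_martingale M X \<longleftrightarrow> levy_process M X \<and> martingale_process M X"

text \<open>No left limit of a path exceeds the value of the path.\<close>

definition nonneg_jumps :: "'w measure \<Rightarrow> (real \<Rightarrow> 'w \<Rightarrow> real) \<Rightarrow> bool" where
  "nonneg_jumps M X \<longleftrightarrow>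
     (AE \<omega> in M. \<forall>t>0. \<forall>l. ((\<lambda>s. X s \<omega>) \<longlongrightarrow> l) (at_left t) \<longrightarrow> l \<le> X t \<omega>)"

definition finite_variation :: "(real \<Rightarrow> real) \<Rightarrow> real \<Rightarrow> bool" where
  "finite_variation f t \<longleftrightarrow>
     (\<exists>B. \<forall>n. \<forall>\<tau>::nat \<Rightarrow> real. mono \<tau> \<and> range \<tau> \<subseteq> {0..t} \<longrightarrow>
        (\<Sum>k<n. \<bar>f (\<tau> (Suc k)) - f (\<tau> k)\<bar>) \<le> B)"

definition infinite_variation :: "'w measure \<Rightarrow> (real \<Rightarrow> 'w \<Rightarrow> real) \<Rightarrow> bool" where
  "infinite_variation M X \<longleftrightarrow>
     (AE \<omega> in M. \<forall>t>0. \<not> finite_variation (\<lambda>s. X s \<omega>) t)"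

text \<open>The generating triplet of the Levy-Khintchine formula: \<open>a\<close> is the drift, \<open>Q\<close> the covariance
  matrix of the Wiener part and \<open>\<nu>\<close> the Levy measure. A Levy process has exactly one triplet.\<close>

definition levy_exponent ::
  "real^'n \<Rightarrow> real^'n^'n \<Rightarrow> (real^'n) measure \<Rightarrow> real^'n \<Rightarrow> complex" where
  "levy_exponent a Q \<nu> u =
     \<i> * of_real (a \<bullet> u) - of_real ((Q *v u) \<bullet> u) / 2
     + (LINT y|\<nu>. iexp (u \<bullet> y) - 1 - (if norm y \<le> 1 then \<i> * of_real (u \<bullet> y) else 0))"

definition levy_triplet ::
  "'w measure \<Rightarrow> (real \<Rightarrow> 'w \<Rightarrow> real^'n) \<Rightarrow> real^'n \<Rightarrow> real^'n^'n \<Rightarrow> (real^'n) measure \<Rightarrow> bool" where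
  "levy_triplet M X a Q \<nu> \<longleftrightarrow>
     transpose Q = Q \<and> (\<forall>u. 0 \<le> (Q *v u) \<bullet> u) \<and>
     sets \<nu> = sets borel \<and> emeasure \<nu> {0} = 0 \<and>
     (\<integral>\<^sup>+ y. ennreal (min 1 ((norm y)\<^sup>2)) \<partial>\<nu>) < \<infinity> \<and>
     (\<forall>t\<ge>0. \<forall>u. (LINT \<omega>|M. iexp (u \<bullet> X t \<omega>)) = exp (of_real t * levy_exponent a Q \<nu> u))"

definition is_laplace_exponent ::
  "'w measure \<Rightarrow> (real \<Rightarrow> 'w \<Rightarrow> real) \<Rightarrow> (real \<Rightarrow> real) \<Rightarrow> bool" where
  "is_laplace_exponent M X J \<longleftrightarrow>
     (\<forall>t\<ge>0. \<forall>b\<ge>0. integrable M (\<lambda>\<omega>. exp (- b * X t \<omega>)) \<and>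
        (LINT \<omega>|M. exp (- b * X t \<omega>)) = exp (t * J b))"

definition varies_regularly_at_0 :: "(real \<Rightarrow> real) \<Rightarrow> real \<Rightarrow> bool" where
  "varies_regularly_at_0 J \<alpha> \<longleftrightarrow>
     (\<forall>b>0. ((\<lambda>x. J (b * x) / J x) \<longlongrightarrow> b powr \<alpha>) (at_right 0))"

text \<open>A Wiener process here may have any variance parameter \<open>\<sigma>\<^sup>2 > 0\<close>.\<close>

definition wiener_process :: "'w measure \<Rightarrow> (real \<Rightarrow> 'w \<Rightarrow> real) \<Rightarrow> bool" where
  "wiener_process M X \<longleftrightarrow>
     levy_process M X \<and>
     (\<exists>\<sigma>>0. \<forall>t>0. distributed M lborel (X t) (normal_density 0 (\<sigma> * sqrt t))) \<and>
     (AE \<omega> in M. continuous_on {0..} (\<lambda>t. X t \<omega>))"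

text \<open>For \<open>\<alpha> < 2\<close>: a Levy process whose law at time 1 is non-degenerate and stable of index \<open>\<alpha>\<close>
  (the \<open>k\<close>-th convolution power, which is the law at time \<open>k\<close>, is a translate of the law scaled by
  \<open>k powr (1/\<alpha>)\<close>), without negative jumps. Index 2 means a Wiener process.\<close>

definition stable_process :: "'w measure \<Rightarrow> real \<Rightarrow> (real \<Rightarrow> 'w \<Rightarrow> real) \<Rightarrow> bool" where
  "stable_process M \<alpha> X \<longleftrightarrow>
     (if \<alpha> = 2 then wiener_process M X
      else 0 < \<alpha> \<and> \<alpha> < 2 \<and> levy_process M X \<and> nonneg_jumps M X \<and>
        \<not> (\<exists>d. AE \<omega> in M. X 1 \<omega> = d) \<and>
        (\<forall>k>0. \<exists>d. distr M borel (X k) = distr M borel (\<lambda>\<omega>. k powr (1 / \<alpha>) * X 1 \<omega> + d)))"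

text \<open>The image \<open>\<nu>\<^sub>g\<close> of the Levy measure under \<open>y \<mapsto> \<langle>g, y\<rangle>\<close>; it may have infinite mass at 0.\<close>

definition proj_measure :: "(real^'n) measure \<Rightarrow> real^'n \<Rightarrow> real measure" where
  "proj_measure \<nu> g = distr \<nu> borel (\<lambda>y. g \<bullet> y)"

text \<open>The conditions on \<open>c\<close> and \<open>\<mu>\<close> in the definition of a generating pair. Measures on
  \<open>(0,\<infinity>)\<close> are Borel measures on the line that do not charge \<open>{..0}\<close>. The process \<open>Z\<close> enters only
  through \<open>Q\<close> and \<open>\<nu>\<close>.\<close>

definition generating_data ::
  "(real \<Rightarrow> real^'n) \<Rightarrow> real^'n^'n \<Rightarrow> (real^'n) measure \<Rightarrow> real \<Rightarrow> real measure \<Rightarrow> bool" where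
  "generating_data G Q \<nu> c \<mu> \<longleftrightarrow>
     0 \<le> c \<and> sets \<mu> = sets borel \<and> emeasure \<mu> {..0} = 0 \<and>
     (\<integral>\<^sup>+ v\<in>{0<..}. ennreal (min v (v\<^sup>2)) \<partial>\<mu>) < \<infinity> \<and>
     (\<forall>x\<ge>0. (Q *v G x) \<bullet> G x / 2 = c * x) \<and>
     (\<forall>x\<ge>0. \<forall>A\<in>sets borel. A \<subseteq> {0<..} \<longrightarrow>
        emeasure (proj_measure \<nu> (G x)) A
          = emeasure (proj_measure \<nu> (G 0)) A + ennreal x * emeasure \<mu> A)"

definition generating_pair ::
  "(real \<Rightarrow> real^'n) \<Rightarrow> real^'n^'n \<Rightarrow> (real^'n) measure \<Rightarrow> bool" where
  "generating_pair G Q \<nu> \<longleftrightarrow>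
     (\<integral>\<^sup>+ v\<in>{0<..}. ennreal v \<partial>(proj_measure \<nu> (G 0))) < \<infinity> \<and>
     (\<exists>c \<mu>. generating_data G Q \<nu> c \<mu>)"

definition J_tilde :: "real \<Rightarrow> real measure \<Rightarrow> real \<Rightarrow> real" where
  "J_tilde c \<mu> b = c * b\<^sup>2 + (LINT v:{0<..}|\<mu>. exp (- b * v) - 1 + b * v)"

text \<open>\<open>J_tilde\<close> of the pair is the function \<open>f\<close>. The data \<open>c\<close> and \<open>\<mu>\<close> are determined by the pair
  (take \<open>x = 1\<close>), so the quantifier ranges over at most the one relevant choice; if there is none,
  the pair is not generating and the form of \<open>J_tilde\<close> imposes nothing.\<close>

definition J_tilde_has_form ::
  "(real \<Rightarrow> real^'n) \<Rightarrow> real^'n^'n \<Rightarrow> (real^'n) measure \<Rightarrow> (real \<Rightarrow> real) \<Rightarrow> bool" where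
  "J_tilde_has_form G Q \<nu> f \<longleftrightarrow>
     (\<forall>c \<mu>. generating_data G Q \<nu> c \<mu> \<longrightarrow> (\<forall>b\<ge>0. J_tilde c \<mu> b = f b))"

end

theory Submission
  imports Defs "HOL-Complex_Analysis.Conformal_Mappings" "HOL-Real_Asymp.Real_Asymp"
begin

text \<open>The idea is to look at \<open>Z\<close> only through the real processes \<open>g \<bullet> Z\<close> with \<open>g\<close> in the closed positive
  quadrant. Each of them is a Levy martingale without downward jumps; its Levy measure is the image of
  \<open>\<nu>\<close> under \<open>y \<mapsto> g \<bullet> y\<close>, its Gaussian variance is \<open>(Q *v g) \<bullet> g\<close>, and by independence its Laplace
  exponent is \<open>J\<^sub>1 (b g\<^sub>1) + J\<^sub>2 (b g\<^sub>2)\<close> (\<open>projection_spectrally_positive\<close>).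

  For such a process, \<open>laplace_exponent_formula\<close> expresses the Laplace exponent by the Gaussian variance
  and the Levy measure. The triplet, however, is given through characteristic functions and the absence of
  downward jumps through the paths. The link is the small-time limit \<open>weighted_limit\<close>: for small \<open>h\<close>, the law
  of \<open>X h\<close> divided by \<open>h\<close> is close to the Levy measure, with the Gaussian part concentrated at 0. Path
  regularity makes \<open>P (X h < - \<epsilon>)\<close> of smaller order than \<open>h\<close>, so the Levy measure lives on the positive half
  line (\<open>levy_measure_nonneg\<close>); testing with \<open>exp (- b x) - 1 + b x\<close> yields the formula.

  Conversely, a Laplace exponent determines the marginal laws of the process (\<open>bilateral_laplace_unique\<close>), the
  Gaussian variance (\<open>gaussian_part_limit\<close>) and the Levy measure (\<open>levy_measure_unique\<close>). Hence stability
  of index \<open>\<alpha>\<close> means that the exponent is a multiple of \<open>b powr \<alpha>\<close> (\<open>stable_if_power\<close>,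
  \<open>power_if_stable\<close>), and, once \<open>G 0 = 0\<close>, \<open>(G, Z)\<close> is a generating pair exactly if
  \<open>J\<^sub>1 (b G\<^sub>1 x) + J\<^sub>2 (b G\<^sub>2 x)\<close> is proportional to \<open>x\<close>. That \<open>G 0 = 0\<close> is forced by the infinite variation of
  the coordinates (\<open>generating_data_zero\<close>).

  The classification thus becomes the functional equation
  \<open>J\<^sub>1 (b G\<^sub>1 x) + J\<^sub>2 (b G\<^sub>2 x) = x f b\<close> with \<open>f\<close> a combination of powers. If \<open>G\<^sub>2 / G\<^sub>1\<close> is constant, \<open>G\<close> moves on
  a ray and the equation determines its speed. If it takes two different values, eliminating \<open>J\<^sub>1\<close> leaves
  \<open>J\<^sub>2 (s t) - J\<^sub>2 s\<close> equal to a combination of powers for one factor \<open>t \<noteq> 1\<close>, and then \<open>J\<^sub>2\<close> itself is one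
  (\<open>scaling_equation_solution\<close>). Regular variation at 0 and positivity decide which powers occur.\<close>

section \<open>Laplace transforms on a half line\<close>

lemma real_distribution_normalized:
  fixes L :: "real measure"
  assumes "finite_measure L" and sets: "sets L = sets borel" and pos: "0 < measure L UNIV"
  shows "real_distribution (density L (\<lambda>_. ennreal (1 / measure L UNIV)))"
proof -
  interpret finite_measure L by fact
  note [measurable_cong] = sets
  have "space L = UNIV" using sets[THEN sets_eq_imp_space_eq] by simp
  then have "prob_space (density L (\<lambda>_. ennreal (1 / measure L UNIV)))"
    using pos by (intro prob_spaceI)
      (simp add: emeasure_density emeasure_eq_measure ennreal_mult[symmetric])
  then show ?thesis
    using sets by (simp add: real_distribution_def real_distribution_axioms_def)
qed

text \<open>The transform at 0 is the total mass, so both measures can be normalized to laws with the same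
  characteristic function.\<close>

lemma finite_measure_char_unique:
  fixes M N :: "real measure"
  assumes "finite_measure M" "finite_measure N"
    and sets: "sets M = sets borel" "sets N = sets borel"
    and eq: "\<And>u. (LINT x|M. iexp (u * x)) = (LINT x|N. iexp (u * x))"
  shows "M = N"
proof -
  interpret M: finite_measure M by fact
  interpret N: finite_measure N by fact
  note [measurable_cong] = sets
  have space: "space M = UNIV" "space N = UNIV"
    using sets[THEN sets_eq_imp_space_eq] by auto
  define T where "T = measure M UNIV"
  have T: "T = measure N UNIV"
    using eq[of 0] space by (simp add: T_def)
  show ?thesis
  proof (cases "T = 0")
    case True
    then have "emeasure M UNIV = 0" "emeasure N UNIV = 0"
      using T by (auto simp: T_def M.emeasure_eq_measure N.emeasure_eq_measure)
    then have "emeasure M A = 0" "emeasure N A = 0" for A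
      by (auto intro: emeasure_eq_0[of UNIV] simp: sets)
    then show ?thesis
      by (intro measure_eqI) (simp_all add: sets)
  next
    case False
    then have Tpos: "T > 0" using T_def by (simp add: zero_less_measure_iff)
    have "density M (\<lambda>_. ennreal (1 / T)) = density N (\<lambda>_. ennreal (1 / T))"
    proof (rule Levy_uniqueness)
      show "char (density M (\<lambda>_. ennreal (1 / T))) = char (density N (\<lambda>_. ennreal (1 / T)))"
        using Tpos eq by (auto simp: char_def fun_eq_iff integral_density)
    qed (use real_distribution_normalized[OF assms(1) sets(1)] real_distribution_normalized[OF assms(2) sets(2)] Tpos
        in \<open>simp_all add: T_def[symmetric] T[symmetric]\<close>)
    then have "density (density M (\<lambda>_. ennreal (1 / T))) (\<lambda>_. ennreal T)
      = density (density N (\<lambda>_. ennreal (1 / T))) (\<lambda>_. ennreal T)" by simp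
    then show ?thesis
      using Tpos by (simp add: density_density_eq ennreal_mult[symmetric] density_1)
  qed
qed

text \<open>The total masses converge, by the case \<open>u = 0\<close>. If the limiting mass is positive, Levy's continuity
  theorem applies to the normalized measures; if it is 0, boundedness of \<open>f\<close> suffices.\<close>

lemma finite_levy_continuity:
  fixes m :: "nat \<Rightarrow> real measure" and \<rho> :: "real measure" and f :: "real \<Rightarrow> real"
  assumes fin: "\<And>n. finite_measure (m n)" "finite_measure \<rho>"
    and sets: "\<And>n. sets (m n) = sets borel" "sets \<rho> = sets borel"
    and lim: "\<And>u. (\<lambda>n. LINT x|m n. iexp (u * x)) \<longlonglongrightarrow> (LINT x|\<rho>. iexp (u * x))"
    and f: "continuous_on UNIV f" "\<And>x. \<bar>f x\<bar> \<le> B"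
  shows "(\<lambda>n. LINT x|m n. f x) \<longlonglongrightarrow> (LINT x|\<rho>. f x)"
proof -
  interpret m: finite_measure "m n" for n by fact
  interpret \<rho>: finite_measure \<rho> by fact
  note [measurable_cong] = sets
  have space: "space (m n) = UNIV" "space \<rho> = UNIV" for n
    using sets[THEN sets_eq_imp_space_eq] by auto
  have [measurable]: "f \<in> borel_measurable borel"
    using f(1) by (rule borel_measurable_continuous_onI)
  define T where "T n = measure (m n) UNIV" for n
  define T' where "T' = measure \<rho> UNIV"
  have "(\<lambda>n. complex_of_real (T n)) \<longlonglongrightarrow> of_real T'"
    using lim[of 0] space by (simp add: T_def T'_def scaleR_conv_of_real)
  then have TT: "T \<longlonglongrightarrow> T'"
    by (simp only: tendsto_of_real_iff)
  show ?thesis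
  proof (cases "T' = 0")
    case True
    have "\<bar>LINT x|m n. f x\<bar> \<le> B * T n" for n
    proof -
      have "\<bar>LINT x|m n. f x\<bar> \<le> (LINT x|m n. \<bar>f x\<bar>)" by (rule integral_abs_bound)
      also have "\<dots> \<le> (LINT x|m n. B)"
        by (rule integral_mono) (auto intro!: m.integrable_const_bound[of _ B] simp: f)
      finally show ?thesis unfolding T_def by (subst mult.commute) (simp add: space)
    qed
    then have bound: "norm (LINT x|m n. f x) \<le> B * T n" for n by simp
    have "(\<lambda>n. B * T n) \<longlonglongrightarrow> B * 0"
      by (intro tendsto_mult tendsto_const TT[unfolded True])
    then have "(\<lambda>n. B * T n) \<longlonglongrightarrow> 0" by simp
    then have lim0: "(\<lambda>n. LINT x|m n. f x) \<longlonglongrightarrow> 0"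
      by (rule Lim_null_comparison[rotated]) (simp only: bound eventually_True)
    have "emeasure \<rho> UNIV = 0"
      using True by (simp add: T'_def \<rho>.emeasure_eq_measure)
    then have "AE x in \<rho>. f x = 0"
      by (intro AE_I[of _ _ UNIV]) (auto simp: space sets)
    then have "(LINT x|\<rho>. f x) = 0"
      by (rule integral_eq_zero_AE)
    with lim0 show ?thesis by simp
  next
    case False
    then have T'pos: "T' > 0" using T'_def by (simp add: zero_less_measure_iff)
    have "eventually (\<lambda>n. T n > 0) sequentially"
      using TT T'pos by (rule order_tendstoD)
    then obtain N where N: "\<And>n. n \<ge> N \<Longrightarrow> T n > 0" by (auto simp: eventually_sequentially)
    define P where "P n = density (m (n + N)) (\<lambda>_. ennreal (1 / T (n + N)))" for n
    define P' where "P' = density \<rho> (\<lambda>_. ennreal (1 / T'))"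
    have TN: "T (n + N) > 0" for n using N by simp
    then have TN': "T (n + N) \<noteq> 0" "0 \<le> T (n + N)" for n
      by (auto simp: order_less_le)
    have T'nn: "0 \<le> T'" using T'pos by simp
    have rdP: "real_distribution (P n)" "real_distribution P'" for n
      using real_distribution_normalized[OF fin(1) sets(1), of "n + N"] real_distribution_normalized[OF fin(2) sets(2)] TN[of n] T'pos
      by (auto simp: P_def P'_def T_def T'_def)
    have TT': "(\<lambda>n. T (n + N)) \<longlonglongrightarrow> T'" using TT by (rule LIMSEQ_ignore_initial_segment)
    have "weak_conv_m P P'"
    proof (rule levy_continuity[OF rdP])
      fix t
      have "(\<lambda>n. (1 / T (n + N)) *\<^sub>R (LINT x|m (n + N). iexp (t * x)))
          \<longlonglongrightarrow> (1 / T') *\<^sub>R (LINT x|\<rho>. iexp (t * x))"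
        using T'pos
        by (intro tendsto_intros TT' LIMSEQ_ignore_initial_segment[OF lim]) auto
      then show "(\<lambda>n. char (P n) t) \<longlonglongrightarrow> char P' t"
        by (simp add: char_def P_def P'_def integral_density TN' T'nn)
    qed
    then have "(\<lambda>n. LINT x|P n. f x) \<longlonglongrightarrow> (LINT x|P'. f x)"
      using f rdP
      by (intro weak_conv_imp_integral_bdd_continuous_conv[of P P' f B])
         (auto simp: continuous_on_eq_continuous_at)
    then have "(\<lambda>n. (1 / T (n + N)) * (LINT x|m (n + N). f x)) \<longlonglongrightarrow> (1 / T') * (LINT x|\<rho>. f x)"
      by (simp add: P_def P'_def integral_density TN' T'nn)
    from tendsto_mult[OF TT' this]
    have "(\<lambda>n. (LINT x|m (n + N). f x)) \<longlonglongrightarrow> (LINT x|\<rho>. f x)"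
      using TN'(1) T'pos by simp
    then show ?thesis by (rule LIMSEQ_offset)
  qed
qed

text \<open>The error of the difference quotient at \<open>z\<close> is bounded by the second-order remainder of \<open>exp\<close>. For
  \<open>|h| \<le> a / 2\<close>, where \<open>a\<close> is the real part of \<open>z\<close>, this remainder has the integrable majorant
  \<open>|h|\<^sup>2 const (1 + exp (- 2 a x))\<close>.\<close>

lemma bilateral_laplace_holomorphic:
  fixes M :: "real measure"
  assumes "finite_measure M" and sets: "sets M = sets borel"
    and int: "\<And>b. b \<ge> 0 \<Longrightarrow> integrable M (\<lambda>x. exp (- b * x))"
  shows "(\<lambda>z. LINT x|M. exp (- z * complex_of_real x)) holomorphic_on {z. Re z > 0}"
proof -
  interpret finite_measure M by fact
  note [measurable_cong] = sets
  have integ: "integrable M (\<lambda>x. exp (- z * complex_of_real x))" if "Re z \<ge> 0" for z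
    by (rule Bochner_Integration.integrable_bound[OF int[OF that]]) auto
  have "\<exists>D. ((\<lambda>z. LINT x|M. exp (- z * complex_of_real x)) has_field_derivative D) (at z)"
    if z: "Re z > 0" for z
  proof -
    define a where "a = Re z"
    have a: "a > 0" using z by (simp add: a_def)
    \<comment> \<open>from \<open>y\<^sup>2 / 2 \<le> exp y\<close> with \<open>y = a |x| / 2\<close>, and \<open>exp (a |x| - a x) \<le> 1 + exp (- 2 a x)\<close>\<close>
    define H where "H x = 8 / a\<^sup>2 * (1 + exp (- (2 * a) * x))" for x
    have Hint: "integrable M H"
      unfolding H_def using a int[of "2 * a"] by auto
    have xbound: "x\<^sup>2 * exp (a / 2 * \<bar>x\<bar>) * exp (- a * x) \<le> H x" for x
    proof -
      have "(a / 2 * \<bar>x\<bar>)\<^sup>2 / 2 \<le> exp (a / 2 * \<bar>x\<bar>)"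
        using exp_lower_Taylor_quadratic[of "a / 2 * \<bar>x\<bar>"] a
        by (smt (verit) divide_nonneg_nonneg mult_nonneg_nonneg)
      then have "x\<^sup>2 \<le> 8 / a\<^sup>2 * exp (a / 2 * \<bar>x\<bar>)"
        using a by (simp add: field_simps power2_eq_square)
      then have "x\<^sup>2 * exp (a / 2 * \<bar>x\<bar>) * exp (- a * x)
          \<le> 8 / a\<^sup>2 * exp (a / 2 * \<bar>x\<bar>) * exp (a / 2 * \<bar>x\<bar>) * exp (- a * x)"
        by (intro mult_right_mono) auto
      also have "\<dots> = 8 / a\<^sup>2 * exp (a * \<bar>x\<bar> - a * x)"
        by (simp add: exp_add[symmetric] mult.assoc exp_diff exp_minus field_simps)
      also have "\<dots> \<le> H x"
      proof -
        have "exp (a * \<bar>x\<bar> - a * x) \<le> 1 + exp (- (2 * a) * x)"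
          by (cases "x \<ge> 0") (simp_all add: mult.assoc)
        then show ?thesis unfolding H_def by (rule mult_left_mono) simp
      qed
      finally show ?thesis .
    qed
    have xbound1: "\<bar>x\<bar> * exp (- a * x) \<le> H x + exp (- a * x)" for x
    proof -
      have "\<bar>x\<bar> \<le> x\<^sup>2 * exp (a / 2 * \<bar>x\<bar>) + 1"
      proof (cases "\<bar>x\<bar> \<le> 1")
        case False
        then have "\<bar>x\<bar> * 1 \<le> \<bar>x\<bar> * \<bar>x\<bar>" by (intro mult_left_mono) auto
        also have "\<dots> \<le> x\<^sup>2 * exp (a / 2 * \<bar>x\<bar>)"
          using a mult_left_mono[of 1 "exp (a / 2 * \<bar>x\<bar>)" "x\<^sup>2"] by (simp add: power2_eq_square)
        finally show ?thesis by simp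
      qed (smt (verit) mult_nonneg_nonneg zero_le_power2 exp_ge_zero)
      then have "\<bar>x\<bar> * exp (- a * x) \<le> (x\<^sup>2 * exp (a / 2 * \<bar>x\<bar>) + 1) * exp (- a * x)"
        by (intro mult_right_mono) auto
      then show ?thesis using xbound[of x] by (simp add: distrib_right)
    qed
    have Dint: "integrable M (\<lambda>x. - complex_of_real x * exp (- z * complex_of_real x))"
    proof (rule Bochner_Integration.integrable_bound)
      show "integrable M (\<lambda>x. H x + exp (- a * x))" using Hint int[of a] a by auto
      show "AE x in M. norm (- complex_of_real x * exp (- z * complex_of_real x)) \<le> norm (H x + exp (- a * x))"
        using xbound1 by (auto simp: norm_mult a_def intro!: AE_I2 order_trans[OF _ abs_ge_self])
    qed auto
    define D where "D = (LINT x|M. - complex_of_real x * exp (- z * complex_of_real x))"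
    let ?F = "\<lambda>z. LINT x|M. exp (- z * complex_of_real x)"
    have main: "norm ((?F (z + h) - ?F z) / h - D) \<le> norm h * (LINT x|M. H x)"
      if h: "h \<noteq> 0" "norm h \<le> a / 2" for h
    proof -
      have Reh: "Re (z + h) \<ge> 0" using h(2) abs_Re_le_cmod[of h] a by (simp add: a_def)
      have pw: "norm (exp (- (z + h) * complex_of_real x) - exp (- z * complex_of_real x)
          - h * (- complex_of_real x * exp (- z * complex_of_real x))) \<le> (norm h)\<^sup>2 * H x" for x
      proof -
        let ?w = "- h * complex_of_real x"
        have "exp (- (z + h) * complex_of_real x) - exp (- z * complex_of_real x)
          - h * (- complex_of_real x * exp (- z * complex_of_real x))
          = exp (- z * complex_of_real x) * (exp ?w - (1 + ?w))"
          by (simp add: exp_add[symmetric] algebra_simps)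
        also have "norm \<dots> = exp (- a * x) * norm (exp ?w - (1 + ?w))"
          by (simp add: norm_mult a_def)
        also have "norm (exp ?w - (1 + ?w)) \<le> exp \<bar>Re ?w\<bar> * norm ?w ^ 2"
          using Taylor_exp[of ?w 1] by (simp add: power2_eq_square)
        also have "\<dots> \<le> exp (a / 2 * \<bar>x\<bar>) * norm ?w ^ 2"
        proof -
          have "\<bar>Re ?w\<bar> \<le> norm h * \<bar>x\<bar>"
            using abs_Re_le_cmod[of ?w] by (simp add: norm_mult)
          also have "\<dots> \<le> a / 2 * \<bar>x\<bar>" using h(2) by (intro mult_right_mono) auto
          finally show ?thesis by (intro mult_right_mono) auto
        qed
        also have "norm ?w ^ 2 = (norm h)\<^sup>2 * x\<^sup>2"
          by (simp add: norm_mult power_mult_distrib)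
        finally have "norm (exp (- (z + h) * complex_of_real x) - exp (- z * complex_of_real x)
            - h * (- complex_of_real x * exp (- z * complex_of_real x)))
          \<le> (norm h)\<^sup>2 * (x\<^sup>2 * exp (a / 2 * \<bar>x\<bar>) * exp (- a * x))" by (simp add: mult_ac)
        also have "\<dots> \<le> (norm h)\<^sup>2 * H x"
          by (intro mult_left_mono xbound) auto
        finally show ?thesis .
      qed
      have "?F (z + h) - ?F z - h * D = (LINT x|M. exp (- (z + h) * complex_of_real x) - exp (- z * complex_of_real x)
          - h * (- complex_of_real x * exp (- z * complex_of_real x)))"
        using Dint integ[OF Reh] integ[of z] z by (simp add: D_def)
      also have "norm \<dots> \<le> (LINT x|M. (norm h)\<^sup>2 * H x)"
        by (rule order_trans[OF integral_norm_bound integral_mono])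
          (use Dint integ[OF Reh] integ[of z] z Hint pw in auto)
      finally have "norm (?F (z + h) - ?F z - h * D) \<le> (norm h)\<^sup>2 * (LINT x|M. H x)" by simp
      moreover have "(?F (z + h) - ?F z) / h - D = (?F (z + h) - ?F z - h * D) / h"
        using h by (simp add: field_simps)
      ultimately show ?thesis
        using h by (simp add: norm_divide power2_eq_square divide_le_eq mult_ac)
    qed
    have "((\<lambda>h. (?F (z + h) - ?F z) / h - D) \<longlongrightarrow> 0) (at 0)"
    proof (rule Lim_null_comparison)
      show "\<forall>\<^sub>F h in at 0. norm ((?F (z + h) - ?F z) / h - D) \<le> norm h * (LINT x|M. H x)"
        unfolding eventually_at using a main by (auto intro!: exI[of _ "a / 2"] simp: dist_norm)
      show "((\<lambda>h. norm h * (LINT x|M. H x)) \<longlongrightarrow> 0) (at (0::complex))"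
        by (auto intro!: tendsto_eq_intros)
    qed
    then have "((\<lambda>h. (?F (z + h) - ?F z) / h) \<longlongrightarrow> D) (at 0)" by (rule LIM_zero_cancel)
    then show ?thesis unfolding DERIV_def by (rule exI)
  qed
  moreover have "open {z. Re z > 0}" by (rule open_halfspace_Re_gt)
  ultimately show ?thesis
    by (auto simp: holomorphic_on_open)
qed

text \<open>The transforms agree on the positive real axis, hence on the open right half plane, hence by
  dominated convergence on the imaginary axis, where they are characteristic functions. The measures
  may charge both half lines.\<close>

lemma bilateral_laplace_unique:
  fixes M N :: "real measure"
  assumes fin: "finite_measure M" "finite_measure N"
    and sets: "sets M = sets borel" "sets N = sets borel"
    and int: "\<And>b. b \<ge> 0 \<Longrightarrow> integrable M (\<lambda>x. exp (- b * x))"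
      "\<And>b. b \<ge> 0 \<Longrightarrow> integrable N (\<lambda>x. exp (- b * x))"
    and eq: "\<And>b. b \<ge> 0 \<Longrightarrow> (LINT x|M. exp (- b * x)) = (LINT x|N. exp (- b * x))"
  shows "M = N"
proof (rule finite_measure_char_unique[OF fin sets])
  fix u
  let ?F = "\<lambda>M z. LINT x|M. exp (- z * complex_of_real x)"
  have zero: "?F M z - ?F N z = 0" if z: "Re z > 0" for z
  proof (rule analytic_continuation[where f="\<lambda>z. ?F M z - ?F N z" and S="{z. Re z > 0}"
        and U="complex_of_real ` {0<..}" and \<xi>=1])
    show "(\<lambda>z. ?F M z - ?F N z) holomorphic_on {z. Re z > 0}"
      by (intro holomorphic_intros bilateral_laplace_holomorphic fin sets int)
    show "connected {z. Re z > 0}" by (intro convex_connected convex_halfspace_Re_gt)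
    show "1 islimpt complex_of_real ` {0<..}"
    proof (rule islimptI)
      fix T assume T: "1 \<in> T" "open (T :: complex set)"
      then obtain e where e: "e > 0" "ball 1 e \<subseteq> T" by (meson openE)
      then have "complex_of_real (1 + e / 2) \<in> T"
        by (intro subsetD[OF e(2)]) (auto simp: dist_norm)
      moreover have "complex_of_real (1 + e / 2) \<noteq> 1"
        using e(1) by (metis add_cancel_left_right half_gt_zero less_irrefl of_real_eq_1_iff)
      moreover have "complex_of_real (1 + e / 2) \<in> complex_of_real ` {0<..}"
        using e by (intro imageI) simp
      ultimately show "\<exists>y\<in>complex_of_real ` {0<..}. y \<in> T \<and> y \<noteq> 1"
        by blast
    qed
    show "?F M w - ?F N w = 0" if "w \<in> complex_of_real ` {0<..}" for w
    proof -
      from that obtain b where b: "b > 0" "w = of_real b" by auto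
      have E: "exp (- w * complex_of_real x) = complex_of_real (exp (- b * x))" for x
        by (simp only: b exp_of_real flip: of_real_minus of_real_mult)
      show ?thesis unfolding E using eq[of b] b by simp
    qed
  qed (use z open_halfspace_Re_gt in auto)
  \<comment> \<open>approach the imaginary axis from inside the half plane\<close>
  have lim: "(\<lambda>n. ?F L (Complex (1 / Suc n) (- u))) \<longlonglongrightarrow> (LINT x|L. iexp (u * x))"
    if "finite_measure L" "sets L = sets borel" "\<And>b. b \<ge> 0 \<Longrightarrow> integrable L (\<lambda>x. exp (- b * x))"
    for L
  proof (rule integral_dominated_convergence[where w="\<lambda>x. 1 + exp (- 1 * x)"])
    interpret finite_measure L by fact
    note [measurable_cong] = that(2)
    show "integrable L (\<lambda>x. 1 + exp (- 1 * x))" using that(3)[of 1] by auto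
    show "(\<lambda>x. iexp (u * x)) \<in> borel_measurable L"
      "\<And>n. (\<lambda>x. exp (- Complex (1 / Suc n) (- u) * complex_of_real x)) \<in> borel_measurable L"
      by measurable
    have "(\<lambda>n. exp (- Complex (1 / Suc n) (- u) * complex_of_real x)) \<longlonglongrightarrow> iexp (u * x)" for x
    proof -
      have "(\<lambda>n. 1 / real (Suc n)) \<longlonglongrightarrow> 0" using LIMSEQ_Suc[OF lim_1_over_n] .
      then have "(\<lambda>n. exp (- (of_real (1 / Suc n) + \<i> * of_real (- u)) * complex_of_real x))
        \<longlonglongrightarrow> exp (- (of_real 0 + \<i> * of_real (- u)) * complex_of_real x)"
        by (intro tendsto_intros)
      then show ?thesis by (simp only: Complex_eq) (simp add: mult_ac)
    qed
    then show "AE x in L. (\<lambda>n. exp (- Complex (1 / Suc n) (- u) * complex_of_real x)) \<longlonglongrightarrow> iexp (u * x)"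
      by auto
    show "AE x in L. norm (exp (- Complex (1 / Suc n) (- u) * complex_of_real x)) \<le> 1 + exp (- 1 * x)" for n
    proof (rule AE_I2)
      fix x
      show "norm (exp (- Complex (1 / Suc n) (- u) * complex_of_real x)) \<le> 1 + exp (- 1 * x)"
      proof (cases "x \<ge> 0")
        case True
        then have "exp (- (x / (1 + real n))) \<le> 1" by simp
        then show ?thesis using True by (auto simp: add_increasing2)
      next
        case False
        then have "- (x / (1 + real n)) \<le> - x" by (simp add: field_simps mult_nonpos_nonneg)
        then have "exp (- (x / (1 + real n))) \<le> exp (- x)" by simp
        then show ?thesis by (simp add: add_increasing)
      qed
    qed
  qed
  have eq': "?F M (Complex (1 / Suc n) (- u)) = ?F N (Complex (1 / Suc n) (- u))" for n
    using zero[of "Complex (1 / Suc n) (- u)"] by simp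
  have "(\<lambda>n. ?F M (Complex (1 / Suc n) (- u))) \<longlonglongrightarrow> (LINT x|M. iexp (u * x))"
    by (rule lim) (use fin sets int in auto)
  moreover have "(\<lambda>n. ?F M (Complex (1 / Suc n) (- u))) \<longlonglongrightarrow> (LINT x|N. iexp (u * x))"
    unfolding eq' by (rule lim) (use fin sets int in auto)
  ultimately show "(LINT x|M. iexp (u * x)) = (LINT x|N. iexp (u * x))"
    by (rule LIMSEQ_unique)
qed

section \<open>Small-time limits of the marginal laws\<close>

text \<open>The Gaussian part of a Levy process appears in the small-time limit as a point mass at 0, to be added
  to a multiple of the Levy measure.\<close>

definition add_atom :: "real measure \<Rightarrow> real \<Rightarrow> real measure" where
  "add_atom N c = measure_of UNIV (sets borel)
     (\<lambda>A. emeasure N A + emeasure (scale_measure (ennreal c) (return borel 0)) A)"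

lemma sets_add_atom [simp, measurable_cong]: "sets (add_atom N c) = sets borel"
  unfolding add_atom_def using sets.sigma_sets_eq[of borel] by simp

lemma space_add_atom [simp]: "space (add_atom N c) = UNIV"
  using sets_add_atom[THEN sets_eq_imp_space_eq] by simp

lemma emeasure_add_atom:
  assumes "sets N = sets borel" "A \<in> sets borel"
  shows "emeasure (add_atom N c) A = emeasure N A + ennreal c * indicator A 0"
proof -
  let ?S = "scale_measure (ennreal c) (return borel (0::real))"
  have "emeasure (add_atom N c) A = emeasure N A + emeasure ?S A"
  proof (rule emeasure_measure_of[OF add_atom_def])
    show "positive (sets (add_atom N c)) (\<lambda>A. emeasure N A + emeasure ?S A)"
      by (simp add: positive_def)
    show "countably_additive (sets (add_atom N c)) (\<lambda>A. emeasure N A + emeasure ?S A)"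
      unfolding countably_additive_def
    proof safe
      fix F :: "nat \<Rightarrow> real set"
      assume F: "range F \<subseteq> sets (add_atom N c)" "disjoint_family F"
      then have "(\<Sum>i. emeasure N (F i)) = emeasure N (\<Union>i. F i)"
        "(\<Sum>i. emeasure ?S (F i)) = emeasure ?S (\<Union>i. F i)"
        using assms by (auto intro!: suminf_emeasure simp del: emeasure_scale_measure)
      then show "(\<Sum>i. emeasure N (F i) + emeasure ?S (F i))
        = emeasure N (\<Union>i. F i) + emeasure ?S (\<Union>i. F i)"
        by (simp add: suminf_add[symmetric] del: emeasure_scale_measure)
    qed
  qed (use assms in auto)
  then show ?thesis using assms by simp
qed

lemma nn_integral_add_atom:
  assumes N: "sets N = sets borel" and f: "f \<in> borel_measurable borel"
  shows "(\<integral>\<^sup>+x. f x \<partial>add_atom N c) = (\<integral>\<^sup>+x. f x \<partial>N) + ennreal c * f 0"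
proof -
  note [measurable_cong] = N
  have space: "space N = UNIV" using N[THEN sets_eq_imp_space_eq] by simp
  show ?thesis
    using f
  proof induction
    case (cong f g)
    then have "f = g" by auto
    with cong show ?case by simp
  next
    case (set A)
    then show ?case by (simp add: emeasure_add_atom N)
  next
    case (mult u a)
    then show ?case by (simp add: nn_integral_cmult distrib_left mult_ac)
  next
    case (add u v)
    then show ?case by (simp add: nn_integral_add distrib_left add_ac)
  next
    case (seq U)
    note [measurable] = seq(1)
    have U: "U i x \<le> U j x" if "i \<le> j" for i j x
      using \<open>incseq U\<close> that by (auto simp: incseq_def le_fun_def)
    have "(\<integral>\<^sup>+x. (SUP i. U i x) \<partial>add_atom N c) = (SUP i. \<integral>\<^sup>+x. U i x \<partial>add_atom N c)"
      using seq by (intro nn_integral_monotone_convergence_SUP) auto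
    also have "\<dots> = (SUP i. (\<integral>\<^sup>+x. U i x \<partial>N) + ennreal c * U i 0)"
      using seq by simp
    also have "\<dots> = (SUP i. (\<integral>\<^sup>+x. U i x \<partial>N)) + (SUP i. ennreal c * U i 0)"
      by (intro ennreal_SUP_add) (auto simp: incseq_def intro!: nn_integral_mono mult_left_mono U)
    also have "(SUP i. (\<integral>\<^sup>+x. U i x \<partial>N)) = (\<integral>\<^sup>+x. (SUP i. U i x) \<partial>N)"
      using seq by (intro nn_integral_monotone_convergence_SUP[symmetric]) auto
    also have "(SUP i. ennreal c * U i 0) = ennreal c * (SUP i. U i 0)"
      by (rule SUP_mult_left_ennreal[symmetric])
    finally show ?case by (simp add: SUP_apply image_comp)
  qed
qed

lemma integral_add_atom_real:
  fixes f :: "real \<Rightarrow> real"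
  assumes N: "sets N = sets borel" and f: "integrable N f" and c: "0 \<le> c"
  shows "integrable (add_atom N c) f" "(LINT x|add_atom N c. f x) = (LINT x|N. f x) + c * f 0"
proof -
  have [measurable]: "f \<in> borel_measurable borel"
    using borel_measurable_integrable[OF f] by (simp only: measurable_cong_sets[OF N refl])
  have fin: "(\<integral>\<^sup>+x. ennreal (f x) \<partial>N) < \<infinity>" "(\<integral>\<^sup>+x. ennreal (- f x) \<partial>N) < \<infinity>"
    using f by (auto simp: real_integrable_def top.not_eq_extremum)
  have nn: "(\<integral>\<^sup>+x. ennreal (f x) \<partial>add_atom N c) = (\<integral>\<^sup>+x. ennreal (f x) \<partial>N) + ennreal c * ennreal (f 0)"
    "(\<integral>\<^sup>+x. ennreal (- f x) \<partial>add_atom N c) = (\<integral>\<^sup>+x. ennreal (- f x) \<partial>N) + ennreal c * ennreal (- f 0)"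
    by (rule nn_integral_add_atom[OF N]; measurable)+
  have fin': "(\<integral>\<^sup>+x. ennreal (f x) \<partial>add_atom N c) < \<infinity>" "(\<integral>\<^sup>+x. ennreal (- f x) \<partial>add_atom N c) < \<infinity>"
    unfolding nn using fin by (auto simp: ennreal_mult_less_top)
  then show int: "integrable (add_atom N c) f"
    by (auto simp: real_integrable_def)
  have e: "enn2real (a + ennreal c * ennreal y) = enn2real a + c * max 0 y" if "a < \<infinity>" for a y
  proof (cases "y \<ge> 0")
    case True
    then show ?thesis using that c by (cases a) (simp_all add: ennreal_mult[symmetric] ennreal_plus[symmetric] max_absorb2 del: ennreal_plus)
  next
    case False
    then show ?thesis by (simp add: ennreal_neg)
  qed
  have "c * max 0 (f 0) - c * max 0 (- f 0) = c * f 0" by (simp add: max_def)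
  then show "(LINT x|add_atom N c. f x) = (LINT x|N. f x) + c * f 0"
    unfolding real_lebesgue_integral_def[OF int] real_lebesgue_integral_def[OF f] nn
      e[OF fin(1)] e[OF fin(2)] by linarith
qed

lemma integral_add_atom:
  fixes f :: "real \<Rightarrow> complex"
  assumes N: "sets N = sets borel" and f: "integrable N f" and c: "0 \<le> c"
  shows "(LINT x|add_atom N c. f x) = (LINT x|N. f x) + of_real c * f 0"
proof -
  have "integrable N (\<lambda>x. Re (f x))" "integrable N (\<lambda>x. Im (f x))" using f by auto
  note R = integral_add_atom_real[OF N this(1) c] and I = integral_add_atom_real[OF N this(2) c]
  have int: "integrable (add_atom N c) f"
    using Bochner_Integration.integrable_add[of "add_atom N c" "\<lambda>x. complex_of_real (Re (f x))" "\<lambda>x. \<i> * complex_of_real (Im (f x))"] R(1) I(1)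
    by (simp flip: complex_eq)
  show ?thesis
    using R(2) I(2) f int by (intro complex_eqI) simp_all
qed

lemma finite_measure_add_atom:
  assumes "finite_measure N" "sets N = sets borel"
  shows "finite_measure (add_atom N c)"
proof
  interpret finite_measure N by fact
  show "emeasure (add_atom N c) (space (add_atom N c)) \<noteq> \<infinity>"
    using assms(2) by (simp add: emeasure_add_atom ennreal_mult_eq_top_iff)
qed

lemma exp_difference_quotient:
  fixes z :: "'a :: {real_normed_field, banach}"
  shows "(\<lambda>n. of_nat (Suc n) * (exp (z / of_nat (Suc n)) - 1)) \<longlonglongrightarrow> z"
proof (cases "z = 0")
  case False
  have lim: "((\<lambda>h. (exp h - 1) / h) \<longlongrightarrow> 1) (at (0::'a))"
    using DERIV_exp[of "0::'a"] by (simp add: DERIV_def)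
  have "(\<lambda>n. z * inverse (of_nat (Suc n))) \<longlonglongrightarrow> z * 0"
    by (intro tendsto_mult tendsto_const LIMSEQ_Suc[OF lim_inverse_n])
  then have "filterlim (\<lambda>n. z / of_nat (Suc n)) (at 0) sequentially"
    using False by (auto simp: filterlim_at divide_inverse simp del: of_nat_Suc)
  from tendsto_mult[OF tendsto_const filterlim_compose[OF lim this], of z]
  have "(\<lambda>n. z * ((exp (z / of_nat (Suc n)) - 1) / (z / of_nat (Suc n)))) \<longlonglongrightarrow> z"
    by (simp del: of_nat_Suc)
  moreover have "z * ((exp (z / of_nat (Suc n)) - 1) / (z / of_nat (Suc n)))
      = of_nat (Suc n) * (exp (z / of_nat (Suc n)) - 1)" for n
    using False by (simp add: field_simps del: of_nat_Suc)
  ultimately show ?thesis by (simp only:)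
qed simp

text \<open>Weighting a law with \<open>1 - cos (s v)\<close> amounts to taking second differences of its characteristic
  function.\<close>

lemma second_difference_iexp:
  fixes u s v :: real
  shows "(1 - cos (s * v)) *\<^sub>R iexp (u * v) = iexp (u * v) - (iexp ((u + s) * v) + iexp ((u - s) * v)) / 2"
proof -
  have "iexp ((u + s) * v) + iexp ((u - s) * v) = iexp (u * v) * (iexp (s * v) + iexp (- (s * v)))"
    by (simp add: algebra_simps exp_add exp_diff exp_minus divide_inverse)
  also have "iexp (s * v) + iexp (- (s * v)) = of_real (2 * cos (s * v))"
    by (simp only: cis_conv_exp[symmetric]) (simp add: complex_eq_iff)
  finally show ?thesis by (simp add: scaleR_conv_of_real algebra_simps)
qed

text \<open>Of the characteristic exponent \<open>\<Psi>\<close> only the second differences are prescribed: drift and compensator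
  drop out of them, and the remaining integrals do not see the mass, possibly infinite, that \<open>\<kappa>\<close> may
  have at 0.\<close>

locale levy_marginals = prob_space M for M :: "'w measure" +
  fixes X :: "real \<Rightarrow> 'w \<Rightarrow> real" and \<Psi> :: "real \<Rightarrow> complex" and q :: real and \<kappa> :: "real measure"
  assumes X_meas: "\<And>t. 0 \<le> t \<Longrightarrow> X t \<in> borel_measurable M"
    and X_char: "\<And>t u. 0 \<le> t \<Longrightarrow> (LINT \<omega>|M. iexp (u * X t \<omega>)) = exp (of_real t * \<Psi> u)"
    and q_nonneg: "0 \<le> q"
    and sets_\<kappa>: "sets \<kappa> = sets borel"
    and \<kappa>_int: "(\<integral>\<^sup>+ v. ennreal (min 1 (v\<^sup>2)) \<partial>\<kappa>) < \<infinity>"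
    and second_difference: "\<And>u s. \<Psi> u - (\<Psi> (u + s) + \<Psi> (u - s)) / 2
       = of_real (q * s\<^sup>2 / 2) + (LINT v|\<kappa>. (1 - cos (s * v)) *\<^sub>R iexp (u * v))"
begin

declare sets_\<kappa> [measurable_cong]

lemma space_\<kappa>: "space \<kappa> = UNIV"
  using sets_\<kappa>[THEN sets_eq_imp_space_eq] by simp

lemma min_integrable: "integrable \<kappa> (\<lambda>v. min 1 (v\<^sup>2))"
  using \<kappa>_int by (intro integrableI_nonneg) auto

lemma one_minus_cos_le: "1 - cos (s * v) \<le> (2 + s\<^sup>2) * min 1 (v\<^sup>2)" for s v :: real
proof -
  have a: "1 - cos (s * v) \<le> (s * v)\<^sup>2 / 2"
  proof -
    have "1 - cos (s * v) = 2 * (sin (s * v / 2))\<^sup>2"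
      using cos_double_sin[of "s * v / 2"] by simp
    also have "\<dots> \<le> 2 * (s * v / 2)\<^sup>2"
      using abs_sin_x_le_abs_x[of "s * v / 2", unfolded abs_le_square_iff] by linarith
    finally show ?thesis by (simp add: power_divide)
  qed
  have b: "1 - cos (s * v) \<le> 2" using cos_ge_minus_one[of "s * v"] by linarith
  show ?thesis
  proof (cases "v\<^sup>2 \<le> 1")
    case True
    have "(s * v)\<^sup>2 / 2 \<le> (2 + s\<^sup>2) * v\<^sup>2"
      by (simp add: power_mult_distrib algebra_simps)
    with a True show ?thesis by (simp add: min_def)
  next
    case False
    have "0 \<le> s\<^sup>2" by simp
    with b have "1 - cos (s * v) \<le> 2 + s\<^sup>2" by linarith
    with False show ?thesis by (simp add: min_def)
  qed
qed

lemma weight_integrable: "integrable \<kappa> (\<lambda>v. 1 - cos (s * v))"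
  by (rule Bochner_Integration.integrable_bound[OF integrable_mult_right[OF min_integrable, of "2 + s\<^sup>2"]])
     (use one_minus_cos_le[of s] in \<open>auto intro!: AE_I2 order_trans[OF _ abs_ge_self] simp: abs_of_nonneg\<close>)

lemma bounded_integrable:
  fixes f :: "'w \<Rightarrow> 'b :: {banach, second_countable_topology}"
  assumes "f \<in> borel_measurable M" "\<And>x. norm (f x) \<le> B"
  shows "integrable M f"
  by (rule integrable_const_bound[of _ B]) (use assms in auto)

text \<open>The law of \<open>X h\<close>, weighted with \<open>1 - cos (s x)\<close>, has as transform a second difference of \<open>exp (h \<Psi>)\<close>.
  Divided by \<open>h\<close> it converges, as \<open>h\<close> tends to 0, to the second difference of \<open>\<Psi>\<close>, which is the transform
  of \<open>(1 - cos (s v)) \<kappa>(dv)\<close> with an atom of mass \<open>q s\<^sup>2 / 2\<close> at 0.\<close>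

lemma weighted_limit:
  assumes f: "continuous_on UNIV f" "\<And>x. \<bar>f x\<bar> \<le> B"
  shows "(\<lambda>n. real (Suc n) * expectation (\<lambda>\<omega>. f (X (1 / Suc n) \<omega>) * (1 - cos (s * X (1 / Suc n) \<omega>))))
    \<longlonglongrightarrow> q * s\<^sup>2 / 2 * f 0 + (LINT v|\<kappa>. f v * (1 - cos (s * v)))"
proof -
  define w where "w v = 1 - cos (s * v)" for v
  have w: "0 \<le> w v" "w v \<le> 2" "w 0 = 0" for v
    unfolding w_def using cos_ge_minus_one[of "s * v"] by (simp_all add: add_increasing del: cos_ge_minus_one)
  have [measurable]: "w \<in> borel_measurable borel" unfolding w_def by measurable
  have [measurable]: "f \<in> borel_measurable borel"
    using f(1) by (rule borel_measurable_continuous_onI)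
  define Y where "Y n = X (1 / real (Suc n))" for n
  have [measurable]: "Y n \<in> borel_measurable M" for n
    unfolding Y_def by (rule X_meas) simp
  define m where "m n = density (distr M borel (Y n)) (\<lambda>x. ennreal (real (Suc n) * w x))" for n
  define N where "N = density \<kappa> (\<lambda>v. ennreal (w v))"
  define \<rho> where "\<rho> = add_atom N (q * s\<^sup>2 / 2)"
  have sets_m: "sets (m n) = sets borel" for n by (simp add: m_def)
  have sets_N: "sets N = sets borel" by (simp add: N_def sets_\<kappa>)
  have w_int: "integrable \<kappa> w" unfolding w_def by (rule weight_integrable)
  have bdd: "integrable \<kappa> (\<lambda>v. w v *\<^sub>R g v)"
    if [measurable]: "g \<in> borel_measurable borel" and "\<And>x. norm (g x) \<le> C"
    for g :: "real \<Rightarrow> 'c :: {banach, second_countable_topology}" and C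
  proof (rule Bochner_Integration.integrable_bound[OF integrable_mult_right[OF w_int, of C]])
    have "0 \<le> C" using that(2)[of 0] norm_ge_zero order_trans by blast
    then show "AE x in \<kappa>. norm (w x *\<^sub>R g x) \<le> norm (C * w x)"
      using that(2) w by (auto intro!: mult_right_mono simp: mult.commute[of "w _"] abs_mult)
  qed measurable
  have fin_m: "finite_measure (m n)" for n
  proof
    have "emeasure (m n) (space (m n)) = (\<integral>\<^sup>+\<omega>. ennreal (real (Suc n) * w (Y n \<omega>)) \<partial>M)"
      unfolding m_def by (simp add: emeasure_density nn_integral_distr del: of_nat_Suc)
    also have "\<dots> \<le> (\<integral>\<^sup>+\<omega>. ennreal (real (Suc n) * 2) \<partial>M)"
      by (intro nn_integral_mono ennreal_leI mult_left_mono w) simp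
    also have "\<dots> = ennreal (real (Suc n) * 2)"
      by (simp add: emeasure_space_1 del: of_nat_Suc)
    finally show "emeasure (m n) (space (m n)) \<noteq> \<infinity>" by (auto simp: top_unique)
  qed
  have fin_N: "finite_measure N"
  proof
    show "emeasure N (space N) \<noteq> \<infinity>"
      unfolding N_def using w w_int
      by (simp add: emeasure_density nn_integral_eq_integral space_\<kappa>)
  qed
  have m_int: "(LINT x|m n. g x) = real (Suc n) *\<^sub>R (LINT \<omega>|M. w (Y n \<omega>) *\<^sub>R g (Y n \<omega>))"
    if [measurable]: "g \<in> borel_measurable borel" for n and g :: "real \<Rightarrow> 'c :: {banach, second_countable_topology}"
    unfolding m_def using w
    by (subst integral_density) (auto simp: integral_distr simp del: of_nat_Suc simp flip: scaleR_scaleR)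
  have N_integrable: "integrable N g" if [measurable]: "g \<in> borel_measurable borel" and "\<And>x. norm (g x) \<le> C"
    for g :: "real \<Rightarrow> 'c :: {banach, second_countable_topology}" and C
    using bdd[OF that] w by (simp add: N_def integrable_density)
  have N_int: "(LINT x|N. g x) = (LINT v|\<kappa>. w v *\<^sub>R g v)" if [measurable]: "g \<in> borel_measurable borel"
    for g :: "real \<Rightarrow> 'c :: {banach, second_countable_topology}"
    using w by (simp add: N_def integral_density)
  have "(\<lambda>n. LINT x|m n. f x) \<longlonglongrightarrow> (LINT x|\<rho>. f x)"
  proof (rule finite_levy_continuity[OF fin_m _ sets_m _ _ f])
    show "finite_measure \<rho>" unfolding \<rho>_def by (intro finite_measure_add_atom fin_N sets_N)
    show "sets \<rho> = sets borel" by (simp add: \<rho>_def)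
    fix u
    have lim: "(\<lambda>n. of_nat (Suc n) * ((LINT \<omega>|M. iexp (u * Y n \<omega>)) - 1)) \<longlonglongrightarrow> \<Psi> u" for u
    proof -
      have "(LINT \<omega>|M. iexp (u * Y n \<omega>)) = exp (\<Psi> u / of_nat (Suc n))" for n
        unfolding Y_def by (subst X_char) (simp_all del: of_nat_Suc)
      then show ?thesis using exp_difference_quotient[of "\<Psi> u"] by simp
    qed
    have eq: "(LINT x|m n. iexp (u * x)) = of_nat (Suc n) * ((LINT \<omega>|M. iexp (u * Y n \<omega>)) - 1)
       - (of_nat (Suc n) * ((LINT \<omega>|M. iexp ((u + s) * Y n \<omega>)) - 1)
          + of_nat (Suc n) * ((LINT \<omega>|M. iexp ((u - s) * Y n \<omega>)) - 1)) / 2" for n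
    proof -
      have pw: "w x *\<^sub>R iexp (u * x) = iexp (u * x) - (iexp ((u + s) * x) + iexp ((u - s) * x)) / 2" for x
        unfolding w_def by (rule second_difference_iexp)
      have int: "integrable M (\<lambda>\<omega>. iexp (v * Y n \<omega>))" for v
        by (rule bounded_integrable[of _ 1]) auto
      have "(LINT \<omega>|M. w (Y n \<omega>) *\<^sub>R iexp (u * Y n \<omega>)) = (LINT \<omega>|M. iexp (u * Y n \<omega>))
        - ((LINT \<omega>|M. iexp ((u + s) * Y n \<omega>)) + (LINT \<omega>|M. iexp ((u - s) * Y n \<omega>))) / 2"
        unfolding pw using int[of u] int[of "u + s"] int[of "u - s"]
        by (simp del: of_real_mult of_real_add of_real_diff)
      moreover have "N * (a - (b + c) / 2) = N * (a - 1) - (N * (b - 1) + N * (c - 1)) / 2"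
        for N a b c :: complex by (simp add: field_simps)
      ultimately show ?thesis
        by (subst m_int, measurable) (simp only: scaleR_conv_of_real of_real_of_nat_eq)
    qed
    have "(\<lambda>n. LINT x|m n. iexp (u * x)) \<longlonglongrightarrow> \<Psi> u - (\<Psi> (u + s) + \<Psi> (u - s)) / 2"
      unfolding eq by (intro tendsto_intros lim) simp
    also have "\<Psi> u - (\<Psi> (u + s) + \<Psi> (u - s)) / 2 = (LINT x|\<rho>. iexp (u * x))"
    proof -
      have "(LINT x|\<rho>. iexp (u * x)) = (LINT x|N. iexp (u * x)) + of_real (q * s\<^sup>2 / 2) * iexp (u * 0)"
        unfolding \<rho>_def by (rule integral_add_atom[OF sets_N N_integrable[of _ 1]]) (auto simp: q_nonneg)
      then show ?thesis by (simp add: second_difference N_int w_def)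
    qed
    finally show "(\<lambda>n. LINT x|m n. iexp (u * x)) \<longlonglongrightarrow> (LINT x|\<rho>. iexp (u * x))" .
  qed
  also have "(LINT x|\<rho>. f x) = (LINT x|N. f x) + q * s\<^sup>2 / 2 * f 0"
    unfolding \<rho>_def by (rule integral_add_atom_real(2)[OF sets_N N_integrable[of _ B]]) (auto simp: q_nonneg f)
  also have "(LINT x|N. f x) = (LINT v|\<kappa>. f v * w v)"
    by (simp add: N_int mult.commute)
  also have "(\<lambda>n. LINT x|m n. f x) = (\<lambda>n. real (Suc n) * (LINT \<omega>|M. f (Y n \<omega>) * w (Y n \<omega>)))"
    by (simp add: m_int mult.commute del: of_nat_Suc)
  finally show ?thesis
    unfolding Y_def w_def by (simp only: add.commute)
qed

end

section \<open>Increments and jumps of the paths\<close>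

text \<open>Just before \<open>t\<close> the path is close to its left limit, from \<open>t\<close> on it is close to \<open>f t\<close>, and the step between
  the two is upward. A Lebesgue number of the resulting cover of the unit interval serves as \<open>\<delta>\<close>.\<close>

lemma cadlag_small_decrease:
  fixes f :: "real \<Rightarrow> real"
  assumes f: "cadlag f" and up: "\<forall>t>0. \<forall>l. (f \<longlongrightarrow> l) (at_left t) \<longrightarrow> l \<le> f t" and "\<epsilon> > 0"
  shows "\<exists>\<delta>>0. \<forall>s u. 0 \<le> s \<and> s \<le> u \<and> u \<le> 1 \<and> u - s < \<delta> \<longrightarrow> - \<epsilon> \<le> f u - f s"
proof -
  have "\<exists>e>0. \<forall>s u. 0 \<le> s \<and> s \<in> ball t e \<and> u \<in> ball t e \<and> s \<le> u \<longrightarrow> - \<epsilon> \<le> f u - f s"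
    if t: "t \<in> {0..1}" for t
  proof -
    have "(f \<longlongrightarrow> f t) (at_right t)" using f t by (auto simp: cadlag_def)
    then have "\<forall>\<^sub>F u in at_right t. dist (f u) (f t) < \<epsilon> / 2"
      using \<open>\<epsilon> > 0\<close> by (intro tendstoD) auto
    then obtain b where b: "b > t" "\<And>u. t < u \<Longrightarrow> u < b \<Longrightarrow> dist (f u) (f t) < \<epsilon> / 2"
      by (auto simp: eventually_at_right[of t "t + 1"] )
    have b': "dist (f u) (f t) < \<epsilon> / 2" if "t \<le> u" "u < b" for u
      using b(2)[of u] that \<open>\<epsilon> > 0\<close> by (cases "u = t") auto
    obtain a l where a: "a < t" "\<And>s. 0 \<le> s \<Longrightarrow> a < s \<Longrightarrow> s < t \<Longrightarrow> dist (f s) l < \<epsilon> / 2" and l: "0 < t \<Longrightarrow> l \<le> f t"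
    proof (cases "t > 0")
      case True
      then obtain l where l: "(f \<longlongrightarrow> l) (at_left t)" using f by (auto simp: cadlag_def)
      then have "\<forall>\<^sub>F u in at_left t. dist (f u) l < \<epsilon> / 2"
        using \<open>\<epsilon> > 0\<close> by (intro tendstoD) auto
      then obtain a where "a < t" "\<And>u. a < u \<Longrightarrow> u < t \<Longrightarrow> dist (f u) l < \<epsilon> / 2"
        by (auto simp: eventually_at_left[of "t - 1" t])
      with that up l True show ?thesis by blast
    next
      case False
      with t have "t = 0" by auto
      then show ?thesis using that[of "-1"] by auto
    qed
    define e where "e = min (b - t) (t - a)"
    have "- \<epsilon> \<le> f u - f s" if "0 \<le> s" "s \<in> ball t e" "u \<in> ball t e" "s \<le> u" for s u
    proof -
      have r: "a < s" "s < b" "a < u" "u < b"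
        using that by (auto simp: e_def dist_real_def)
      consider "t \<le> s" | "s < t" "t \<le> u" | "u < t" by linarith
      then show ?thesis
      proof cases
        case 1
        then have "dist (f s) (f t) < \<epsilon> / 2" "dist (f u) (f t) < \<epsilon> / 2" using b'[of s] b'[of u] r that by auto
        then show ?thesis unfolding dist_real_def by linarith
      next
        case 2
        then have "dist (f s) (l) < \<epsilon> / 2" "dist (f u) (f t) < \<epsilon> / 2" using a(2)[of s] b'[of u] r that by auto
        moreover have "l \<le> f t" using l 2 that by simp
        ultimately show ?thesis unfolding dist_real_def by linarith
      next
        case 3
        then have "dist (f s) (l) < \<epsilon> / 2" "dist (f u) (l) < \<epsilon> / 2" using a(2)[of s] a(2)[of u] r that by auto
        then show ?thesis unfolding dist_real_def by linarith
      qed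
    qed
    moreover have "e > 0" using a b by (auto simp: e_def)
    ultimately show ?thesis by blast
  qed
  then obtain e where e: "\<And>t. t \<in> {0..1} \<Longrightarrow> e t > 0"
    "\<And>t s u. t \<in> {0..1} \<Longrightarrow> 0 \<le> s \<Longrightarrow> s \<in> ball t (e t) \<Longrightarrow> u \<in> ball t (e t) \<Longrightarrow> s \<le> u \<Longrightarrow> - \<epsilon> \<le> f u - f s"
    by metis
  have "compact {0..1::real}" by simp
  moreover have "(\<lambda>t. ball t (e t)) ` {0..1} \<noteq> {}" by simp
  moreover have "{0..1} \<subseteq> \<Union> ((\<lambda>t. ball t (e t)) ` {0..1})" using e(1) by force
  ultimately obtain \<delta> where d: "0 < \<delta>"
    "\<And>T. T \<subseteq> {0..1} \<Longrightarrow> diameter T < \<delta> \<Longrightarrow> \<exists>B\<in>(\<lambda>t. ball t (e t)) ` {0..1}. T \<subseteq> B"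
    using Lebesgue_number_lemma[of "{0..1::real}" "(\<lambda>t. ball t (e t)) ` {0..1}"] by (metis (no_types, lifting) imageE open_ball)
  have "- \<epsilon> \<le> f u - f s" if "0 \<le> s" "s \<le> u" "u \<le> 1" "u - s < \<delta>" for s u
  proof -
    have "\<exists>B\<in>(\<lambda>t. ball t (e t)) ` {0..1}. {s..u} \<subseteq> B"
      using that by (intro d(2)) auto
    then obtain t where "t \<in> {0..1}" "{s..u} \<subseteq> ball t (e t)" by auto
    with that show ?thesis by (intro e(2)[of t]) auto
  qed
  then show ?thesis using d(1) by blast
qed

text \<open>On a fine grid, the cell that contains \<open>t\<close> has an increment close to the jump at \<open>t\<close>.\<close>

lemma cadlag_no_upward_jump:
  fixes f :: "real \<Rightarrow> real"
  assumes f: "cadlag f" and t: "t > 0" and l: "(f \<longlongrightarrow> l) (at_left t)"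
    and small: "\<And>j N. \<exists>\<^sub>F n in sequentially. \<forall>k < N * Suc n. f (real (Suc k) / Suc n) - f (real k / Suc n) \<le> 1 / Suc j"
  shows "f t \<le> l"
proof (rule field_le_epsilon)
  fix e :: real assume e: "e > 0"
  obtain j where j: "1 / Suc j < e / 2" using e nat_approx_posE[of "e / 2"] by auto
  have "(f \<longlongrightarrow> f t) (at_right t)" using f t by (auto simp: cadlag_def)
  then have "\<forall>\<^sub>F u in at_right t. dist (f u) (f t) < e / 4"
    using e by (intro tendstoD) auto
  then obtain b where b: "b > t" "\<And>u. t < u \<Longrightarrow> u < b \<Longrightarrow> dist (f u) (f t) < e / 4"
    by (auto simp: eventually_at_right[of t "t + 1"] )
  have b': "dist (f u) (f t) < e / 4" if "t \<le> u" "u < b" for u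
    using b(2)[of u] that e by (cases "u = t") auto
  have "\<forall>\<^sub>F u in at_left t. dist (f u) l < e / 4"
    using e l by (intro tendstoD) auto
  then obtain a where a: "a < t" "\<And>u. a < u \<Longrightarrow> u < t \<Longrightarrow> dist (f u) l < e / 4"
    by (auto simp: eventually_at_left[of "t - 1" t])
  obtain N where N: "t < real N" using reals_Archimedean2 by blast
  have "(\<lambda>n. 1 / real (Suc n)) \<longlonglongrightarrow> 0" using LIMSEQ_Suc[OF lim_1_over_n] .
  then have "\<forall>\<^sub>F n in sequentially. 1 / real (Suc n) < min (b - t) (t - a)"
    using a b by (intro order_tendstoD) auto
  then have "\<exists>\<^sub>F n in sequentially. 1 / real (Suc n) < min (b - t) (t - a) \<and>
      (\<forall>k < N * Suc n. f (real (Suc k) / Suc n) - f (real k / Suc n) \<le> 1 / Suc j)"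
    by (rule frequently_eventually_conj[OF small])
  then obtain n where n: "1 / real (Suc n) < min (b - t) (t - a)"
    "\<And>k. k < N * Suc n \<Longrightarrow> f (real (Suc k) / Suc n) - f (real k / Suc n) \<le> 1 / Suc j"
    by (auto dest: frequently_ex)
  define k where "k = nat (\<lceil>t * Suc n\<rceil> - 1)"
  have tn: "t * Suc n > 0" using t by simp
  then have "real (Suc k) = of_int \<lceil>t * Suc n\<rceil>" by (simp add: k_def of_nat_diff)
  then have k: "real k < t * Suc n" "t * Suc n \<le> real (Suc k)"
    using ceiling_correct[of "t * Suc n"] by auto
  have "t * Suc n < real (N * Suc n)" 
    using mult_strict_right_mono[OF N, of "real (Suc n)"] by (simp only: of_nat_mult)
  with k(1) have kN: "k < N * Suc n" by linarith
  have "real k / Suc n < t" "t \<le> real (Suc k) / Suc n"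
    using k by (simp_all add: field_simps del: of_nat_Suc)
  moreover have "real (Suc k) / Suc n = real k / Suc n + 1 / Suc n"
    by (simp add: add_divide_distrib)
  ultimately have "dist (f (real (Suc k) / Suc n)) (f t) < e / 4" "dist (f (real k / Suc n)) l < e / 4"
    using n(1) by (intro b' a(2); linarith)+
  with n(2)[OF kN] j show "f t \<le> l + e" unfolding dist_real_def by linarith
qed

locale real_levy_process = prob_space M for M :: "'w measure" +
  fixes X :: "real \<Rightarrow> 'w \<Rightarrow> real"
  assumes levy: "levy_process M X" and jumps: "nonneg_jumps M X"
begin

lemma measurable_X: "0 \<le> t \<Longrightarrow> X t \<in> borel_measurable M"
  using levy by (auto simp: levy_process_def)

lemma prob_increment:
  assumes "0 \<le> s" "0 \<le> h" "A \<in> sets borel"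
  shows "prob {\<omega> \<in> space M. X (s + h) \<omega> - X s \<omega> \<in> A} = prob {\<omega> \<in> space M. X h \<omega> \<in> A}"
proof -
  have [measurable]: "X (s + h) \<in> borel_measurable M" "X s \<in> borel_measurable M" "X h \<in> borel_measurable M"
    using assms by (auto intro: measurable_X)
  have "distr M borel (\<lambda>\<omega>. X (s + h) \<omega> - X s \<omega>) = distr M borel (X h)"
    using levy assms by (auto simp: levy_process_def)
  then have "measure (distr M borel (\<lambda>\<omega>. X (s + h) \<omega> - X s \<omega>)) A = measure (distr M borel (X h)) A"
    by simp
  then show ?thesis
    using assms by (simp add: measure_distr vimage_def Int_def conj_commute)
qed

lemma prob_all_increments:
  assumes h: "0 \<le> h" and A: "A \<in> sets borel"
  shows "prob {\<omega> \<in> space M. \<forall>k<n. X (real (Suc k) * h) \<omega> - X (real k * h) \<omega> \<in> A}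
    = prob {\<omega> \<in> space M. X h \<omega> \<in> A} ^ n"
proof (cases "n = 0")
  case False
  define \<tau> where "\<tau> k = real k * h" for k :: nat
  have "mono \<tau>" using h by (auto simp: \<tau>_def mono_def intro!: mult_right_mono)
  moreover have \<tau>0: "0 \<le> \<tau> 0" by (simp add: \<tau>_def)
  ultimately have ind: "indep_vars (\<lambda>_. borel) (\<lambda>k \<omega>. X (\<tau> (Suc k)) \<omega> - X (\<tau> k) \<omega>) {..<n}"
    using levy \<tau>0 unfolding levy_process_def by blast
  have "prob (\<Inter>k\<in>{..<n}. (\<lambda>\<omega>. X (\<tau> (Suc k)) \<omega> - X (\<tau> k) \<omega>) -` A \<inter> space M)
      = (\<Prod>k<n. prob ((\<lambda>\<omega>. X (\<tau> (Suc k)) \<omega> - X (\<tau> k) \<omega>) -` A \<inter> space M))"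
    using False A by (intro indep_varsD[OF ind]) auto
  also have "\<dots> = (\<Prod>k<n. prob {\<omega> \<in> space M. X h \<omega> \<in> A})"
  proof (rule prod.cong[OF refl])
    fix k
    have "\<tau> (Suc k) = \<tau> k + h" by (simp add: \<tau>_def algebra_simps)
    moreover have "0 \<le> \<tau> k" using h by (simp add: \<tau>_def)
    ultimately show "prob ((\<lambda>\<omega>. X (\<tau> (Suc k)) \<omega> - X (\<tau> k) \<omega>) -` A \<inter> space M) = prob {\<omega> \<in> space M. X h \<omega> \<in> A}"
      using prob_increment[of "\<tau> k" h A] h A by (simp add: vimage_def Int_def conj_commute)
  qed
  also have "(\<Inter>k\<in>{..<n}. (\<lambda>\<omega>. X (\<tau> (Suc k)) \<omega> - X (\<tau> k) \<omega>) -` A \<inter> space M)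
      = {\<omega> \<in> space M. \<forall>k<n. X (real (Suc k) * h) \<omega> - X (real k * h) \<omega> \<in> A}"
    using False by (auto simp: \<tau>_def)
  finally show ?thesis by simp
qed (simp add: prob_space)

lemma AE_path:
  "AE \<omega> in M. cadlag (\<lambda>t. X t \<omega>) \<and> (\<forall>t>0. \<forall>l. ((\<lambda>s. X s \<omega>) \<longlongrightarrow> l) (at_left t) \<longrightarrow> l \<le> X t \<omega>)"
  using levy jumps by (auto simp: levy_process_def nonneg_jumps_def)

text \<open>With \<open>p = P (X (1 / n) < - \<epsilon>)\<close>, all increments over the \<open>n\<close> cells of the unit interval are at least \<open>- \<epsilon>\<close>
  with probability \<open>(1 - p)\<^sup>n \<le> exp (- n p)\<close>. Without downward jumps this probability tends to 1.\<close>

lemma downward_increments_vanish: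
  assumes "\<epsilon> > 0"
  shows "(\<lambda>n. real (Suc n) * prob {\<omega> \<in> space M. X (1 / Suc n) \<omega> < - \<epsilon>}) \<longlonglongrightarrow> 0"
proof -
  define E where "E n = {\<omega> \<in> space M. \<forall>k<Suc n. X (real (Suc k) * (1 / Suc n)) \<omega> - X (real k * (1 / Suc n)) \<omega> \<in> {-\<epsilon>..}}" for n
  define p where "p n = prob {\<omega> \<in> space M. X (1 / Suc n) \<omega> < - \<epsilon>}" for n
  have meas[measurable]: "X (real k * (1 / Suc n)) \<in> borel_measurable M" for k n
    by (rule measurable_X) simp
  have meas'[measurable]: "X (1 / Suc n) \<in> borel_measurable M" for n
    by (rule measurable_X) simp
  have [measurable]: "E n \<in> sets M" for n unfolding E_def by measurable
  have PE: "prob (E n) = (1 - p n) ^ Suc n" for n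
  proof -
    have "prob (E n) = prob {\<omega> \<in> space M. X (1 / Suc n) \<omega> \<in> {-\<epsilon>..}} ^ Suc n"
      unfolding E_def by (rule prob_all_increments) auto
    also have "prob {\<omega> \<in> space M. X (1 / Suc n) \<omega> \<in> {-\<epsilon>..}} = 1 - p n"
      unfolding p_def by (subst prob_neg[symmetric]) (auto intro!: arg_cong[where f=prob] simp del: of_nat_Suc)
    finally show ?thesis .
  qed
  have "(\<lambda>n. LINT \<omega>|M. indicator (E n) \<omega> :: real) \<longlonglongrightarrow> (LINT \<omega>|M. 1)"
  proof (rule integral_dominated_convergence[where w="\<lambda>_. 1"])
    show "AE \<omega> in M. (\<lambda>n. indicator (E n) \<omega> :: real) \<longlonglongrightarrow> 1"
      using AE_path AE_space
    proof eventually_elim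
      case (elim \<omega>)
      then obtain \<delta> where d: "\<delta> > 0"
        "\<And>s u. 0 \<le> s \<Longrightarrow> s \<le> u \<Longrightarrow> u \<le> 1 \<Longrightarrow> u - s < \<delta> \<Longrightarrow> - \<epsilon> \<le> X u \<omega> - X s \<omega>"
        using cadlag_small_decrease[of "\<lambda>t. X t \<omega>" \<epsilon>] assms by blast
      have "(\<lambda>n. 1 / real (Suc n)) \<longlonglongrightarrow> 0" using LIMSEQ_Suc[OF lim_1_over_n] .
      then have "\<forall>\<^sub>F n in sequentially. 1 / real (Suc n) < \<delta>" using d(1) by (rule order_tendstoD)
      then have "\<forall>\<^sub>F n in sequentially. indicator (E n) \<omega> = (1::real)"
      proof eventually_elim
        case n: (elim n)
        have "- \<epsilon> \<le> X (real (Suc k) * (1 / Suc n)) \<omega> - X (real k * (1 / Suc n)) \<omega>" if "k < Suc n" for k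
        proof (rule d(2))
          show "real (Suc k) * (1 / Suc n) \<le> 1" using that by (simp add: field_simps)
          show "real (Suc k) * (1 / Suc n) - real k * (1 / Suc n) < \<delta>" using n by (simp add: field_simps)
        qed (auto simp: field_simps)
        then show ?case using elim by (auto simp: E_def)
      qed
      then show ?case by (rule tendsto_eventually)
    qed
  qed (auto simp: indicator_def)
  then have lim: "(\<lambda>n. prob (E n)) \<longlonglongrightarrow> 1" by (simp add: prob_space)
  have p: "0 \<le> p n" "p n \<le> 1" for n by (auto simp: p_def)
  have "(\<lambda>n. - ln (prob (E n))) \<longlonglongrightarrow> - ln 1" by (intro tendsto_intros lim) simp
  then have lim': "(\<lambda>n. - ln (prob (E n))) \<longlonglongrightarrow> 0" by simp
  have "(\<lambda>n. real (Suc n) * p n) \<longlonglongrightarrow> 0"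
  proof (rule tendsto_sandwich[OF _ _ tendsto_const lim'])
    have "\<forall>\<^sub>F n in sequentially. prob (E n) > 0" using lim by (rule order_tendstoD) simp
    then show "\<forall>\<^sub>F n in sequentially. real (Suc n) * p n \<le> - ln (prob (E n))"
    proof eventually_elim
      case (elim n)
      then have "1 - p n \<noteq> 0" unfolding PE by (intro notI) simp
      then have "1 - p n > 0" using p[of n] by linarith
      then have "ln (prob (E n)) = real (Suc n) * ln (1 - p n)" unfolding PE by (simp add: ln_realpow del: of_nat_Suc power_Suc)
      also have "\<dots> \<le> real (Suc n) * (- p n)"
        using ln_le_minus_one[OF \<open>1 - p n > 0\<close>] by (intro mult_left_mono) auto
      finally show ?case by simp
    qed
  qed (use p in auto)
  then show ?thesis by (simp add: p_def)
qed

text \<open>The probability that a grid of mesh \<open>1 / n\<close> on \<open>[0, N]\<close> has an increment above \<open>\<epsilon>\<close> tends to 0, so almost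
  every path has arbitrarily fine grids without such increments.\<close>

lemma continuous_paths:
  assumes small: "\<And>\<epsilon>. \<epsilon> > 0 \<Longrightarrow> (\<lambda>n. real (Suc n) * prob {\<omega> \<in> space M. X (1 / Suc n) \<omega> > \<epsilon>}) \<longlonglongrightarrow> 0"
  shows "AE \<omega> in M. continuous_on {0..} (\<lambda>t. X t \<omega>)"
proof -
  have "AE \<omega> in M. \<exists>\<^sub>F n in sequentially. \<forall>k < N * Suc n. X (real (Suc k) / Suc n) \<omega> - X (real k / Suc n) \<omega> \<le> 1 / Suc j" for j N
  proof -
    define \<epsilon> where "\<epsilon> = 1 / real (Suc j)"
    have eps: "\<epsilon> > 0" by (simp add: \<epsilon>_def)
    define F where "F n = {\<omega> \<in> space M. \<exists>k < N * Suc n. X (real (Suc k) / Suc n) \<omega> - X (real k / Suc n) \<omega> > \<epsilon>}" for n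
    have meas[measurable]: "X (real k / Suc n) \<in> borel_measurable M" for k n
      by (rule measurable_X) simp
    have [measurable]: "F n \<in> sets M" for n unfolding F_def by measurable
    have PF: "prob (F n) \<le> real N * (real (Suc n) * prob {\<omega> \<in> space M. X (1 / Suc n) \<omega> > \<epsilon>})" for n
    proof -
      have "F n = (\<Union>k\<in>{..<N * Suc n}. {\<omega> \<in> space M. X (real (Suc k) / Suc n) \<omega> - X (real k / Suc n) \<omega> > \<epsilon>})"
        by (auto simp: F_def)
      also have "prob \<dots> \<le> (\<Sum>k<N * Suc n. prob {\<omega> \<in> space M. X (real (Suc k) / Suc n) \<omega> - X (real k / Suc n) \<omega> > \<epsilon>})"
        by (intro finite_measure_subadditive_finite) (auto simp del: of_nat_Suc)
      also have "\<dots> = (\<Sum>k<N * Suc n. prob {\<omega> \<in> space M. X (1 / Suc n) \<omega> > \<epsilon>})"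
      proof (rule sum.cong[OF refl])
        fix k
        have "real (Suc k) / Suc n = real k / Suc n + 1 / Suc n" by (simp add: add_divide_distrib)
        then show "prob {\<omega> \<in> space M. X (real (Suc k) / Suc n) \<omega> - X (real k / Suc n) \<omega> > \<epsilon>} = prob {\<omega> \<in> space M. X (1 / Suc n) \<omega> > \<epsilon>}"
          using prob_increment[of "real k / Suc n" "1 / Suc n" "{\<epsilon><..}"] by simp
      qed
      finally show ?thesis by (simp add: algebra_simps)
    qed
    have "(\<lambda>n. real N * (real (Suc n) * prob {\<omega> \<in> space M. X (1 / Suc n) \<omega> > \<epsilon>})) \<longlonglongrightarrow> real N * 0"
      by (intro tendsto_mult tendsto_const small eps)
    then have z: "(\<lambda>n. real N * (real (Suc n) * prob {\<omega> \<in> space M. X (1 / Suc n) \<omega> > \<epsilon>})) \<longlonglongrightarrow> 0"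
      by (simp only: mult_zero_right)
    have "(\<lambda>n. prob (F n)) \<longlonglongrightarrow> 0"
      by (rule tendsto_sandwich[OF _ _ tendsto_const z]) (simp_all only: PF measure_nonneg eventually_True)
    then have lim: "(\<lambda>n. prob (F (n + m))) \<longlonglongrightarrow> 0" for m by (rule LIMSEQ_ignore_initial_segment)
    have "prob (\<Inter>n\<in>{m..}. F n) \<le> 0" for m
      by (rule LIMSEQ_le_const[OF lim[of m]]) (auto intro!: exI[of _ 0] finite_measure_mono)
    then have "emeasure M (\<Inter>n\<in>{m..}. F n) = 0" for m
      by (simp add: emeasure_eq_measure measure_le_0_iff)
    then have "AE \<omega> in M. \<omega> \<notin> (\<Inter>n\<in>{m..}. F n)" for m
      by (intro AE_not_in) (auto simp: null_sets_def)
    then have "AE \<omega> in M. \<forall>m. \<omega> \<notin> (\<Inter>n\<in>{m..}. F n)" by (simp add: AE_all_countable)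
    then show ?thesis
      using AE_space
    proof eventually_elim
      case (elim \<omega>)
      then have "\<exists>n\<ge>m. \<omega> \<notin> F n" for m by auto
      then have "\<exists>\<^sub>F n in sequentially. \<omega> \<notin> F n"
        by (simp add: frequently_sequentially)
      then show ?case
      proof (rule frequently_elim1)
        fix n
        assume "\<omega> \<notin> F n"
        with elim(2) show "\<forall>k < N * Suc n. X (real (Suc k) / Suc n) \<omega> - X (real k / Suc n) \<omega> \<le> 1 / Suc j"
          unfolding F_def \<epsilon>_def not_le[symmetric] by blast
      qed
    qed
  qed
  then have "AE \<omega> in M. \<forall>j N. \<exists>\<^sub>F n in sequentially. \<forall>k < N * Suc n. X (real (Suc k) / Suc n) \<omega> - X (real k / Suc n) \<omega> \<le> 1 / Suc j"
    by (simp only: AE_all_countable simp_thms)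
  then show ?thesis
    using AE_path
  proof eventually_elim
    case (elim \<omega>)
    then have cad: "cadlag (\<lambda>t. X t \<omega>)" by simp
    have "((\<lambda>t. X t \<omega>) \<longlongrightarrow> X t \<omega>) (at t within {0..})" if "t \<ge> 0" for t
    proof (cases "t = 0")
      case True
      then show ?thesis using cad by (auto simp: cadlag_def at_within_Ici_at_right)
    next
      case False
      with that have t: "t > 0" by simp
      obtain l where l: "((\<lambda>t. X t \<omega>) \<longlongrightarrow> l) (at_left t)" using cad t by (auto simp: cadlag_def)
      have "X t \<omega> \<le> l" using elim by (intro cadlag_no_upward_jump[OF cad t l]) auto
      moreover have "l \<le> X t \<omega>" using elim t l by auto
      ultimately have "((\<lambda>t. X t \<omega>) \<longlongrightarrow> X t \<omega>) (at t)"
        using l cad t by (auto simp: filterlim_at_split cadlag_def)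
      then show ?thesis by (rule tendsto_within_subset) simp
    qed
    then show ?case by (auto simp: continuous_on_def)
  qed
qed

end

section \<open>The Laplace exponent without downward jumps\<close>

text \<open>The integrand of the Levy-Khintchine formula for the Laplace exponent of a martingale.\<close>

definition comp_exp :: "real \<Rightarrow> real" where
  "comp_exp y = exp (- y) - 1 + y"

lemma comp_exp_measurable [measurable]: "comp_exp \<in> borel_measurable borel"
  unfolding comp_exp_def by measurable

lemma comp_exp_nonneg: "0 \<le> comp_exp y"
  using exp_ge_add_one_self[of "- y"] by (simp add: comp_exp_def)

lemma comp_exp_0 [simp]: "comp_exp 0 = 0"
  by (simp add: comp_exp_def)

lemma comp_exp_le: "0 \<le> y \<Longrightarrow> comp_exp y \<le> y"
  by (simp add: comp_exp_def)

lemma comp_exp_contract: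
  assumes "0 \<le> c" "c \<le> 1"
  shows "comp_exp (c * y) \<le> c * comp_exp y"
proof -
  have "exp ((1 - c) *\<^sub>R 0 + c *\<^sub>R (- y)) \<le> (1 - c) * exp 0 + c * exp (- y)"
    using convex_onD[OF exp_convex assms, of 0 "- y"] by simp
  then show ?thesis by (simp add: comp_exp_def algebra_simps)
qed

lemma comp_exp_ge:
  assumes "1 \<le> y"
  shows "y \<le> exp 1 * comp_exp y"
proof -
  have "comp_exp (1 / y * y) \<le> 1 / y * comp_exp y"
    using assms by (intro comp_exp_contract) auto
  then have "y * exp (- 1) \<le> comp_exp y"
    using assms by (simp add: comp_exp_def field_simps)
  then have "exp 1 * (y * exp (- 1)) \<le> exp 1 * comp_exp y" by (intro mult_left_mono) auto
  moreover have "exp 1 * (y * exp (- 1)) = (y :: real)"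
    by (simp add: exp_minus)
  ultimately show ?thesis by simp
qed

text \<open>Doubling a negative argument gains an exponential factor; this controls the left tail of \<open>X h\<close> by a
  further value of the Laplace exponent.\<close>

lemma comp_exp_neg:
  assumes "0 \<le> y"
  shows "comp_exp (- y) \<le> exp (- y) * comp_exp (- (2 * y))"
proof -
  have "1 + y \<le> exp y" by (rule exp_ge_add_one_self)
  then have "(1 + y) * (1 + y) \<le> (1 + y) * exp y" using assms by (intro mult_left_mono) auto
  moreover have "1 + 2 * y \<le> (1 + y) * (1 + y)" by (simp add: algebra_simps)
  ultimately have "1 + 2 * y \<le> (1 + y) * exp y" by linarith
  then have "exp (- y) * (1 + 2 * y) \<le> exp (- y) * ((1 + y) * exp y)" by (intro mult_left_mono) auto
  also have "\<dots> = 1 + y" by (simp add: exp_minus)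
  finally have "exp (- y) * (1 + 2 * y) \<le> 1 + y" .
  moreover have "exp (- y) * comp_exp (- (2 * y)) = exp y - exp (- y) * (1 + 2 * y)"
    by (simp add: comp_exp_def algebra_simps flip: exp_add)
  ultimately show ?thesis by (simp add: comp_exp_def)
qed

lemma min_le_comp_exp:
  assumes "0 \<le> v"
  shows "min v (v\<^sup>2) \<le> 6 * comp_exp v"
proof (cases "v \<le> 1")
  case True
  obtain t where t: "\<bar>t\<bar> \<le> \<bar>- v\<bar>" "exp (- v) = (\<Sum>m<2. (- v) ^ m / fact m) + exp t / fact 2 * (- v) ^ 2"
    using Maclaurin_exp_le[of "- v" 2] by blast
  then have "comp_exp v = exp t / 2 * v\<^sup>2" by (simp add: comp_exp_def numeral_2_eq_2)
  moreover have "1 / 3 \<le> exp t"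
  proof -
    have "1 / 3 \<le> exp (- 1 :: real)" using e_less_272 by (simp add: exp_minus field_simps)
    also have "\<dots> \<le> exp t" using t True assms by auto
    finally show ?thesis .
  qed
  ultimately have "1 / 3 / 2 * v\<^sup>2 \<le> comp_exp v"
    by (simp only:) (intro mult_right_mono divide_right_mono; simp)
  then show ?thesis by (auto simp: min_def)
next
  case False
  have "exp 1 * comp_exp v \<le> 6 * comp_exp v"
    using e_less_272 by (intro mult_right_mono comp_exp_nonneg) simp
  with comp_exp_ge[of v] False show ?thesis by (auto simp: min_def)
qed

lemma comp_exp_weight_limit:
  assumes "b > 0" "s > 0"
  shows "((\<lambda>x. comp_exp (b * x) / (1 - cos (s * x))) \<longlongrightarrow> b\<^sup>2 / s\<^sup>2) (at 0)"
proof -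
  have "((\<lambda>x. comp_exp (b * x) / (1 - cos (s * x))) \<longlongrightarrow> b * b / (s * s)) (at 0)"
    unfolding comp_exp_def using assms by real_asymp
  then show ?thesis by (simp add: power2_eq_square)
qed

definition cutoff :: "real \<Rightarrow> real \<Rightarrow> real" where
  "cutoff K x = max 0 (min 1 (2 - \<bar>x\<bar> / K))"

lemma cutoff_measurable [measurable]: "cutoff K \<in> borel_measurable borel"
  unfolding cutoff_def by measurable

lemma cutoff_range: "0 \<le> cutoff K x" "cutoff K x \<le> 1"
  by (auto simp: cutoff_def)

lemma cutoff_eq_1: "K > 0 \<Longrightarrow> \<bar>x\<bar> \<le> K \<Longrightarrow> cutoff K x = 1"
  by (auto simp: cutoff_def min_def field_simps)

lemma cutoff_eq_0: "K > 0 \<Longrightarrow> \<bar>x\<bar> \<ge> 2 * K \<Longrightarrow> cutoff K x = 0"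
  by (auto simp: cutoff_def max_def min_def field_simps)

lemma cutoff_mono: "0 < K \<Longrightarrow> K \<le> L \<Longrightarrow> cutoff K x \<le> cutoff L x"
proof -
  assume "0 < K" "K \<le> L"
  then have "\<bar>x\<bar> / L \<le> \<bar>x\<bar> / K" by (intro divide_left_mono) auto
  then show ?thesis by (auto simp: cutoff_def)
qed

lemma one_minus_cos_pos: "x \<noteq> 0 \<Longrightarrow> \<bar>x\<bar> < pi \<Longrightarrow> 0 < 1 - cos (x::real)"
  using cos_monotone_0_pi[of 0 "\<bar>x\<bar>"] by simp

text \<open>The truncation error is bounded by the same function at other arguments, whose expectations are known
  exactly. The right tail leads to \<open>K J (1 / K)\<close>, which is small because the mean vanishes, the left tail to
  the factor \<open>exp (- b K)\<close>.\<close>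

lemma comp_exp_tail:
  assumes "b > 0" "K \<ge> 1"
  shows "comp_exp (b * x) * (1 - cutoff K x)
    \<le> exp 1 * b * (K * comp_exp (1 / K * x)) + exp (- (b * K)) * comp_exp (2 * b * x)"
proof -
  have nn: "0 \<le> exp 1 * b * (K * comp_exp (1 / K * x))" "0 \<le> exp (- (b * K)) * comp_exp (2 * b * x)"
    using assms comp_exp_nonneg by auto
  have le: "comp_exp (b * x) * (1 - cutoff K x) \<le> comp_exp (b * x)"
    using mult_left_mono[of "1 - cutoff K x" 1 "comp_exp (b * x)"] cutoff_range[of K x] comp_exp_nonneg[of "b * x"] by simp
  consider "\<bar>x\<bar> \<le> K" | "x > K" | "x < - K" by linarith
  then show ?thesis
  proof cases
    case 1
    then have "comp_exp (b * x) * (1 - cutoff K x) = 0" using assms by (simp add: cutoff_eq_1)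
    with nn show ?thesis by linarith
  next
    case 2
    then have "comp_exp (b * x) \<le> b * x" using assms by (intro comp_exp_le) auto
    also have "\<dots> = b * K * (1 / K * x)" using assms by simp
    also have "\<dots> \<le> b * K * (exp 1 * comp_exp (1 / K * x))"
      using assms 2 by (intro mult_left_mono comp_exp_ge) (auto simp: field_simps)
    finally show ?thesis using le nn by (simp add: mult_ac)
  next
    case 3
    then have neg: "0 \<le> - (b * x)" using assms by (simp add: mult_nonneg_nonpos)
    have "comp_exp (b * x) \<le> exp (b * x) * comp_exp (2 * b * x)"
      using comp_exp_neg[OF neg] by (simp add: mult_ac)
    also have "\<dots> \<le> exp (- (b * K)) * comp_exp (2 * b * x)"
    proof (intro mult_right_mono comp_exp_nonneg)
      have "b * x \<le> b * (- K)" using 3 assms by (intro mult_left_mono) auto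
      then show "exp (b * x) \<le> exp (- (b * K))" by simp
    qed
    finally show ?thesis using le nn by linarith
  qed
qed

locale spectrally_positive = levy_marginals M X \<Psi> q \<kappa> + real_levy_process M X
  for M :: "'w measure" and X \<Psi> q \<kappa> +
  fixes J :: "real \<Rightarrow> real"
  assumes J: "is_laplace_exponent M X J"
    and X_integrable: "\<And>t. 0 \<le> t \<Longrightarrow> integrable M (X t)"
    and X_mean: "\<And>t. 0 \<le> t \<Longrightarrow> expectation (X t) = 0"
begin

text \<open>For \<open>f\<close> vanishing on \<open>[- \<epsilon>, \<infinity>)\<close>, the integral of \<open>f v (1 - cos (s v))\<close> is the limit of expectations over
  the event \<open>X (1 / n) < - \<epsilon>\<close>, multiplied by \<open>n\<close>, and this limit is 0. Countably many such functions
  detect all of \<open>(-\<infinity>, 0)\<close>.\<close>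

lemma levy_measure_nonneg: "AE v in \<kappa>. 0 \<le> v"
proof -
  define f where "f j v = min 1 (max 0 (- v - 1 / real (Suc j)))" for j v
  have zero: "AE v in \<kappa>. f j v * (1 - cos (1 / real (Suc i) * v)) = 0" for i j
  proof -
    define s where "s = 1 / real (Suc i)"
    have cont: "continuous_on UNIV (f j)" unfolding f_def by (intro continuous_intros)
    have bdd: "\<bar>f j v\<bar> \<le> 1" for v unfolding f_def by auto
    have [measurable]: "f j \<in> borel_measurable borel" using cont by (rule borel_measurable_continuous_onI)
    have f0: "f j 0 = 0" by (auto simp: f_def)
    have nn: "0 \<le> f j v * (1 - cos (s * v))" for v
      unfolding f_def by (intro mult_nonneg_nonneg) auto
    have lim: "(\<lambda>n. real (Suc n) * expectation (\<lambda>\<omega>. f j (X (1 / Suc n) \<omega>) * (1 - cos (s * X (1 / Suc n) \<omega>))))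
      \<longlonglongrightarrow> (LINT v|\<kappa>. f j v * (1 - cos (s * v)))"
      using weighted_limit[OF cont bdd, of s] by (simp add: f0 del: of_nat_Suc)
    have up: "(\<lambda>n. 2 * (real (Suc n) * prob {\<omega> \<in> space M. X (1 / Suc n) \<omega> < - (1 / real (Suc j))})) \<longlonglongrightarrow> 2 * 0"
      by (intro tendsto_mult tendsto_const downward_increments_vanish) simp
    have "real (Suc n) * expectation (\<lambda>\<omega>. f j (X (1 / Suc n) \<omega>) * (1 - cos (s * X (1 / Suc n) \<omega>)))
      \<le> 2 * (real (Suc n) * prob {\<omega> \<in> space M. X (1 / Suc n) \<omega> < - (1 / real (Suc j))})" for n
    proof -
      have [measurable]: "X (1 / Suc n) \<in> borel_measurable M" by (rule measurable_X) simp
      let ?A = "{\<omega> \<in> space M. X (1 / Suc n) \<omega> < - (1 / real (Suc j))}"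
      have "expectation (\<lambda>\<omega>. f j (X (1 / Suc n) \<omega>) * (1 - cos (s * X (1 / Suc n) \<omega>))) \<le> expectation (\<lambda>\<omega>. 2 * indicator ?A \<omega>)"
      proof (rule integral_mono)
        have b2: "\<bar>f j v * (1 - cos (s * v))\<bar> \<le> 1 * 2" for v
        proof -
          have "\<bar>1 - cos (s * v)\<bar> \<le> 2" using cos_ge_minus_one[of "s * v"] cos_le_one[of "s * v"] by linarith
          then show ?thesis unfolding abs_mult using bdd by (intro mult_mono) auto
        qed
        show "integrable M (\<lambda>\<omega>. f j (X (1 / Suc n) \<omega>) * (1 - cos (s * X (1 / Suc n) \<omega>)))"
          using b2 by (intro bounded_integrable[of _ 2]) (auto simp del: of_nat_Suc)
        show "integrable M (\<lambda>\<omega>. 2 * indicator ?A \<omega> :: real)"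
          by (intro bounded_integrable[of _ 2]) (auto simp: indicator_def simp del: of_nat_Suc)
        fix \<omega> assume "\<omega> \<in> space M"
        then show "f j (X (1 / Suc n) \<omega>) * (1 - cos (s * X (1 / Suc n) \<omega>)) \<le> 2 * indicator ?A \<omega>"
          using b2[of "X (1 / Suc n) \<omega>"] by (auto simp: indicator_def f_def)
      qed
      also have "\<dots> = 2 * prob ?A" by (simp add: Int_def conj_commute del: of_nat_Suc)
      finally show ?thesis by (simp add: mult.left_commute del: of_nat_Suc)
    qed
    then have "(LINT v|\<kappa>. f j v * (1 - cos (s * v))) \<le> 2 * 0"
      by (intro LIMSEQ_le[OF lim up] exI allI impI)
    moreover have "0 \<le> (LINT v|\<kappa>. f j v * (1 - cos (s * v)))"
      by (intro Bochner_Integration.integral_nonneg nn)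
    ultimately have "(LINT v|\<kappa>. f j v * (1 - cos (s * v))) = 0" by simp
    moreover have "integrable \<kappa> (\<lambda>v. f j v * (1 - cos (s * v)))"
    proof (rule Bochner_Integration.integrable_bound[OF weight_integrable[of s]])
      show "AE x in \<kappa>. norm (f j x * (1 - cos (s * x))) \<le> norm (1 - cos (s * x))"
        using bdd by (auto intro!: mult_left_le_one_le simp: abs_mult)
    qed measurable
    ultimately show ?thesis
      using integral_nonneg_eq_0_iff_AE[of \<kappa> "\<lambda>v. f j v * (1 - cos (s * v))"] nn by (simp add: s_def)
  qed
  then have "AE v in \<kappa>. \<forall>i j. f j v * (1 - cos (1 / real (Suc i) * v)) = 0"
    by (simp only: AE_all_countable simp_thms)
  then show ?thesis
  proof eventually_elim
    case (elim v)
    show ?case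
    proof (rule ccontr)
      assume "\<not> 0 \<le> v"
      then have v: "v < 0" by simp
      obtain j where j: "1 / real (Suc j) < - v" using v nat_approx_posE[of "- v"] by auto
      obtain i where i: "- v < real i" using reals_Archimedean2 by blast
      then have "\<bar>1 / real (Suc i) * v\<bar> < 1" using v by (auto simp: abs_mult field_simps)
      then have "\<bar>1 / real (Suc i) * v\<bar> < pi" using pi_ge_two by linarith
      moreover have "1 / real (Suc i) * v \<noteq> 0" using v by simp
      ultimately have "0 < 1 - cos (1 / real (Suc i) * v)" by (intro one_minus_cos_pos)
      moreover have "0 < f j v" using j by (auto simp: f_def)
      ultimately show False using elim by (metis less_irrefl mult_pos_pos)
    qed
  qed
qed

lemma expectation_comp_exp:
  assumes "0 \<le> t" "0 \<le> b"
  shows "integrable M (\<lambda>\<omega>. comp_exp (b * X t \<omega>))"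
    and "expectation (\<lambda>\<omega>. comp_exp (b * X t \<omega>)) = exp (t * J b) - 1"
proof -
  have "integrable M (\<lambda>\<omega>. exp (- b * X t \<omega>))" "expectation (\<lambda>\<omega>. exp (- b * X t \<omega>)) = exp (t * J b)"
    using J assms by (auto simp: is_laplace_exponent_def)
  then show "integrable M (\<lambda>\<omega>. comp_exp (b * X t \<omega>))"
    and "expectation (\<lambda>\<omega>. comp_exp (b * X t \<omega>)) = exp (t * J b) - 1"
    using X_integrable[OF assms(1)] X_mean[OF assms(1)]
    by (simp_all add: comp_exp_def prob_space)
qed

lemma J_nonneg: "0 \<le> b \<Longrightarrow> 0 \<le> J b"
  using expectation_comp_exp(2)[of 1 b] Bochner_Integration.integral_nonneg[of M "\<lambda>\<omega>. comp_exp (b * X 1 \<omega>)"] comp_exp_nonneg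
  by simp

lemma J_0: "J 0 = 0"
  using expectation_comp_exp(2)[of 1 0] by simp

text \<open>Since \<open>X 1\<close> has mean 0, \<open>exp (J c) - 1\<close> is the expectation of \<open>comp_exp (c X 1)\<close>, which is \<open>o(c)\<close> by
  dominated convergence: convexity gives \<open>comp_exp (c x) \<le> c comp_exp x\<close>.\<close>

lemma J_sublinear_at_0: "(\<lambda>k. real (Suc k) * J (1 / real (Suc k))) \<longlonglongrightarrow> 0"
proof -
  have "(\<lambda>k. LINT \<omega>|M. real (Suc k) * comp_exp (1 / real (Suc k) * X 1 \<omega>)) \<longlonglongrightarrow> (LINT \<omega>|M. 0)"
  proof (rule integral_dominated_convergence[where w="\<lambda>\<omega>. comp_exp (1 * X 1 \<omega>)"])
    have [measurable]: "X 1 \<in> borel_measurable M" by (rule measurable_X) simp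
    show "integrable M (\<lambda>\<omega>. comp_exp (1 * X 1 \<omega>))" by (rule expectation_comp_exp) auto
    show "(\<lambda>\<omega>. real (Suc k) * comp_exp (1 / real (Suc k) * X 1 \<omega>)) \<in> borel_measurable M" for k
      by measurable
    show "AE \<omega> in M. (\<lambda>k. real (Suc k) * comp_exp (1 / real (Suc k) * X 1 \<omega>)) \<longlonglongrightarrow> 0"
    proof (rule AE_I2)
      fix \<omega>
      have "(\<lambda>k. real (Suc k) * (exp (- X 1 \<omega> / real (Suc k)) - 1) + X 1 \<omega>) \<longlonglongrightarrow> - X 1 \<omega> + X 1 \<omega>"
        by (intro tendsto_add tendsto_const exp_difference_quotient)
      moreover have "real (Suc k) * (exp (- X 1 \<omega> / real (Suc k)) - 1) + X 1 \<omega>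
          = real (Suc k) * comp_exp (1 / real (Suc k) * X 1 \<omega>)" for k
        by (simp add: comp_exp_def ring_distribs del: of_nat_Suc)
      ultimately show "(\<lambda>k. real (Suc k) * comp_exp (1 / real (Suc k) * X 1 \<omega>)) \<longlonglongrightarrow> 0"
        by (simp only: add.left_inverse)
    qed
    show "AE \<omega> in M. norm (real (Suc k) * comp_exp (1 / real (Suc k) * X 1 \<omega>)) \<le> comp_exp (1 * X 1 \<omega>)" for k
    proof (rule AE_I2)
      fix \<omega>
      have "comp_exp (1 / real (Suc k) * X 1 \<omega>) \<le> 1 / real (Suc k) * comp_exp (X 1 \<omega>)"
        by (rule comp_exp_contract) auto
      then have "real (Suc k) * comp_exp (1 / real (Suc k) * X 1 \<omega>) \<le> comp_exp (X 1 \<omega>)"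
        by (simp add: field_simps del: of_nat_Suc)
      then show "norm (real (Suc k) * comp_exp (1 / real (Suc k) * X 1 \<omega>)) \<le> comp_exp (1 * X 1 \<omega>)"
        by (simp add: abs_mult abs_of_nonneg[OF comp_exp_nonneg] del: of_nat_Suc)
    qed
  qed simp
  then have lim: "(\<lambda>k. real (Suc k) * (exp (1 * J (1 / real (Suc k))) - 1)) \<longlonglongrightarrow> 0"
    by (simp only: integral_mult_right_zero expectation_comp_exp(2)[OF zero_le_one divide_nonneg_nonneg[OF zero_le_one of_nat_0_le_iff]] integral_zero)
  show ?thesis
  proof (rule tendsto_sandwich[OF _ _ tendsto_const lim])
    show "\<forall>\<^sub>F k in sequentially. 0 \<le> real (Suc k) * J (1 / real (Suc k))"
      by (intro always_eventually allI mult_nonneg_nonneg J_nonneg) auto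
    show "\<forall>\<^sub>F k in sequentially. real (Suc k) * J (1 / real (Suc k)) \<le> real (Suc k) * (exp (1 * J (1 / real (Suc k))) - 1)"
    proof (intro always_eventually allI mult_left_mono)
      fix k show "J (1 / real (Suc k)) \<le> exp (1 * J (1 / real (Suc k))) - 1"
        using exp_ge_add_one_self[of "J (1 / real (Suc k))"] by (simp only: mult_1)
    qed simp
  qed
qed

text \<open>The weight \<open>1 - cos (x / K)\<close> has no zero besides 0 in the support of the cutoff, so the test function
  divided by it extends continuously to 0.\<close>

lemma truncated_limit:
  assumes b: "b > 0" and K: "K > 0"
  shows "integrable \<kappa> (\<lambda>v. comp_exp (b * v) * cutoff K v)"
    and "(\<lambda>n. real (Suc n) * expectation (\<lambda>\<omega>. comp_exp (b * X (1 / Suc n) \<omega>) * cutoff K (X (1 / Suc n) \<omega>)))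
    \<longlonglongrightarrow> q * b\<^sup>2 / 2 + (LINT v|\<kappa>. comp_exp (b * v) * cutoff K v)"
proof -
  define s where "s = 1 / K"
  have s: "s > 0" using K by (simp add: s_def)
  \<comment> \<open>the value at 0 is the limit of the quotient, as both terms are quadratic there\<close>
  define h where "h x = (if x = 0 then b\<^sup>2 / s\<^sup>2 else comp_exp (b * x) * cutoff K x / (1 - cos (s * x)))" for x
  have pos: "0 < 1 - cos (s * x)" if "x \<noteq> 0" "\<bar>x\<bar> < 3 * K" for x
  proof (rule one_minus_cos_pos)
    have "\<bar>x\<bar> < K * pi" using that(2) mult_strict_left_mono[OF pi_gt3 K] by linarith
    then show "\<bar>s * x\<bar> < pi" using K by (auto simp: s_def abs_mult field_simps)
  qed (use that s in auto)
  have hw: "h x * (1 - cos (s * x)) = comp_exp (b * x) * cutoff K x" for x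
  proof (cases "\<bar>x\<bar> < 3 * K")
    case True
    then show ?thesis using pos[of x] by (auto simp: h_def)
  next
    case False
    then show ?thesis using K by (auto simp: h_def cutoff_eq_0)
  qed
  have cont: "isCont h x" for x
  proof -
    consider "x = 0" | "x \<noteq> 0" "\<bar>x\<bar> < 3 * K" | "\<bar>x\<bar> > 2 * K" using K by linarith
    then show ?thesis
    proof cases
      case 1
      have "((\<lambda>x. comp_exp (b * x) / (1 - cos (s * x))) \<longlongrightarrow> b\<^sup>2 / s\<^sup>2) (at 0)"
        using b s by (rule comp_exp_weight_limit)
      then have "(h \<longlongrightarrow> b\<^sup>2 / s\<^sup>2) (at 0)"
      proof (rule Lim_transform_eventually)
        show "\<forall>\<^sub>F x in at 0. comp_exp (b * x) / (1 - cos (s * x)) = h x"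
          unfolding eventually_at using K
          by (intro exI[of _ K]) (auto simp: h_def cutoff_eq_1 dist_real_def)
      qed
      then show ?thesis using 1 by (simp add: isCont_def h_def)
    next
      case 2
      have op: "open {x. x \<noteq> 0 \<and> \<bar>x\<bar> < 3 * K}"
        by (intro open_Collect_conj open_Collect_neq open_Collect_less continuous_intros)
      have "continuous_on {x. x \<noteq> 0 \<and> \<bar>x\<bar> < 3 * K} (\<lambda>x. comp_exp (b * x) * cutoff K x / (1 - cos (s * x)))"
        unfolding comp_exp_def cutoff_def using pos K by (intro continuous_intros) force+
      then have "continuous_on {x. x \<noteq> 0 \<and> \<bar>x\<bar> < 3 * K} h"
        by (rule continuous_on_eq) (auto simp: h_def)
      then show ?thesis using op 2 by (auto simp: continuous_on_eq_continuous_at)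
    next
      case 3
      have op: "open {x. \<bar>x\<bar> > 2 * K}"
        by (intro open_Collect_less continuous_intros)
      have "continuous_on {x. \<bar>x\<bar> > 2 * K} h"
        by (rule continuous_on_eq[OF continuous_on_const[of _ 0]]) (use K in \<open>auto simp: h_def cutoff_eq_0\<close>)
      then show ?thesis using op 3 by (auto simp: continuous_on_eq_continuous_at)
    qed
  qed
  then have conth: "continuous_on UNIV h" by (simp add: continuous_at_imp_continuous_on)
  then have [measurable]: "h \<in> borel_measurable borel" by (rule borel_measurable_continuous_onI)
  have "compact (h ` {- (2 * K)..2 * K})"
    using conth by (intro compact_continuous_image) (auto intro: continuous_on_subset)
  then have "\<exists>B. \<forall>x\<in>{- (2 * K)..2 * K}. \<bar>h x\<bar> \<le> B"
    by (auto dest!: compact_imp_bounded simp: bounded_iff)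
  then obtain B where B: "\<And>x. x \<in> {- (2 * K)..2 * K} \<Longrightarrow> \<bar>h x\<bar> \<le> B" by blast
  have B0: "0 \<le> B" using B[of 0] K by auto
  have bdd: "\<bar>h x\<bar> \<le> B" for x
  proof (cases "x \<in> {- (2 * K)..2 * K}")
    case False
    then have "h x = 0" using K by (auto simp: h_def cutoff_eq_0)
    then show ?thesis using B0 by simp
  qed (rule B)
  have "integrable \<kappa> (\<lambda>v. h v * (1 - cos (s * v)))"
  proof (rule Bochner_Integration.integrable_bound[OF integrable_mult_right[OF weight_integrable[of s], of B]])
    show "AE x in \<kappa>. norm (h x * (1 - cos (s * x))) \<le> norm (B * (1 - cos (s * x)))"
      using bdd B0 by (auto intro!: mult_right_mono simp: abs_mult)
  qed measurable
  then show "integrable \<kappa> (\<lambda>v. comp_exp (b * v) * cutoff K v)" by (simp only: hw)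
  have "q * s\<^sup>2 / 2 * h 0 = q * b\<^sup>2 / 2" using s by (simp add: h_def)
  then show "(\<lambda>n. real (Suc n) * expectation (\<lambda>\<omega>. comp_exp (b * X (1 / Suc n) \<omega>) * cutoff K (X (1 / Suc n) \<omega>)))
    \<longlonglongrightarrow> q * b\<^sup>2 / 2 + (LINT v|\<kappa>. comp_exp (b * v) * cutoff K v)"
    using weighted_limit[OF conth bdd, of s] by (simp only: hw)
qed

text \<open>Both tail terms are expectations of the form \<open>n (exp (J c / n) - 1)\<close>, which converge to \<open>J c\<close>.\<close>

lemma truncation_error:
  assumes b: "b > 0" and K: "K \<ge> 1"
  defines "I \<equiv> (LINT v|\<kappa>. comp_exp (b * v) * cutoff K v)"
  shows "q * b\<^sup>2 / 2 + I \<le> J b"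
    and "J b - (q * b\<^sup>2 / 2 + I) \<le> exp 1 * b * (K * J (1 / K)) + exp (- (b * K)) * J (2 * b)"
proof -
  define L where "L n = real (Suc n) * expectation (\<lambda>\<omega>. comp_exp (b * X (1 / Suc n) \<omega>) * cutoff K (X (1 / Suc n) \<omega>))" for n
  define A where "A c n = real (Suc n) * expectation (\<lambda>\<omega>. comp_exp (c * X (1 / Suc n) \<omega>))" for c n
  have L: "L \<longlonglongrightarrow> q * b\<^sup>2 / 2 + I"
    unfolding L_def I_def using b K by (intro truncated_limit) auto
  have A: "A c \<longlonglongrightarrow> J c" if "0 \<le> c" for c
    using exp_difference_quotient[of "J c"] that unfolding A_def
    by (simp add: expectation_comp_exp(2) del: of_nat_Suc)
  have *: "L n \<le> A b n \<and> A b n - L n \<le> exp 1 * b * (K * A (1 / K) n) + exp (- (b * K)) * A (2 * b) n" for n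
  proof -
    have [measurable]: "X (1 / Suc n) \<in> borel_measurable M" by (rule measurable_X) simp
    let ?X = "X (1 / Suc n)"
    have int: "integrable M (\<lambda>\<omega>. comp_exp (c * ?X \<omega>))" if "0 \<le> c" for c
      using that by (intro expectation_comp_exp) auto
    have le: "comp_exp (b * x) * cutoff K x \<le> comp_exp (b * x)" for x
      using mult_left_mono[of "cutoff K x" 1 "comp_exp (b * x)"] cutoff_range[of K x] comp_exp_nonneg[of "b * x"] by simp
    have int2: "integrable M (\<lambda>\<omega>. comp_exp (b * ?X \<omega>) * cutoff K (?X \<omega>))"
      using le b cutoff_range comp_exp_nonneg
      by (intro Bochner_Integration.integrable_bound[OF int[of b]]) (auto simp: abs_mult simp del: of_nat_Suc)
    have "expectation (\<lambda>\<omega>. comp_exp (b * ?X \<omega>) * cutoff K (?X \<omega>)) \<le> expectation (\<lambda>\<omega>. comp_exp (b * ?X \<omega>))"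
      using b by (intro integral_mono int int2 le) auto
    then have 1: "L n \<le> A b n" unfolding L_def A_def by (intro mult_left_mono) auto
    have "expectation (\<lambda>\<omega>. comp_exp (b * ?X \<omega>)) - expectation (\<lambda>\<omega>. comp_exp (b * ?X \<omega>) * cutoff K (?X \<omega>))
      = expectation (\<lambda>\<omega>. comp_exp (b * ?X \<omega>) - comp_exp (b * ?X \<omega>) * cutoff K (?X \<omega>))"
      using b int[of b] int2 by simp
    also have "\<dots> \<le> expectation (\<lambda>\<omega>. exp 1 * b * (K * comp_exp (1 / K * ?X \<omega>)) + exp (- (b * K)) * comp_exp (2 * b * ?X \<omega>))"
    proof (rule integral_mono)
      show "integrable M (\<lambda>\<omega>. comp_exp (b * ?X \<omega>) - comp_exp (b * ?X \<omega>) * cutoff K (?X \<omega>))"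
        using b int[of b] int2 by auto
      show "integrable M (\<lambda>\<omega>. exp 1 * b * (K * comp_exp (1 / K * ?X \<omega>)) + exp (- (b * K)) * comp_exp (2 * b * ?X \<omega>))"
        using b K by (intro Bochner_Integration.integrable_add integrable_mult_right int) auto
      show "comp_exp (b * ?X \<omega>) - comp_exp (b * ?X \<omega>) * cutoff K (?X \<omega>)
        \<le> exp 1 * b * (K * comp_exp (1 / K * ?X \<omega>)) + exp (- (b * K)) * comp_exp (2 * b * ?X \<omega>)" for \<omega>
        using comp_exp_tail[OF b K, of "?X \<omega>"] by (simp add: right_diff_distrib)
    qed
    also have "\<dots> = exp 1 * b * (K * expectation (\<lambda>\<omega>. comp_exp (1 / K * ?X \<omega>))) + exp (- (b * K)) * expectation (\<lambda>\<omega>. comp_exp (2 * b * ?X \<omega>))"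
      using b K int[of "1 / K"] int[of "2 * b"] by (subst Bochner_Integration.integral_add) auto
    finally have "real (Suc n) * (expectation (\<lambda>\<omega>. comp_exp (b * ?X \<omega>)) - expectation (\<lambda>\<omega>. comp_exp (b * ?X \<omega>) * cutoff K (?X \<omega>)))
      \<le> real (Suc n) * (exp 1 * b * (K * expectation (\<lambda>\<omega>. comp_exp (1 / K * ?X \<omega>))) + exp (- (b * K)) * expectation (\<lambda>\<omega>. comp_exp (2 * b * ?X \<omega>)))"
      by (rule mult_left_mono) simp
    with 1 show ?thesis unfolding L_def A_def
      by (simp add: right_diff_distrib distrib_left mult_ac del: of_nat_Suc)
  qed
  show "q * b\<^sup>2 / 2 + I \<le> J b"
    using b * by (intro LIMSEQ_le[OF L A]) auto
  have AbL: "(\<lambda>n. A b n - L n) \<longlonglongrightarrow> J b - (q * b\<^sup>2 / 2 + I)"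
    using b by (intro tendsto_diff A L) auto
  have R: "(\<lambda>n. exp 1 * b * (K * A (1 / K) n) + exp (- (b * K)) * A (2 * b) n)
     \<longlonglongrightarrow> exp 1 * b * (K * J (1 / K)) + exp (- (b * K)) * J (2 * b)"
    using b K by (intro tendsto_add tendsto_mult tendsto_const A) auto
  show "J b - (q * b\<^sup>2 / 2 + I) \<le> exp 1 * b * (K * J (1 / K)) + exp (- (b * K)) * J (2 * b)"
    using * by (intro LIMSEQ_le[OF AbL R]) blast
qed

text \<open>As the truncation level grows, the error bound tends to 0, and monotone convergence identifies the
  limit and shows that the integral is finite.\<close>

theorem laplace_exponent_formula:
  assumes "0 \<le> b"
  shows "integrable \<kappa> (\<lambda>v. comp_exp (b * v))"
    and "J b = q * b\<^sup>2 / 2 + (LINT v|\<kappa>. comp_exp (b * v))"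
proof -
  have "integrable \<kappa> (\<lambda>v. comp_exp (b * v)) \<and> (LINT v|\<kappa>. comp_exp (b * v)) = J b - q * b\<^sup>2 / 2"
  proof (cases "b = 0")
    case True
    then show ?thesis by (simp add: J_0)
  next
    case False
    with assms have b: "b > 0" by simp
    define f where "f k v = comp_exp (b * v) * cutoff (real (Suc k)) v" for k v
    define I where "I k = (LINT v|\<kappa>. f k v)" for k
    define R where "R k = exp 1 * b * (real (Suc k) * J (1 / real (Suc k))) + exp (- (b * real (Suc k))) * J (2 * b)" for k
    have "(\<lambda>k. exp (- (b * real (Suc k)))) \<longlonglongrightarrow> 0"
      using b by real_asymp
    then have "R \<longlonglongrightarrow> exp 1 * b * 0 + 0 * J (2 * b)"
      unfolding R_def by (intro tendsto_add tendsto_mult tendsto_const J_sublinear_at_0)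
    then have R0: "R \<longlonglongrightarrow> 0" by simp
    have bound: "\<bar>J b - (q * b\<^sup>2 / 2 + I k)\<bar> \<le> R k" for k
      using truncation_error[OF b, of "real (Suc k)"] by (simp add: I_def f_def R_def del: of_nat_Suc)
    have "(\<lambda>k. J b - (q * b\<^sup>2 / 2 + I k)) \<longlonglongrightarrow> 0"
      by (rule Lim_null_comparison[OF _ R0]) (simp only: real_norm_def bound eventually_True)
    from tendsto_diff[OF tendsto_const this, of "J b - q * b\<^sup>2 / 2"]
    have I: "I \<longlonglongrightarrow> J b - q * b\<^sup>2 / 2" by simp
    have i: "integrable \<kappa> (f k)" for k unfolding f_def using b by (intro truncated_limit) auto
    have m: "AE v in \<kappa>. mono (\<lambda>k. f k v)"
      unfolding f_def by (auto simp: mono_def intro!: mult_left_mono cutoff_mono comp_exp_nonneg)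
    have p: "AE v in \<kappa>. 0 \<le> f k v" for k
      unfolding f_def by (auto intro!: mult_nonneg_nonneg comp_exp_nonneg cutoff_range)
    have l: "AE v in \<kappa>. (\<lambda>k. f k v) \<longlonglongrightarrow> comp_exp (b * v)"
    proof (rule AE_I2)
      fix v
      have "\<forall>\<^sub>F k in sequentially. \<bar>v\<bar> \<le> real (Suc k)"
        by real_asymp
      then have "\<forall>\<^sub>F k in sequentially. f k v = comp_exp (b * v)"
        by eventually_elim (simp add: f_def cutoff_eq_1 del: of_nat_Suc)
      then show "(\<lambda>k. f k v) \<longlonglongrightarrow> comp_exp (b * v)" by (rule tendsto_eventually)
    qed
    have il: "(\<lambda>k. integral\<^sup>L \<kappa> (f k)) \<longlonglongrightarrow> J b - q * b\<^sup>2 / 2" using I by (simp add: I_def[abs_def])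
    have me: "(\<lambda>v. comp_exp (b * v)) \<in> borel_measurable \<kappa>" by measurable
    show ?thesis
      using integral_monotone_convergence_nonneg[OF i m p l il me] by simp
  qed
  then show "integrable \<kappa> (\<lambda>v. comp_exp (b * v))" "J b = q * b\<^sup>2 / 2 + (LINT v|\<kappa>. comp_exp (b * v))"
    by auto
qed

end

section \<open>Finite variation and uniqueness\<close>

lemma comp_exp_le_power2:
  assumes "0 \<le> y"
  shows "comp_exp y \<le> y\<^sup>2"
proof -
  obtain t where t: "\<bar>t\<bar> \<le> \<bar>- y\<bar>" "exp (- y) = (\<Sum>m<3. (- y) ^ m / fact m) + exp t / fact 3 * (- y) ^ 3"
    using Maclaurin_exp_le[of "- y" 3] by blast
  have "exp t / fact 3 * (- y) ^ 3 \<le> 0"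
    using assms by (intro mult_nonneg_nonpos) (auto simp: power3_eq_cube mult_nonneg_nonneg)
  moreover have "(\<Sum>m<3. (- y) ^ m / fact m) = 1 - y + y\<^sup>2 / 2"
    by (simp add: numeral_3_eq_3 power2_eq_square)
  ultimately have "comp_exp y \<le> y\<^sup>2 / 2" using t(2) unfolding comp_exp_def by linarith
  also have "\<dots> \<le> y\<^sup>2" by simp
  finally show ?thesis .
qed

lemma comp_exp_second_difference:
  "comp_exp ((b + 2) * v) - 2 * comp_exp ((b + 1) * v) + comp_exp (b * v) = (1 - exp (- v))\<^sup>2 * exp (- b * v)"
proof -
  have "exp (- ((b + 2) * v)) = exp (- b * v) * (exp (- v))\<^sup>2" "exp (- ((b + 1) * v)) = exp (- b * v) * exp (- v)"
    by (simp_all add: algebra_simps flip: exp_add exp_of_nat_mult power2_eq_square)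
  then show ?thesis
    by (simp add: comp_exp_def power2_eq_square algebra_simps)
qed

text \<open>The finite measure \<open>(1 - exp (- v))\<^sup>2 \<kappa>(dv)\<close> has as Laplace transform a second difference of
  \<open>b \<mapsto> \<integral> comp_exp (b v) \<kappa>(dv)\<close>, and its density does not vanish on \<open>(0, \<infinity>)\<close>.\<close>

lemma levy_measure_unique:
  fixes \<kappa>\<^sub>1 \<kappa>\<^sub>2 :: "real measure"
  assumes sets: "sets \<kappa>\<^sub>1 = sets borel" "sets \<kappa>\<^sub>2 = sets borel"
    and int: "\<And>b. 0 \<le> b \<Longrightarrow> integrable \<kappa>\<^sub>1 (\<lambda>v. comp_exp (b * v))"
      "\<And>b. 0 \<le> b \<Longrightarrow> integrable \<kappa>\<^sub>2 (\<lambda>v. comp_exp (b * v))"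
    and x: "0 \<le> x"
    and eq: "\<And>b. 0 \<le> b \<Longrightarrow> (LINT v|\<kappa>\<^sub>1. comp_exp (b * v)) = x * (LINT v|\<kappa>\<^sub>2. comp_exp (b * v))"
    and A: "A \<in> sets borel" "A \<subseteq> {0<..}"
  shows "emeasure \<kappa>\<^sub>1 A = ennreal x * emeasure \<kappa>\<^sub>2 A"
proof -
  define w where "w v = (1 - exp (- v))\<^sup>2" for v :: real
  have w0: "0 \<le> w v" for v by (simp add: w_def)
  have [measurable]: "w \<in> borel_measurable borel" unfolding w_def by measurable
  have wint: "integrable \<kappa> (\<lambda>v. w v * exp (- b * v))"
    and weq: "(LINT v|\<kappa>. w v * exp (- b * v)) = (LINT v|\<kappa>. comp_exp ((b + 2) * v))
      - 2 * (LINT v|\<kappa>. comp_exp ((b + 1) * v)) + (LINT v|\<kappa>. comp_exp (b * v))"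
    if "\<And>b. 0 \<le> b \<Longrightarrow> integrable \<kappa> (\<lambda>v. comp_exp (b * v))" "0 \<le> b" for \<kappa> :: "real measure" and b
    using that(1)[of b] that(1)[of "b + 1"] that(1)[of "b + 2"] that(2)
    by (simp_all only: w_def comp_exp_second_difference[symmetric]) auto
  have lap: "finite_measure (density \<kappa> (\<lambda>v. ennreal (c * w v)))"
    "\<And>b. 0 \<le> b \<Longrightarrow> integrable (density \<kappa> (\<lambda>v. ennreal (c * w v))) (\<lambda>v. exp (- b * v))"
    "\<And>b. (LINT v|density \<kappa> (\<lambda>v. ennreal (c * w v)). exp (- b * v)) = c * (LINT v|\<kappa>. w v * exp (- b * v))"
    if \<kappa>: "sets \<kappa> = sets borel" "\<And>b. 0 \<le> b \<Longrightarrow> integrable \<kappa> (\<lambda>v. comp_exp (b * v))" and c: "0 \<le> c"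
    for \<kappa> :: "real measure" and c
  proof -
    note [measurable_cong] = \<kappa>(1)
    have "integrable \<kappa> (\<lambda>v. c * w v)" using wint[OF \<kappa>(2), of 0] by simp
    then have "(\<integral>\<^sup>+v. ennreal (c * w v) \<partial>\<kappa>) < \<infinity>"
      using c w0 by (subst nn_integral_eq_integral) auto
    then show "finite_measure (density \<kappa> (\<lambda>v. ennreal (c * w v)))"
      by (intro finite_measureI) (simp add: emeasure_density)
    show "integrable (density \<kappa> (\<lambda>v. ennreal (c * w v))) (\<lambda>v. exp (- b * v))" if "0 \<le> b" for b
      using wint[OF \<kappa>(2) that] c w0 by (subst integrable_density) (auto simp: mult.assoc)
    show "(LINT v|density \<kappa> (\<lambda>v. ennreal (c * w v)). exp (- b * v)) = c * (LINT v|\<kappa>. w v * exp (- b * v))" for b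
      using c w0 by (subst integral_density) (auto simp: mult.assoc)
  qed
  have "density \<kappa>\<^sub>1 (\<lambda>v. ennreal (1 * w v)) = density \<kappa>\<^sub>2 (\<lambda>v. ennreal (x * w v))"
  proof (rule bilateral_laplace_unique)
    fix b :: real assume b: "0 \<le> b"
    have e: "(LINT v|\<kappa>\<^sub>1. comp_exp (c * v)) = x * (LINT v|\<kappa>\<^sub>2. comp_exp (c * v))"
      if "c \<in> {b, b + 1, b + 2}" for c using that b by (intro eq) auto
    show "(LINT v|density \<kappa>\<^sub>1 (\<lambda>v. ennreal (1 * w v)). exp (- b * v)) = (LINT v|density \<kappa>\<^sub>2 (\<lambda>v. ennreal (x * w v)). exp (- b * v))"
      using b by (simp only: lap(3)[OF sets(1) int(1) zero_le_one] lap(3)[OF sets(2) int(2) x]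
          weq[OF int(1)] weq[OF int(2)] e insertI1 insertI2) (simp add: right_diff_distrib distrib_left)
  qed (use lap[OF sets(1) int(1) zero_le_one] lap[OF sets(2) int(2) x] sets in auto)
  then have d: "density \<kappa>\<^sub>1 (\<lambda>v. ennreal (w v)) = density \<kappa>\<^sub>2 (\<lambda>v. ennreal (x * w v))" by simp
  have inv: "emeasure \<kappa> A * ennreal c = (\<integral>\<^sup>+v. ennreal (1 / w v) * indicator A v \<partial>density \<kappa> (\<lambda>v. ennreal (c * w v)))"
    if \<kappa>: "sets \<kappa> = sets borel" and c: "0 \<le> c" for \<kappa> :: "real measure" and c
  proof -
    note [measurable_cong] = \<kappa>
    have "(\<integral>\<^sup>+v. ennreal (1 / w v) * indicator A v \<partial>density \<kappa> (\<lambda>v. ennreal (c * w v)))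
      = (\<integral>\<^sup>+v. ennreal (c * w v) * (ennreal (1 / w v) * indicator A v) \<partial>\<kappa>)"
      using A by (subst nn_integral_density) auto
    also have "\<dots> = (\<integral>\<^sup>+v. ennreal c * indicator A v \<partial>\<kappa>)"
    proof (rule nn_integral_cong)
      fix v
      show "ennreal (c * w v) * (ennreal (1 / w v) * indicator A v) = ennreal c * indicator A v"
      proof (cases "v \<in> A")
        case True
        then have "v > 0" using A by auto
        then have "w v > 0" by (simp add: w_def)
        then show ?thesis using True c by (simp add: ennreal_mult[symmetric])
      qed simp
    qed
    also have "\<dots> = emeasure \<kappa> A * ennreal c"
      using A \<kappa> by (simp add: nn_integral_cmult mult.commute)
    finally show ?thesis ..
  qed
  show ?thesis
    using inv[OF sets(1), of 1] inv[OF sets(2) x] d by (simp add: mult.commute)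
qed

lemma normal_laplace:
  assumes s: "0 < s"
  shows "integrable lborel (\<lambda>x. normal_density 0 s x * exp (- b * x))"
    and "(LINT x|lborel. normal_density 0 s x * exp (- b * x)) = exp (b\<^sup>2 * s\<^sup>2 / 2)"
proof -
  have eq: "normal_density 0 s x * exp (- b * x) = exp (b\<^sup>2 * s\<^sup>2 / 2) * normal_density (- (b * s\<^sup>2)) s x" for x
  proof -
    have "- x\<^sup>2 / (2 * s\<^sup>2) + - b * x = b\<^sup>2 * s\<^sup>2 / 2 + - (x + b * s\<^sup>2)\<^sup>2 / (2 * s\<^sup>2)"
      using s by (simp add: field_simps power2_eq_square)
    then have "exp (- x\<^sup>2 / (2 * s\<^sup>2)) * exp (- b * x) = exp (b\<^sup>2 * s\<^sup>2 / 2) * exp (- (x + b * s\<^sup>2)\<^sup>2 / (2 * s\<^sup>2))"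
      by (simp only: flip: exp_add)
    then show ?thesis by (simp add: normal_density_def)
  qed
  show "integrable lborel (\<lambda>x. normal_density 0 s x * exp (- b * x))"
    unfolding eq using s by auto
  show "(LINT x|lborel. normal_density 0 s x * exp (- b * x)) = exp (b\<^sup>2 * s\<^sup>2 / 2)"
    unfolding eq using s by simp
qed

context spectrally_positive
begin

lemma laplace:
  assumes "0 \<le> t" "0 \<le> b"
  shows "integrable M (\<lambda>\<omega>. exp (- b * X t \<omega>))" "expectation (\<lambda>\<omega>. exp (- b * X t \<omega>)) = exp (t * J b)"
  using J assms by (auto simp: is_laplace_exponent_def)

lemma J_star_shaped:
  assumes "0 \<le> c" "c \<le> 1" "0 \<le> b"
  shows "J (c * b) \<le> c * J b"
proof -
  have "(LINT v|\<kappa>. comp_exp (c * b * v)) \<le> (LINT v|\<kappa>. c * comp_exp (b * v))"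
    using assms comp_exp_contract[of c] by (intro integral_mono laplace_exponent_formula integrable_mult_right)
      (auto simp: mult.assoc)
  moreover have "c\<^sup>2 \<le> c" using assms by (simp add: power2_eq_square mult_left_le)
  then have "q * (c * b)\<^sup>2 / 2 \<le> c * (q * b\<^sup>2 / 2)"
    using mult_right_mono[of "c\<^sup>2" c "q * b\<^sup>2 / 2"] q_nonneg by (simp add: power_mult_distrib mult_ac)
  ultimately show ?thesis
    using assms laplace_exponent_formula(2)[of b] laplace_exponent_formula(2)[of "c * b"]
    by (simp add: distrib_left)
qed

text \<open>Regular variation makes \<open>J x / J x\<close> tend to 1, so \<open>J\<close> has no zeros close to 0 (there the quotient would
  be 0). The inequality \<open>J (c b) \<le> c J b\<close> carries positivity to larger arguments.\<close>

lemma J_pos: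
  assumes reg: "varies_regularly_at_0 J \<alpha>" and b: "0 < b"
  shows "0 < J b"
proof -
  have "((\<lambda>x. J (1 * x) / J x) \<longlongrightarrow> 1 powr \<alpha>) (at_right 0)"
    using reg unfolding varies_regularly_at_0_def by (rule allE[of _ 1]) simp
  then have "\<forall>\<^sub>F x in at_right 0. 0 < J x / J x"
    by (intro order_tendstoD) auto
  then have "\<forall>\<^sub>F x in at_right 0. J x \<noteq> 0 \<and> x \<in> {0<..<b}"
    using eventually_at_right_real[OF b] by eventually_elim auto
  then obtain x where x: "J x \<noteq> 0" "0 < x" "x < b"
    using eventually_happens[of _ "at_right (0::real)"] by fastforce
  then have "0 < J x" using J_nonneg[of x] by simp
  also have "J x = J (x / b * b)" using b by simp
  also have "\<dots> \<le> x / b * J b" using x b by (intro J_star_shaped) auto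
  finally show ?thesis using x b by (simp add: zero_less_mult_iff zero_less_divide_iff)
qed

text \<open>The expectation of \<open>exp (- b (X h + m h))\<close> is at most 1 for every \<open>b \<ge> 0\<close>, which leaves no mass on
  \<open>X h + m h < 0\<close>.\<close>

lemma drift_bound:
  assumes m: "\<And>b. 0 \<le> b \<Longrightarrow> J b \<le> b * m" and h: "0 \<le> h"
  shows "prob {\<omega> \<in> space M. X h \<omega> \<in> {..< - (m * h)}} = 0"
proof -
  have [measurable]: "X h \<in> borel_measurable M" using h by (rule measurable_X)
  have small: "prob {\<omega> \<in> space M. X h \<omega> < - (m * h) - \<epsilon>} = 0" if e: "\<epsilon> > 0" for \<epsilon>
  proof -
    let ?A = "{\<omega> \<in> space M. X h \<omega> < - (m * h) - \<epsilon>}"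
    have le: "prob ?A \<le> exp (- (real n * \<epsilon>))" for n
    proof -
      have "prob ?A = expectation (indicator ?A)" by simp
      also have "\<dots> \<le> expectation (\<lambda>\<omega>. exp (- (real n * (m * h + \<epsilon>))) * exp (- real n * X h \<omega>))"
      proof (rule integral_mono)
        show "integrable M (indicator ?A :: 'w \<Rightarrow> real)"
          by (intro bounded_integrable[of _ 1]) (auto simp: indicator_def)
        show "integrable M (\<lambda>\<omega>. exp (- (real n * (m * h + \<epsilon>))) * exp (- real n * X h \<omega>))"
          using h by (intro integrable_mult_right laplace) auto
        fix \<omega> assume "\<omega> \<in> space M"
        have "1 \<le> exp (real n * (- (m * h) - \<epsilon> - X h \<omega>))" if "X h \<omega> < - (m * h) - \<epsilon>"
          using that by auto
        moreover have "exp (real n * (- (m * h) - \<epsilon> - X h \<omega>)) = exp (- (real n * (m * h + \<epsilon>))) * exp (- real n * X h \<omega>)"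
          by (simp add: algebra_simps flip: exp_add)
        ultimately show "indicator ?A \<omega> \<le> exp (- (real n * (m * h + \<epsilon>))) * exp (- real n * X h \<omega>)"
          by (auto simp: indicator_def)
      qed
      also have "\<dots> = exp (- (real n * (m * h + \<epsilon>))) * exp (h * J (real n))"
        using h laplace(2)[of h "real n"] by simp
      also have "\<dots> \<le> exp (- (real n * (m * h + \<epsilon>))) * exp (h * (real n * m))"
        using h m[of "real n"] by (auto intro!: mult_left_mono)
      also have "\<dots> = exp (- (real n * \<epsilon>))"
        by (simp add: algebra_simps flip: exp_add)
      finally show ?thesis .
    qed
    have "(\<lambda>n. exp (- (real n * \<epsilon>))) \<longlonglongrightarrow> 0" using e by real_asymp
    then have "prob ?A \<le> 0" using le by (intro LIMSEQ_le_const) auto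
    then show ?thesis using measure_nonneg[of M ?A] by linarith
  qed
  have "AE \<omega> in M. \<forall>j. \<not> X h \<omega> < - (m * h) - 1 / real (Suc j)"
    unfolding AE_all_countable
  proof
    fix j
    have "{\<omega> \<in> space M. X h \<omega> < - (m * h) - 1 / real (Suc j)} \<in> null_sets M"
      using small[of "1 / real (Suc j)"] by (auto simp: null_sets_def emeasure_eq_measure simp del: of_nat_Suc)
    then show "AE \<omega> in M. \<not> X h \<omega> < - (m * h) - 1 / real (Suc j)"
      by (rule AE_I') auto
  qed
  then have "AE \<omega> in M. \<omega> \<notin> {\<omega> \<in> space M. X h \<omega> \<in> {..< - (m * h)}}"
  proof eventually_elim
    case (elim \<omega>)
    have False if "X h \<omega> < - (m * h)"
    proof -
      from that have "0 < - (m * h) - X h \<omega>" by simp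
      then obtain j where "1 / real (Suc j) < - (m * h) - X h \<omega>" by (rule nat_approx_posE)
      then have "X h \<omega> < - (m * h) - 1 / real (Suc j)" by linarith
      with elim show False by blast
    qed
    then show ?case by auto
  qed
  then show ?thesis
    by (subst (asm) AE_iff_measurable[OF _ refl]) (auto simp: emeasure_eq_measure)
qed

text \<open>By the preceding bound, \<open>X t + m t\<close> increases along the rational times and, by right continuity, along
  all times. Almost every path is thus a difference of two increasing functions.\<close>

lemma finite_variation_if_linear_bound:
  assumes m: "\<And>b. 0 \<le> b \<Longrightarrow> J b \<le> b * m"
  shows "\<not> infinite_variation M X"
proof
  assume inf: "infinite_variation M X"
  have m0: "0 \<le> m" using m[of 1] J_nonneg[of 1] by simp
  have "AE \<omega> in M. \<forall>s\<in>\<rat> \<inter> {0..}. \<forall>h\<in>\<rat> \<inter> {0..}. - (m * h) \<le> X (s + h) \<omega> - X s \<omega>"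
  proof (intro AE_ball_countable[THEN iffD2] ballI)
    fix s h :: real assume sh: "s \<in> \<rat> \<inter> {0..}" "h \<in> \<rat> \<inter> {0..}"
    then have [measurable]: "X s \<in> borel_measurable M" "X (s + h) \<in> borel_measurable M"
      by (auto intro: measurable_X)
    have "prob {\<omega> \<in> space M. X (s + h) \<omega> - X s \<omega> \<in> {..< - (m * h)}} = 0"
      using sh prob_increment[of s h "{..< - (m * h)}"] drift_bound[OF m, of h] by simp
    then have "{\<omega> \<in> space M. X (s + h) \<omega> - X s \<omega> \<in> {..< - (m * h)}} \<in> null_sets M"
      by (auto simp: null_sets_def emeasure_eq_measure)
    then show "AE \<omega> in M. - (m * h) \<le> X (s + h) \<omega> - X s \<omega>"
      by (rule AE_I') auto
  qed (auto intro: countable_Int1 countable_rat)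
  then have "AE \<omega> in M. False"
    using AE_path inf[unfolded infinite_variation_def]
  proof eventually_elim
    case (elim \<omega>)
    define g where "g t = X t \<omega> + m * t" for t
    have rat: "g s \<le> g u" if "s \<in> \<rat>" "u \<in> \<rat>" "0 \<le> s" "s \<le> u" for s u
      using elim(1)[rule_format, of s "u - s"] that by (auto simp: g_def algebra_simps)
    have right: "(g \<longlongrightarrow> g t) (at_right t)" if "0 \<le> t" for t
      using elim(2) that unfolding g_def by (auto simp: cadlag_def intro!: tendsto_intros)
    have mono: "g s \<le> g u" if su: "0 \<le> s" "s < u" for s u
    proof (rule ccontr)
      assume "\<not> g s \<le> g u"
      then obtain c where c: "g u < c" "c < g s" using dense[of "g u" "g s"] by auto
      have "\<forall>\<^sub>F x in at_right s. c < g x"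
        using su by (intro order_tendstoD(1)[OF right c(2)]) auto
      then have "\<forall>\<^sub>F x in at_right s. c < g x \<and> x \<in> {s<..<u}"
        using eventually_at_right_real[OF su(2)] by eventually_elim auto
      then obtain d where d: "d > s" "\<And>x. s < x \<Longrightarrow> x < d \<Longrightarrow> c < g x \<and> x < u"
        by (auto simp: eventually_at_right[OF su(2)])
      obtain s' where s': "s < of_rat s'" "of_rat s' < d" using of_rat_dense[OF d(1)] by auto
      have "\<forall>\<^sub>F x in at_right u. g x < c"
        using su by (intro order_tendstoD(2)[OF right c(1)]) auto
      then obtain e where e: "e > u" "\<And>x. u < x \<Longrightarrow> x < e \<Longrightarrow> g x < c"
        by (auto simp: eventually_at_right[of u "u + 1"])
      obtain u' where u': "u < of_rat u'" "of_rat u' < e" using of_rat_dense[OF e(1)] by auto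
      have "g (of_rat s') \<le> g (of_rat u')"
      proof (rule rat)
        show "0 \<le> real_of_rat s'" "real_of_rat s' \<le> of_rat u'"
          using d(2)[OF s'] s' u' su by linarith+
      qed auto
      with d(2)[OF s'] e(2)[OF u'] show False by linarith
    qed
    have mono': "g s \<le> g u" if "0 \<le> s" "s \<le> u" for s u
      using mono[of s u] that by (cases "s = u") auto
    have "finite_variation (\<lambda>s. X s \<omega>) 1"
      unfolding finite_variation_def
    proof (intro exI allI impI)
      fix n :: nat and \<tau> :: "nat \<Rightarrow> real"
      assume \<tau>: "mono \<tau> \<and> range \<tau> \<subseteq> {0..1}"
      then have "\<tau> k \<in> {0..1}" for k by (meson rangeI subsetD)
      then have r: "0 \<le> \<tau> k" "\<tau> k \<le> 1" for k by auto
      have inc: "\<tau> k \<le> \<tau> (Suc k)" for k using \<tau> by (auto simp: mono_def)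
      have "(\<Sum>k<n. \<bar>X (\<tau> (Suc k)) \<omega> - X (\<tau> k) \<omega>\<bar>)
        \<le> (\<Sum>k<n. (g (\<tau> (Suc k)) + m * \<tau> (Suc k)) - (g (\<tau> k) + m * \<tau> k))"
      proof (rule sum_mono)
        fix k
        have "g (\<tau> k) \<le> g (\<tau> (Suc k))" using r inc by (intro mono') auto
        moreover have "m * \<tau> k \<le> m * \<tau> (Suc k)" using m0 inc by (intro mult_left_mono) auto
        ultimately show "\<bar>X (\<tau> (Suc k)) \<omega> - X (\<tau> k) \<omega>\<bar> \<le> (g (\<tau> (Suc k)) + m * \<tau> (Suc k)) - (g (\<tau> k) + m * \<tau> k)"
          unfolding g_def by linarith
      qed
      also have "\<dots> = (g (\<tau> n) + m * \<tau> n) - (g (\<tau> 0) + m * \<tau> 0)"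
        by (rule sum_lessThan_telescope)
      also have "\<dots> \<le> (g 1 + m) - g 0"
      proof -
        have "g (\<tau> n) \<le> g 1" "g 0 \<le> g (\<tau> 0)" using r by (auto intro: mono')
        moreover have "m * \<tau> n \<le> m" "0 \<le> m * \<tau> 0" using m0 r by (auto intro: mult_left_le)
        ultimately show ?thesis by linarith
      qed
      finally show "(\<Sum>k<n. \<bar>X (\<tau> (Suc k)) \<omega> - X (\<tau> k) \<omega>\<bar>) \<le> (g 1 + m) - g 0" .
    qed
    with elim(3) show ?case by (auto dest: spec[of _ 1])
  qed
  then show False by simp
qed

text \<open>Dividing by \<open>n\<^sup>2\<close> isolates the quadratic term of the exponent at \<open>b = n\<close>; the jump part is dominated by
  \<open>min v (v\<^sup>2)\<close>.\<close>

lemma gaussian_part_limit: "(\<lambda>n. J (real (Suc n)) / (real (Suc n))\<^sup>2) \<longlonglongrightarrow> q / 2"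
proof -
  have "(\<lambda>n. LINT v|\<kappa>. comp_exp (real (Suc n) * v) / (real (Suc n))\<^sup>2) \<longlonglongrightarrow> (LINT v|\<kappa>. 0)"
  proof (rule integral_dominated_convergence[where w="\<lambda>v. 6 * comp_exp (1 * v)"])
    show "integrable \<kappa> (\<lambda>v. 6 * comp_exp (1 * v))"
      by (intro integrable_mult_right laplace_exponent_formula) simp
    show "AE v in \<kappa>. (\<lambda>n. comp_exp (real (Suc n) * v) / (real (Suc n))\<^sup>2) \<longlonglongrightarrow> 0"
      using levy_measure_nonneg
    proof eventually_elim
      case (elim v)
      have lim: "(\<lambda>n. v * (1 / real (Suc n))) \<longlonglongrightarrow> 0" by real_asymp
      show ?case
      proof (rule Lim_null_comparison[OF always_eventually lim], intro allI)
        fix n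
        have "comp_exp (real (Suc n) * v) \<le> real (Suc n) * v"
          using elim by (intro comp_exp_le) simp
        then have "comp_exp (real (Suc n) * v) / (real (Suc n))\<^sup>2 \<le> real (Suc n) * v / (real (Suc n))\<^sup>2"
          by (rule divide_right_mono) simp
        also have "\<dots> = v * (1 / real (Suc n))" by (simp add: power2_eq_square del: of_nat_Suc)
        finally show "norm (comp_exp (real (Suc n) * v) / (real (Suc n))\<^sup>2) \<le> v * (1 / real (Suc n))"
          using comp_exp_nonneg[of "real (Suc n) * v"] by (simp del: of_nat_Suc)
      qed
    qed
    show "AE v in \<kappa>. norm (comp_exp (real (Suc n) * v) / (real (Suc n))\<^sup>2) \<le> 6 * comp_exp (1 * v)" for n
      using levy_measure_nonneg
    proof eventually_elim
      case (elim v)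
      let ?n = "real (Suc n)"
      have n: "1 \<le> ?n" by simp
      have "comp_exp (?n * v) / ?n\<^sup>2 \<le> (?n * v)\<^sup>2 / ?n\<^sup>2"
        using elim by (intro divide_right_mono comp_exp_le_power2) auto
      then have 1: "comp_exp (?n * v) / ?n\<^sup>2 \<le> v\<^sup>2" by (simp add: power_mult_distrib del: of_nat_Suc)
      have "comp_exp (?n * v) / ?n\<^sup>2 \<le> (?n * v) / ?n\<^sup>2"
        using elim by (intro divide_right_mono comp_exp_le) auto
      also have "\<dots> = v / ?n" by (simp add: power2_eq_square del: of_nat_Suc)
      also have "\<dots> \<le> v / 1" using n elim by (intro divide_left_mono) auto
      finally have "comp_exp (?n * v) / ?n\<^sup>2 \<le> min v (v\<^sup>2)" using 1 by simp
      also have "\<dots> \<le> 6 * comp_exp v" using elim by (rule min_le_comp_exp)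
      finally show ?case using comp_exp_nonneg[of "?n * v"] by (simp del: of_nat_Suc)
    qed
  qed measurable
  then have "(\<lambda>n. q / 2 + (LINT v|\<kappa>. comp_exp (real (Suc n) * v) / (real (Suc n))\<^sup>2)) \<longlonglongrightarrow> q / 2 + 0"
    by (intro tendsto_add tendsto_const) simp
  moreover have "q / 2 + (LINT v|\<kappa>. comp_exp (real (Suc n) * v) / (real (Suc n))\<^sup>2) = J (real (Suc n)) / (real (Suc n))\<^sup>2" for n
    using laplace_exponent_formula(2)[of "real (Suc n)"] by (simp add: add_divide_distrib del: of_nat_Suc)
  ultimately show ?thesis by (simp only: add_0_right)
qed

end

section \<open>Stable processes\<close>

context spectrally_positive
begin

lemma distr_eqI:
  assumes t: "0 \<le> t" and N: "prob_space N" "sets N = sets borel"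
    and int: "\<And>b. 0 \<le> b \<Longrightarrow> integrable N (\<lambda>x. exp (- b * x))"
    and eq: "\<And>b. 0 \<le> b \<Longrightarrow> (LINT x|N. exp (- b * x)) = exp (t * J b)"
  shows "distr M borel (X t) = N"
proof (rule bilateral_laplace_unique)
  have [measurable]: "X t \<in> borel_measurable M" using t by (rule measurable_X)
  show "finite_measure (distr M borel (X t))"
    by (intro prob_space.finite_measure prob_space_distr) measurable
  show "finite_measure N" using N(1) by (rule prob_space.finite_measure)
  fix b :: real assume b: "0 \<le> b"
  show "integrable (distr M borel (X t)) (\<lambda>x. exp (- b * x))"
    using laplace(1)[OF t b] by (subst integrable_distr_eq) auto
  show "(LINT x|distr M borel (X t). exp (- b * x)) = (LINT x|N. exp (- b * x))"
    using laplace(2)[OF t b] eq[OF b] by (subst integral_distr) auto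
qed (use N int in auto)

text \<open>The fourth difference of a quadratic \<open>J\<close> is 0, so the expectation of \<open>(1 - exp (- X (1 / n)))\<^sup>4\<close>
  is of smaller order than \<open>1 / n\<close>.\<close>

lemma upward_increments_vanish:
  assumes J2: "\<And>b. 0 \<le> b \<Longrightarrow> J b = \<gamma> * b\<^sup>2" and e: "\<epsilon> > 0"
  shows "(\<lambda>n. real (Suc n) * prob {\<omega> \<in> space M. X (1 / Suc n) \<omega> > \<epsilon>}) \<longlonglongrightarrow> 0"
proof -
  define c where "c = (1 - exp (- \<epsilon>)) ^ 4"
  have c: "c > 0" using e by (simp add: c_def)
  define S where "S n = - 4 * (real (Suc n) * (exp (\<gamma> / real (Suc n)) - 1)) + 6 * (real (Suc n) * (exp (4 * \<gamma> / real (Suc n)) - 1))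
     - 4 * (real (Suc n) * (exp (9 * \<gamma> / real (Suc n)) - 1)) + real (Suc n) * (exp (16 * \<gamma> / real (Suc n)) - 1)" for n
  have "S \<longlonglongrightarrow> - 4 * \<gamma> + 6 * (4 * \<gamma>) - 4 * (9 * \<gamma>) + 16 * \<gamma>"
    unfolding S_def by (intro tendsto_add tendsto_diff tendsto_mult tendsto_const exp_difference_quotient)
  then have "S \<longlonglongrightarrow> 0" by simp
  then have lim: "(\<lambda>n. S n / c) \<longlonglongrightarrow> 0" using tendsto_divide[OF _ tendsto_const, of S 0 sequentially c] c by simp
  have bound: "real (Suc n) * prob {\<omega> \<in> space M. X (1 / Suc n) \<omega> > \<epsilon>} \<le> S n / c" for n
  proof -
    let ?X = "X (1 / Suc n)" and ?A = "{\<omega> \<in> space M. X (1 / Suc n) \<omega> > \<epsilon>}"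
    have [measurable]: "?X \<in> borel_measurable M" by (rule measurable_X) simp
    \<comment> \<open>the binomial coefficients make \<open>- 4 + 6 * 4 - 4 * 9 + 16 = 0\<close> in the limit\<close>
    have exp4: "(1 - exp (- x)) ^ 4 = 1 - 4 * exp (- 1 * x) + 6 * exp (- 2 * x) - 4 * exp (- 3 * x) + exp (- 4 * x)" for x :: real
    proof -
      have "exp (- 2 * x) = exp (- x) ^ 2" "exp (- 3 * x) = exp (- x) ^ 3" "exp (- 4 * x) = exp (- x) ^ 4"
        by (simp_all flip: exp_of_nat_mult)
      then show ?thesis by (simp add: power4_eq_xxxx power3_eq_cube power2_eq_square algebra_simps)
    qed
    have lap: "integrable M (\<lambda>\<omega>. exp (- b * ?X \<omega>))" "expectation (\<lambda>\<omega>. exp (- b * ?X \<omega>)) = exp (b\<^sup>2 * \<gamma> / real (Suc n))"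
      if "0 \<le> b" for b
      using laplace[of "1 / real (Suc n)" b] that by (simp_all add: J2 mult.commute del: of_nat_Suc)
    have E: "expectation (\<lambda>\<omega>. (1 - exp (- ?X \<omega>)) ^ 4) = 1 - 4 * exp (\<gamma> / real (Suc n)) + 6 * exp (4 * \<gamma> / real (Suc n))
       - 4 * exp (9 * \<gamma> / real (Suc n)) + exp (16 * \<gamma> / real (Suc n))"
      "integrable M (\<lambda>\<omega>. (1 - exp (- ?X \<omega>)) ^ 4)"
      unfolding exp4 using lap[of 1] lap[of 2] lap[of 3] lap[of 4] by (simp_all add: prob_space del: of_nat_Suc)
    have "c * prob ?A = expectation (\<lambda>\<omega>. c * indicator ?A \<omega>)" by (simp add: Int_def conj_commute del: of_nat_Suc)
    also have "\<dots> \<le> expectation (\<lambda>\<omega>. (1 - exp (- ?X \<omega>)) ^ 4)"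
    proof (rule integral_mono[OF _ E(2)])
      show "integrable M (\<lambda>\<omega>. c * indicator ?A \<omega> :: real)"
        using c by (intro bounded_integrable[of _ c]) (auto simp: indicator_def simp del: of_nat_Suc)
      fix \<omega>
      show "c * indicator ?A \<omega> \<le> (1 - exp (- ?X \<omega>)) ^ 4"
        using e by (auto simp: indicator_def c_def intro!: power_mono zero_le_even_power)
    qed
    finally have "real (Suc n) * (c * prob ?A) \<le> real (Suc n) * expectation (\<lambda>\<omega>. (1 - exp (- ?X \<omega>)) ^ 4)"
      by (rule mult_left_mono) simp
    also have "\<dots> = S n" unfolding S_def E by (simp only: ring_distribs)
    finally show ?thesis using c by (simp add: field_simps del: of_nat_Suc)
  qed
  show ?thesis
    by (rule tendsto_sandwich[OF _ _ tendsto_const lim]) (simp_all only: bound eventually_True measure_nonneg mult_nonneg_nonneg of_nat_0_le_iff)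
qed

text \<open>Laplace transforms on \<open>b \<ge> 0\<close> determine laws, so a power law for \<open>J\<close> is the scaling property of the
  marginals. For \<open>\<alpha> = 2\<close> they are normal, and the paths are continuous because upward jumps do not occur
  either.\<close>

theorem stable_if_power:
  assumes a: "1 < \<alpha>" "\<alpha> \<le> 2" and \<gamma>: "0 < \<gamma>" and power: "\<And>b. 0 \<le> b \<Longrightarrow> J b = \<gamma> * b powr \<alpha>"
  shows "stable_process M \<alpha> X"
proof (cases "\<alpha> = 2")
  case True
  have J2: "J b = \<gamma> * b\<^sup>2" if "0 \<le> b" for b
    using power[OF that] that True by (cases "b = 0") (simp_all add: powr_numeral)
  define \<sigma> where "\<sigma> = sqrt (2 * \<gamma>)"
  have \<sigma>: "\<sigma> > 0" using \<gamma> by (simp add: \<sigma>_def)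
  have "distributed M lborel (X t) (normal_density 0 (\<sigma> * sqrt t))" if t: "0 < t" for t
  proof -
    let ?s = "\<sigma> * sqrt t"
    have s: "0 < ?s" using \<sigma> t by simp
    have [measurable]: "X t \<in> borel_measurable M" using t by (intro measurable_X) simp
    have "distr M borel (X t) = density lborel (normal_density 0 ?s)"
    proof (rule distr_eqI)
      show "prob_space (density lborel (normal_density 0 ?s))" using s by (rule prob_space_normal_density)
      fix b :: real assume b: "0 \<le> b"
      show "integrable (density lborel (normal_density 0 ?s)) (\<lambda>x. exp (- b * x))"
        using normal_laplace(1)[OF s, of b] by (subst integrable_density) auto
      have "(LINT x|density lborel (normal_density 0 ?s). exp (- b * x)) = exp (b\<^sup>2 * ?s\<^sup>2 / 2)"
        using normal_laplace(2)[OF s, of b] by (subst integral_density) auto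
      also have "b\<^sup>2 * ?s\<^sup>2 / 2 = t * J b"
        using b \<gamma> t by (simp add: J2 \<sigma>_def power_mult_distrib)
      finally show "(LINT x|density lborel (normal_density 0 ?s). exp (- b * x)) = exp (t * J b)" .
    qed (use t in auto)
    moreover have "distr M lborel (X t) = distr M borel (X t)" by (rule distr_cong) auto
    ultimately show ?thesis by (simp add: distributed_def)
  qed
  moreover have "AE \<omega> in M. continuous_on {0..} (\<lambda>t. X t \<omega>)"
    by (rule continuous_paths[OF upward_increments_vanish[OF J2]])
  ultimately show ?thesis
    using True \<sigma> levy by (auto simp: stable_process_def wiener_process_def)
next
  case False
  have [measurable]: "X 1 \<in> borel_measurable M" by (rule measurable_X) simp
  have "\<not> (AE \<omega> in M. X 1 \<omega> = d)" for d
  proof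
    assume d: "AE \<omega> in M. X 1 \<omega> = d"
    then have "expectation (X 1) = expectation (\<lambda>_. d)" by (intro integral_cong_AE) auto
    then have "d = 0" using X_mean[of 1] by (simp add: prob_space)
    have "expectation (\<lambda>\<omega>. exp (- 1 * X 1 \<omega>)) = expectation (\<lambda>_. 1)"
      using d \<open>d = 0\<close> by (intro integral_cong_AE) auto
    then show False using laplace(2)[of 1 1] power[of 1] \<gamma> by (simp add: prob_space)
  qed
  moreover have "distr M borel (X k) = distr M borel (\<lambda>\<omega>. k powr (1 / \<alpha>) * X 1 \<omega> + 0)" if k: "k > 0" for k
  proof (rule distr_eqI)
    show "prob_space (distr M borel (\<lambda>\<omega>. k powr (1 / \<alpha>) * X 1 \<omega> + 0))"
      by (rule prob_space_distr) measurable
    fix b :: real assume b: "0 \<le> b"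
    let ?c = "k powr (1 / \<alpha>) * b"
    have c: "0 \<le> ?c" using b by simp
    have E: "exp (- b * (k powr (1 / \<alpha>) * X 1 \<omega> + 0)) = exp (- ?c * X 1 \<omega>)" for \<omega>
      by (simp add: mult_ac)
    show "integrable (distr M borel (\<lambda>\<omega>. k powr (1 / \<alpha>) * X 1 \<omega> + 0)) (\<lambda>x. exp (- b * x))"
      using laplace(1)[OF zero_le_one c] by (subst integrable_distr_eq) (auto simp only: E, measurable)
    have "(LINT x|distr M borel (\<lambda>\<omega>. k powr (1 / \<alpha>) * X 1 \<omega> + 0). exp (- b * x)) = exp (1 * J ?c)"
      using laplace(2)[OF zero_le_one c] by (subst integral_distr) (auto simp only: E, measurable)
    also have "1 * J ?c = k * J b"
      using b k a by (simp add: power powr_mult powr_powr)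
    finally show "(LINT x|distr M borel (\<lambda>\<omega>. k powr (1 / \<alpha>) * X 1 \<omega> + 0). exp (- b * x)) = exp (k * J b)" .
  qed (use k in auto)
  then have "\<forall>k>0. \<exists>d. distr M borel (X k) = distr M borel (\<lambda>\<omega>. k powr (1 / \<alpha>) * X 1 \<omega> + d)"
    by blast
  ultimately show ?thesis
    using False a levy jumps by (simp add: stable_process_def)
qed

text \<open>For \<open>\<alpha> < 2\<close> take the scaling property at time \<open>k = b powr \<alpha>\<close> and evaluate Laplace transforms at 1.\<close>

theorem power_if_stable:
  assumes a: "1 < \<alpha>" "\<alpha> \<le> 2" and stable: "stable_process M \<alpha> X" and b: "0 \<le> b"
  shows "J b = J 1 * b powr \<alpha>"
proof (cases "b = 0")
  case True
  then show ?thesis by (simp add: J_0)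
next
  case False
  with b have b: "0 < b" by simp
  have [measurable]: "X 1 \<in> borel_measurable M" by (rule measurable_X) simp
  show ?thesis
  proof (cases "\<alpha> = 2")
    case True
    then obtain \<sigma> where \<sigma>0: "\<sigma> > 0" "\<forall>t>0. distributed M lborel (X t) (normal_density 0 (\<sigma> * sqrt t))"
      using stable by (auto simp: stable_process_def wiener_process_def)
    then have \<sigma>: "\<sigma> > 0" "distributed M lborel (X 1) (normal_density 0 (\<sigma> * sqrt 1))"
      using zero_less_one by blast+
    have Jc: "J c = c\<^sup>2 * \<sigma>\<^sup>2 / 2" if "0 \<le> c" for c
    proof -
      have "exp (1 * J c) = expectation (\<lambda>\<omega>. exp (- c * X 1 \<omega>))"
        using laplace(2)[of 1 c] that by simp
      also have "\<dots> = (LINT x|lborel. normal_density 0 (\<sigma> * sqrt 1) x * exp (- c * x))"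
        using \<sigma> by (subst distributed_integral[OF \<sigma>(2)]) auto
      also have "\<dots> = exp (c\<^sup>2 * \<sigma>\<^sup>2 / 2)" using normal_laplace(2)[of \<sigma> c] \<sigma> by simp
      finally show ?thesis by simp
    qed
    show ?thesis unfolding True Jc[OF zero_le_one] Jc[OF less_imp_le[OF b]] using b by (simp add: powr_numeral)
  next
    case False
    define k where "k = b powr \<alpha>"
    have k: "k > 0" using b by (simp add: k_def)
    have kb: "k powr (1 / \<alpha>) = b" using b a by (simp add: k_def powr_powr)
    obtain d where d: "distr M borel (X k) = distr M borel (\<lambda>\<omega>. k powr (1 / \<alpha>) * X 1 \<omega> + d)"
      using stable False k by (auto simp: stable_process_def)
    have [measurable]: "X k \<in> borel_measurable M" using k by (intro measurable_X) simp
    \<comment> \<open>comparing means shows that the translation is 0\<close>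
    have "(LINT x|distr M borel (X k). x) = (LINT x|distr M borel (\<lambda>\<omega>. k powr (1 / \<alpha>) * X 1 \<omega> + d). x)"
      using d by simp
    then have "expectation (X k) = expectation (\<lambda>\<omega>. b * X 1 \<omega> + d)"
      by (simp add: integral_distr kb)
    then have "d = 0"
      using X_mean[of 1] X_mean[of k] X_integrable[of 1] k by (simp add: prob_space)
    have "(LINT x|distr M borel (X k). exp (- 1 * x)) = (LINT x|distr M borel (\<lambda>\<omega>. k powr (1 / \<alpha>) * X 1 \<omega> + d). exp (- 1 * x))"
      using d by simp
    then have "expectation (\<lambda>\<omega>. exp (- 1 * X k \<omega>)) = expectation (\<lambda>\<omega>. exp (- b * X 1 \<omega>))"
      by (simp add: integral_distr kb \<open>d = 0\<close>)
    then have "exp (k * J 1) = exp (1 * J b)"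
      using laplace(2)[of k 1] laplace(2)[of 1 b] k b by simp
    then show ?thesis by (simp add: k_def mult.commute)
  qed
qed

end

section \<open>Projections of the two-dimensional process\<close>

definition levy_integrand :: "real^'n \<Rightarrow> real^'n \<Rightarrow> complex" where
  "levy_integrand u y = iexp (u \<bullet> y) - 1 - (if norm y \<le> 1 then \<i> * of_real (u \<bullet> y) else 0)"

lemma levy_integrand_measurable [measurable]: "levy_integrand u \<in> borel_measurable borel"
  unfolding levy_integrand_def by measurable

lemma norm_levy_integrand_le: "norm (levy_integrand u y) \<le> (2 + (norm u)\<^sup>2) * min 1 ((norm y)\<^sup>2)"
proof (cases "norm y \<le> 1")
  case True
  have "norm (iexp (u \<bullet> y) - (\<Sum>k\<le>1. (\<i> * complex_of_real (u \<bullet> y)) ^ k / fact k)) \<le> \<bar>u \<bullet> y\<bar> ^ Suc 1 / fact (Suc 1)"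
    by (rule iexp_approx1)
  then have "norm (levy_integrand u y) \<le> \<bar>u \<bullet> y\<bar>\<^sup>2 / 2"
    using True by (simp add: levy_integrand_def algebra_simps numeral_2_eq_2)
  also have "\<dots> \<le> \<bar>u \<bullet> y\<bar>\<^sup>2" by simp
  also have "\<dots> \<le> (norm u * norm y)\<^sup>2" by (intro power_mono Cauchy_Schwarz_ineq2) simp
  also have "\<dots> \<le> (2 + (norm u)\<^sup>2) * (norm y)\<^sup>2" by (simp add: power_mult_distrib mult_right_mono)
  also have "(norm y)\<^sup>2 = min 1 ((norm y)\<^sup>2)" using True by (simp add: power_le_one)
  finally show ?thesis .
next
  case False
  have "norm (iexp (u \<bullet> y) - 1) \<le> norm (iexp (u \<bullet> y)) + norm (1::complex)" by (rule norm_triangle_ineq4)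
  then have "norm (levy_integrand u y) \<le> 2" using False by (simp add: levy_integrand_def)
  also have "\<dots> \<le> 2 + (norm u)\<^sup>2" by simp
  also have "\<dots> = (2 + (norm u)\<^sup>2) * min 1 ((norm y)\<^sup>2)" using False by (simp add: one_le_power)
  finally show ?thesis .
qed

text \<open>The drift and the compensator are linear in the argument of the exponent and cancel.\<close>

lemma levy_exponent_second_difference:
  assumes sets: "sets \<nu> = sets borel" and fin: "(\<integral>\<^sup>+ y. ennreal (min 1 ((norm y)\<^sup>2)) \<partial>\<nu>) < \<infinity>"
  shows "levy_exponent a Q \<nu> (u *\<^sub>R g) - (levy_exponent a Q \<nu> ((u + s) *\<^sub>R g) + levy_exponent a Q \<nu> ((u - s) *\<^sub>R g)) / 2
    = of_real ((Q *v g) \<bullet> g * s\<^sup>2 / 2) + (LINT v|proj_measure \<nu> g. (1 - cos (s * v)) *\<^sub>R iexp (u * v))"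
proof -
  note [measurable_cong] = sets
  have "integrable \<nu> (\<lambda>y. min 1 ((norm y)\<^sup>2))"
    using fin by (intro integrableI_nonneg) auto
  then have int: "integrable \<nu> (levy_integrand u)" for u
    by (rule Bochner_Integration.integrable_bound[OF integrable_mult_right[where c="2 + (norm u)\<^sup>2"]])
       (use norm_levy_integrand_le[of u] in \<open>auto intro!: AE_I2 order_trans[OF _ abs_ge_self]\<close>)
  have pw: "levy_integrand (u *\<^sub>R g) y - (levy_integrand ((u + s) *\<^sub>R g) y + levy_integrand ((u - s) *\<^sub>R g) y) / 2
     = (1 - cos (s * (g \<bullet> y))) *\<^sub>R iexp (u * (g \<bullet> y))" for y
  proof -
    have ring: "(A - 1 - D) - ((B - 1 - E) + (C - 1 - F)) / 2 = A - (B + C) / 2" if "E + F = 2 * D"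
      for A B C D E F :: complex
    proof -
      from that have "E = 2 * D - F" by (simp add: eq_diff_eq)
      then show ?thesis by (simp add: field_simps)
    qed
    show ?thesis
      unfolding levy_integrand_def second_difference_iexp inner_scaleR_left
      by (rule ring) (simp add: algebra_simps)
  qed
  have "(LINT v|proj_measure \<nu> g. (1 - cos (s * v)) *\<^sub>R iexp (u * v))
     = (LINT y|\<nu>. levy_integrand (u *\<^sub>R g) y - (levy_integrand ((u + s) *\<^sub>R g) y + levy_integrand ((u - s) *\<^sub>R g) y) / 2)"
    unfolding pw proj_measure_def by (rule integral_distr) measurable
  also have "\<dots> = (LINT y|\<nu>. levy_integrand (u *\<^sub>R g) y)
     - ((LINT y|\<nu>. levy_integrand ((u + s) *\<^sub>R g) y) + (LINT y|\<nu>. levy_integrand ((u - s) *\<^sub>R g) y)) / 2"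
    by (simp add: int)
  finally have I: "(LINT v|proj_measure \<nu> g. (1 - cos (s * v)) *\<^sub>R iexp (u * v)) = \<dots>" .
  have E: "levy_exponent a Q \<nu> (u *\<^sub>R g) = \<i> * of_real (u * (a \<bullet> g)) - of_real (u\<^sup>2 * ((Q *v g) \<bullet> g)) / 2
      + (LINT y|\<nu>. levy_integrand (u *\<^sub>R g) y)" for u
    unfolding levy_exponent_def levy_integrand_def
    by (simp add: matrix_vector_mult_scaleR power2_eq_square mult_ac)
  show ?thesis
    unfolding I E by (simp add: field_simps power2_eq_square)
qed

lemma levy_process_inner:
  assumes "levy_process M Z"
  shows "levy_process M (\<lambda>t \<omega>. g \<bullet> Z t \<omega>)"
proof -
  note Z = assms[unfolded levy_process_def]
  interpret prob_space M using Z by simp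
  have meas[measurable]: "Z t \<in> borel_measurable M" if "0 \<le> t" for t using Z that by simp
  show ?thesis
    unfolding levy_process_def
  proof (intro conjI allI impI)
    show "(\<lambda>\<omega>. g \<bullet> Z t \<omega>) \<in> borel_measurable M" if "0 \<le> t" for t using that by measurable
    have "AE \<omega> in M. Z 0 \<omega> = 0" using Z by simp
    then show "AE \<omega> in M. g \<bullet> Z 0 \<omega> = 0" by eventually_elim simp
    have "AE \<omega> in M. cadlag (\<lambda>t. Z t \<omega>)" using Z by simp
    then show "AE \<omega> in M. cadlag (\<lambda>t. g \<bullet> Z t \<omega>)"
    proof eventually_elim
      case (elim \<omega>)
      then show ?case
        unfolding cadlag_def by (metis tendsto_inner[OF tendsto_const])
    qed
  next
    fix n and \<tau> :: "nat \<Rightarrow> real" assume "0 \<le> \<tau> 0 \<and> mono \<tau>"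
    then have ind: "indep_vars (\<lambda>_. borel) (\<lambda>k \<omega>. Z (\<tau> (Suc k)) \<omega> - Z (\<tau> k) \<omega>) {..<n}"
      using Z by blast
    have "indep_vars (\<lambda>_. borel) (\<lambda>k \<omega>. g \<bullet> (Z (\<tau> (Suc k)) \<omega> - Z (\<tau> k) \<omega>)) {..<n}"
      by (rule indep_vars_compose2[OF ind]) measurable
    then show "indep_vars (\<lambda>_. borel) (\<lambda>k \<omega>. g \<bullet> Z (\<tau> (Suc k)) \<omega> - g \<bullet> Z (\<tau> k) \<omega>) {..<n}"
      by (simp add: inner_diff_right)
  next
    fix s h :: real assume sh: "0 \<le> s" "0 \<le> h"
    then have "distr M borel (\<lambda>\<omega>. Z (s + h) \<omega> - Z s \<omega>) = distr M borel (Z h)" using Z by blast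
    then have "distr (distr M borel (\<lambda>\<omega>. Z (s + h) \<omega> - Z s \<omega>)) borel (\<lambda>z. g \<bullet> z) = distr (distr M borel (Z h)) borel (\<lambda>z. g \<bullet> z)"
      by simp
    then show "distr M borel (\<lambda>\<omega>. g \<bullet> Z (s + h) \<omega> - g \<bullet> Z s \<omega>) = distr M borel (\<lambda>\<omega>. g \<bullet> Z h \<omega>)"
      using sh by (subst (asm) (1 2) distr_distr) (auto simp: comp_def inner_diff_right)
  qed (use Z in simp)
qed

lemma process_algebra_subalgebra:
  assumes "\<And>t. t \<in> T \<Longrightarrow> X t \<in> borel_measurable M"
  shows "subalgebra M (process_algebra M X T)"
proof -
  have sub: "(\<Union>t\<in>T. {X t -` A \<inter> space M | A. A \<in> sets borel}) \<subseteq> sets M"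
    using assms by (auto intro: measurable_sets)
  then have "sets (process_algebra M X T) = sigma_sets (space M) (\<Union>t\<in>T. {X t -` A \<inter> space M | A. A \<in> sets borel})"
    unfolding process_algebra_def by (intro sets_measure_of) (use sets.sets_into_space in blast)
  with sub show ?thesis
    unfolding subalgebra_def process_algebra_def by (auto simp: space_measure_of_conv dest: sets.sigma_sets_subset)
qed

text \<open>The conditional expectation of \<open>Z t\<close> given time 0 is \<open>Z 0 = 0\<close>.\<close>

lemma (in prob_space) levy_martingale_mean:
  fixes Z :: "real \<Rightarrow> 'a \<Rightarrow> real^'n"
  assumes Z: "levy_martingale M Z" and t: "0 \<le> t"
  shows "integrable M (\<lambda>\<omega>. g \<bullet> Z t \<omega>)" "expectation (\<lambda>\<omega>. g \<bullet> Z t \<omega>) = 0"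
proof -
  have lp: "levy_process M Z" and mp: "martingale_process M Z"
    using Z by (auto simp: levy_martingale_def)
  have int: "integrable M (Z t)" if "0 \<le> t" for t using mp that by (simp add: martingale_process_def)
  show "integrable M (\<lambda>\<omega>. g \<bullet> Z t \<omega>)" using int[OF t] by simp
  have mean: "expectation (\<lambda>\<omega>. Z t \<omega> \<bullet> e) = 0" if e: "e \<in> Basis" for e
  proof -
    let ?F = "process_algebra M Z {0..0}"
    have sub: "subalgebra M ?F"
      using lp by (intro process_algebra_subalgebra) (auto simp: levy_process_def)
    then interpret F: finite_measure_subalgebra M ?F by unfold_locales
    have "AE \<omega> in M. Z 0 \<omega> = 0" using lp by (simp add: levy_process_def)
    moreover have "AE \<omega> in M. real_cond_exp M ?F (\<lambda>\<omega>. Z t \<omega> \<bullet> e) \<omega> = Z 0 \<omega> \<bullet> e"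
      by (rule mp[unfolded martingale_process_def, THEN conjunct2, rule_format, OF order_refl t e])
    ultimately have "AE \<omega> in M. real_cond_exp M ?F (\<lambda>\<omega>. Z t \<omega> \<bullet> e) \<omega> = 0"
      by eventually_elim simp
    then have "expectation (real_cond_exp M ?F (\<lambda>\<omega>. Z t \<omega> \<bullet> e)) = 0"
      by (rule integral_eq_zero_AE)
    then show ?thesis
      using F.real_cond_exp_int(2)[of "\<lambda>\<omega>. Z t \<omega> \<bullet> e"] int[OF t] by simp
  qed
  have "expectation (Z t) = 0"
    by (rule euclidean_eqI) (use mean int[OF t] in simp)
  then show "expectation (\<lambda>\<omega>. g \<bullet> Z t \<omega>) = 0"
    using int[OF t] by simp
qed

lemma nonneg_jumps_combination:
  fixes Z :: "real \<Rightarrow> 'w \<Rightarrow> real^2"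
  assumes lp: "levy_process M Z" and jumps: "\<forall>i. nonneg_jumps M (\<lambda>t \<omega>. Z t \<omega> $ i)"
    and g: "0 \<le> g $ 1" "0 \<le> g $ 2"
  shows "nonneg_jumps M (\<lambda>t \<omega>. g \<bullet> Z t \<omega>)"
proof -
  have "AE \<omega> in M. \<forall>t>0. \<forall>l. ((\<lambda>s. Z s \<omega> $ i) \<longlongrightarrow> l) (at_left t) \<longrightarrow> l \<le> Z t \<omega> $ i" for i
    using jumps by (simp add: nonneg_jumps_def)
  from this[of 1] this[of 2] have "AE \<omega> in M. \<forall>t>0. \<forall>l. ((\<lambda>s. g \<bullet> Z s \<omega>) \<longlongrightarrow> l) (at_left t) \<longrightarrow> l \<le> g \<bullet> Z t \<omega>"
    using lp[unfolded levy_process_def, THEN conjunct2, THEN conjunct2, THEN conjunct2, THEN conjunct2, THEN conjunct2]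
  proof eventually_elim
    case (elim \<omega>)
    show ?case
    proof (intro allI impI)
      fix t l :: real assume t: "0 < t" and l: "((\<lambda>s. g \<bullet> Z s \<omega>) \<longlongrightarrow> l) (at_left t)"
      obtain L where L: "((\<lambda>s. Z s \<omega>) \<longlongrightarrow> L) (at_left t)" using elim(3) t by (auto simp: cadlag_def)
      have "((\<lambda>s. g \<bullet> Z s \<omega>) \<longlongrightarrow> g \<bullet> L) (at_left t)" by (intro tendsto_intros L)
      with l have "l = g \<bullet> L" by (intro tendsto_unique[of "at_left t"]) auto
      moreover have "L $ 1 \<le> Z t \<omega> $ 1" "L $ 2 \<le> Z t \<omega> $ 2"
        using elim(1,2) t tendsto_vec_nth[OF L] by blast+
      ultimately show "l \<le> g \<bullet> Z t \<omega>"
        using g by (simp add: inner_vec_def sum_2 add_mono mult_left_mono)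
    qed
  qed
  then show ?thesis by (simp add: nonneg_jumps_def)
qed

lemma (in prob_space) indep_processes_indep_var:
  assumes "indep_processes M X Y" and t: "0 \<le> t"
    and [measurable]: "X t \<in> borel_measurable M" "Y t \<in> borel_measurable M"
  shows "indep_var borel (X t) borel (Y t)"
proof -
  have gen: "sigma_sets (space M) {X t -` A \<inter> space M | A. A \<in> sets borel} \<subseteq> sets (process_algebra M X {0..})"
    for X :: "real \<Rightarrow> 'a \<Rightarrow> 'z :: topological_space"
  proof -
    have "sets (process_algebra M X {0..}) = sigma_sets (space M) (\<Union>t\<in>{0..}. {X t -` A \<inter> space M | A. A \<in> sets borel})"
      unfolding process_algebra_def by (intro sets_measure_of) auto
    then show ?thesis using t by (auto intro!: sigma_sets_mono')
  qed
  show ?thesis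
    unfolding indep_var_eq
  proof (intro conjI)
    show "indep_set (sigma_sets (space M) {X t -` A \<inter> space M | A. A \<in> sets borel})
      (sigma_sets (space M) {Y t -` A \<inter> space M | A. A \<in> sets borel})"
      unfolding indep_set_def
    proof (rule indep_sets_mono_sets)
      show "indep_sets (case_bool (sets (process_algebra M X {0..})) (sets (process_algebra M Y {0..}))) UNIV"
        using assms(1) by (simp add: indep_processes_def indep_set_def)
    qed (use gen[of X] gen[of Y] in \<open>simp split: bool.split\<close>)
  qed measurable
qed

lemma (in prob_space) laplace_exponent_combination:
  fixes Z :: "real \<Rightarrow> 'a \<Rightarrow> real^2"
  assumes Z: "\<And>t. 0 \<le> t \<Longrightarrow> Z t \<in> borel_measurable M"
    and indep: "indep_processes M (\<lambda>t \<omega>. Z t \<omega> $ 1) (\<lambda>t \<omega>. Z t \<omega> $ 2)"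
    and J: "is_laplace_exponent M (\<lambda>t \<omega>. Z t \<omega> $ 1) J\<^sub>1" "is_laplace_exponent M (\<lambda>t \<omega>. Z t \<omega> $ 2) J\<^sub>2"
    and g: "0 \<le> g $ 1" "0 \<le> g $ 2"
  shows "is_laplace_exponent M (\<lambda>t \<omega>. g \<bullet> Z t \<omega>) (\<lambda>b. J\<^sub>1 (b * g $ 1) + J\<^sub>2 (b * g $ 2))"
  unfolding is_laplace_exponent_def
proof (intro allI impI)
  fix t b :: real assume t: "0 \<le> t" and b: "0 \<le> b"
  have [measurable]: "Z t \<in> borel_measurable M" using t by (rule Z)
  have iv: "indep_var borel (\<lambda>\<omega>. Z t \<omega> $ 1) borel (\<lambda>\<omega>. Z t \<omega> $ 2)"
    by (rule indep_processes_indep_var[OF indep t]) (unfold cart_eq_inner_axis, measurable)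
  have iv': "indep_var borel (\<lambda>\<omega>. exp (- (b * g $ 1) * Z t \<omega> $ 1)) borel (\<lambda>\<omega>. exp (- (b * g $ 2) * Z t \<omega> $ 2))"
    using indep_var_compose[OF iv, of "\<lambda>x. exp (- (b * g $ 1) * x)" borel "\<lambda>x. exp (- (b * g $ 2) * x)" borel]
    by (simp add: comp_def)
  have L: "integrable M (\<lambda>\<omega>. exp (- (b * g $ 1) * Z t \<omega> $ 1))" "integrable M (\<lambda>\<omega>. exp (- (b * g $ 2) * Z t \<omega> $ 2))"
    "expectation (\<lambda>\<omega>. exp (- (b * g $ 1) * Z t \<omega> $ 1)) = exp (t * J\<^sub>1 (b * g $ 1))"
    "expectation (\<lambda>\<omega>. exp (- (b * g $ 2) * Z t \<omega> $ 2)) = exp (t * J\<^sub>2 (b * g $ 2))"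
    using J t b g unfolding is_laplace_exponent_def by (auto simp only: mult_nonneg_nonneg)
  have E: "exp (- b * (g \<bullet> Z t \<omega>)) = exp (- (b * g $ 1) * Z t \<omega> $ 1) * exp (- (b * g $ 2) * Z t \<omega> $ 2)" for \<omega>
    by (simp add: inner_vec_def sum_2 algebra_simps flip: exp_add)
  show "integrable M (\<lambda>\<omega>. exp (- b * (g \<bullet> Z t \<omega>))) \<and>
    expectation (\<lambda>\<omega>. exp (- b * (g \<bullet> Z t \<omega>))) = exp (t * (J\<^sub>1 (b * g $ 1) + J\<^sub>2 (b * g $ 2)))"
    unfolding E using indep_var_integrable[OF iv' L(1,2)] indep_var_lebesgue_integral[OF iv' L(1,2)]
    by (simp only: L(3,4) distrib_left exp_add simp_thms)
qed

text \<open>A left limit of \<open>g \<bullet> Z\<close> is \<open>g \<bullet> L\<close> with \<open>L\<close> the left limit of \<open>Z\<close>, so the signs of \<open>g\<close> keep the jumps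
  nonnegative. Independence makes the Laplace exponents add up.\<close>

theorem projection_spectrally_positive:
  fixes Z :: "real \<Rightarrow> 'w \<Rightarrow> real^2"
  assumes Z_martingale: "levy_martingale M Z"
    and Z_triplet: "levy_triplet M Z a Q \<nu>"
    and Z_indep: "indep_processes M (\<lambda>t \<omega>. Z t \<omega> $ 1) (\<lambda>t \<omega>. Z t \<omega> $ 2)"
    and Z_jumps: "\<forall>i. nonneg_jumps M (\<lambda>t \<omega>. Z t \<omega> $ i)"
    and J: "is_laplace_exponent M (\<lambda>t \<omega>. Z t \<omega> $ 1) J\<^sub>1" "is_laplace_exponent M (\<lambda>t \<omega>. Z t \<omega> $ 2) J\<^sub>2"
    and g: "0 \<le> g $ 1" "0 \<le> g $ 2"
  shows "spectrally_positive M (\<lambda>t \<omega>. g \<bullet> Z t \<omega>) (\<lambda>u. levy_exponent a Q \<nu> (u *\<^sub>R g)) ((Q *v g) \<bullet> g)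
    (proj_measure \<nu> g) (\<lambda>b. J\<^sub>1 (b * g $ 1) + J\<^sub>2 (b * g $ 2))"
proof -
  have lp: "levy_process M Z" using Z_martingale by (simp add: levy_martingale_def)
  then interpret prob_space M by (simp add: levy_process_def)
  have Zm: "Z t \<in> borel_measurable M" if "0 \<le> t" for t using lp that by (simp add: levy_process_def)
  note T = Z_triplet[unfolded levy_triplet_def]
  have \<nu>: "sets \<nu> = sets borel" and fin: "(\<integral>\<^sup>+ y. ennreal (min 1 ((norm y)\<^sup>2)) \<partial>\<nu>) < \<infinity>" using T by auto
  note [measurable_cong] = \<nu>
  show ?thesis
  proof unfold_locales
    show "(\<lambda>\<omega>. g \<bullet> Z t \<omega>) \<in> borel_measurable M" if "0 \<le> t" for t using Zm[OF that] by measurable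
    show "(LINT \<omega>|M. iexp (u * (g \<bullet> Z t \<omega>))) = exp (of_real t * levy_exponent a Q \<nu> (u *\<^sub>R g))" if "0 \<le> t" for t u
    proof -
      have "(LINT \<omega>|M. iexp ((u *\<^sub>R g) \<bullet> Z t \<omega>)) = exp (of_real t * levy_exponent a Q \<nu> (u *\<^sub>R g))"
        using T that by blast
      then show ?thesis by (simp only: inner_scaleR_left)
    qed
    show "0 \<le> (Q *v g) \<bullet> g" using T by blast
    show "sets (proj_measure \<nu> g) = sets borel" by (simp add: proj_measure_def)
    show "(\<integral>\<^sup>+ v. ennreal (min 1 (v\<^sup>2)) \<partial>proj_measure \<nu> g) < \<infinity>"
    proof -
      have "(\<integral>\<^sup>+ v. ennreal (min 1 (v\<^sup>2)) \<partial>proj_measure \<nu> g) = (\<integral>\<^sup>+ y. ennreal (min 1 ((g \<bullet> y)\<^sup>2)) \<partial>\<nu>)"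
        unfolding proj_measure_def by (subst nn_integral_distr) auto
      also have "\<dots> \<le> (\<integral>\<^sup>+ y. ennreal (1 + (norm g)\<^sup>2) * ennreal (min 1 ((norm y)\<^sup>2)) \<partial>\<nu>)"
      proof (intro nn_integral_mono)
        fix y
        have "(g \<bullet> y)\<^sup>2 \<le> (norm g * norm y)\<^sup>2"
          using power_mono[OF Cauchy_Schwarz_ineq2[of g y], of 2] by simp
        then have 1: "(g \<bullet> y)\<^sup>2 \<le> (1 + (norm g)\<^sup>2) * (norm y)\<^sup>2"
          by (simp add: power_mult_distrib algebra_simps add_increasing)
        have "min 1 ((g \<bullet> y)\<^sup>2) \<le> (1 + (norm g)\<^sup>2) * min 1 ((norm y)\<^sup>2)"
        proof (cases "(norm y)\<^sup>2 \<le> 1")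
          case True
          with 1 show ?thesis by (simp add: min_def)
        next
          case False
          then show ?thesis by (simp add: min_def add_increasing2)
        qed
        then show "ennreal (min 1 ((g \<bullet> y)\<^sup>2)) \<le> ennreal (1 + (norm g)\<^sup>2) * ennreal (min 1 ((norm y)\<^sup>2))"
          by (subst ennreal_mult[symmetric]) (auto intro!: ennreal_leI)
      qed
      also have "\<dots> = ennreal (1 + (norm g)\<^sup>2) * (\<integral>\<^sup>+ y. ennreal (min 1 ((norm y)\<^sup>2)) \<partial>\<nu>)"
        by (rule nn_integral_cmult) measurable
      also have "\<dots> < \<infinity>" using fin by (simp add: ennreal_mult_less_top)
      finally show ?thesis .
    qed
    show "levy_exponent a Q \<nu> (u *\<^sub>R g) - (levy_exponent a Q \<nu> ((u + s) *\<^sub>R g) + levy_exponent a Q \<nu> ((u - s) *\<^sub>R g)) / 2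
      = of_real ((Q *v g) \<bullet> g * s\<^sup>2 / 2) + (LINT v|proj_measure \<nu> g. (1 - cos (s * v)) *\<^sub>R iexp (u * v))" for u s
      by (rule levy_exponent_second_difference[OF \<nu> fin])
    show "levy_process M (\<lambda>t \<omega>. g \<bullet> Z t \<omega>)" using lp by (rule levy_process_inner)
    show "nonneg_jumps M (\<lambda>t \<omega>. g \<bullet> Z t \<omega>)" using lp Z_jumps g by (rule nonneg_jumps_combination)
    show "is_laplace_exponent M (\<lambda>t \<omega>. g \<bullet> Z t \<omega>) (\<lambda>b. J\<^sub>1 (b * g $ 1) + J\<^sub>2 (b * g $ 2))"
      using Zm Z_indep J g by (rule laplace_exponent_combination)
    show "integrable M (\<lambda>\<omega>. g \<bullet> Z t \<omega>)" "expectation (\<lambda>\<omega>. g \<bullet> Z t \<omega>) = 0" if "0 \<le> t" for t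
      using levy_martingale_mean[OF Z_martingale that] by auto
  qed
qed

section \<open>Functional equations\<close>

lemma scale_invariant_zero:
  fixes D :: "real \<Rightarrow> real"
  assumes D: "(D \<longlongrightarrow> 0) (at_right 0)" and t: "0 < t" "t < 1" and inv: "\<And>s. 0 < s \<Longrightarrow> D (s * t) = D s"
    and s: "0 < s"
  shows "D s = 0"
proof -
  have eq: "D (s * t ^ n) = D s" for n
  proof (induction n)
    case (Suc n)
    then show ?case using inv[of "s * t ^ n"] s t by (simp add: mult_ac)
  qed simp
  have "(\<lambda>n. s * t ^ n) \<longlonglongrightarrow> 0"
    using t by (intro tendsto_mult_right_zero LIMSEQ_power_zero) auto
  then have "filterlim (\<lambda>n. s * t ^ n) (at_right 0) sequentially"
    using s t by (auto simp: filterlim_at)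
  from filterlim_compose[OF D this] have "(\<lambda>n. D s) \<longlonglongrightarrow> 0" by (simp add: eq)
  then show ?thesis by (simp add: LIMSEQ_const_iff)
qed

text \<open>A single scaling factor determines the solution: what is left after subtracting the powers is invariant
  under \<open>s \<mapsto> s t\<close> and tends to 0 at 0.\<close>

lemma scaling_equation_solution:
  fixes J :: "real \<Rightarrow> real"
  assumes J: "(J \<longlongrightarrow> 0) (at_right 0)" and t: "0 < t" "t \<noteq> 1" and p: "0 < p" "0 < r"
    and eq: "\<And>s. 0 < s \<Longrightarrow> J (s * t) - J s = A * s powr p + B * s powr r"
    and s: "0 < s"
  shows "J s = A / (t powr p - 1) * s powr p + B / (t powr r - 1) * s powr r"
proof -
  define P where "P = A / (t powr p - 1)"
  define R where "R = B / (t powr r - 1)"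
  define D where "D s = J s - (P * s powr p + R * s powr r)" for s
  have ne: "t powr p - 1 \<noteq> 0" "t powr r - 1 \<noteq> 0"
    using t p by (auto simp: powr_eq_one_iff_gen)
  then have PR: "P * (t powr p - 1) = A" "R * (t powr r - 1) = B" by (simp_all add: P_def R_def)
  have inv: "D (s * t) = D s" if "0 < s" for s
  proof -
    have "D (s * t) - D s = (J (s * t) - J s) - (P * (t powr p - 1) * s powr p + R * (t powr r - 1) * s powr r)"
      using that t by (simp add: D_def powr_mult algebra_simps)
    also have "\<dots> = 0" using eq[OF that] by (simp only: PR)
    finally show ?thesis by simp
  qed
  have "((\<lambda>s. P * s powr p + R * s powr r) \<longlongrightarrow> P * 0 + R * 0) (at_right 0)"
    using p by (intro tendsto_add tendsto_mult tendsto_const) real_asymp+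
  then have D0: "(D \<longlongrightarrow> 0) (at_right 0)"
    unfolding D_def using tendsto_diff[OF J] by fastforce
  have "D s = 0"
  proof (cases "t < 1")
    case True
    then show ?thesis using scale_invariant_zero[OF D0 t(1) _ inv s] by simp
  next
    case False
    then have "1 / t < 1" "0 < 1 / t" using t by auto
    moreover have "D (s * (1 / t)) = D s" if "0 < s" for s
      using inv[of "s / t"] that t by simp
    ultimately show ?thesis using scale_invariant_zero[OF D0 _ _ _ s, of "1 / t"] by blast
  qed
  then show ?thesis by (simp add: D_def P_def R_def)
qed

lemma powr_coefficients_unique:
  fixes p r :: real
  assumes "r < p" and eq: "\<And>b. 0 < b \<Longrightarrow> u * b powr p + v * b powr r = u' * b powr p + v' * b powr r"
  shows "u = u'" "v = v'"
proof -
  have 1: "u + v = u' + v'" using eq[of 1] by simp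
  have "(u - u') * 2 powr p = (v' - v) * 2 powr r" using eq[of 2] by (simp add: algebra_simps)
  also have "v' - v = u - u'" using 1 by simp
  finally have "(u - u') * (2 powr p - 2 powr r) = 0" by (simp add: algebra_simps)
  moreover have "2 powr p - 2 powr r \<noteq> (0::real)" using assms(1) by (simp add: powr_inj)
  ultimately show "u = u'" by simp
  with 1 show "v = v'" by simp
qed

lemma higher_power_not_dominated:
  fixes p r :: real
  assumes "r < p" "0 < C"
  shows "\<exists>s>0. D * s powr r < C * s powr p"
proof -
  define s where "s = (\<bar>D\<bar> / C + 1) powr (1 / (p - r))"
  have base: "0 < \<bar>D\<bar> / C + 1" using assms by (intro add_nonneg_pos) auto
  then have s: "0 < s" by (simp add: s_def)
  have "C * (\<bar>D\<bar> / C + 1) = \<bar>D\<bar> + C" using assms by (simp add: distrib_left)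
  then have "D < C * (\<bar>D\<bar> / C + 1)" using assms by linarith
  also have "\<bar>D\<bar> / C + 1 = s powr (p - r)" using assms base by (simp add: s_def powr_powr)
  finally have "D * s powr r < C * s powr (p - r) * s powr r" using s by (intro mult_strict_right_mono) auto
  also have "\<dots> = C * s powr p" by (simp add: mult.assoc flip: powr_add)
  finally show ?thesis using s by blast
qed

text \<open>Near 0 the lower power dominates unless its coefficient vanishes; the ratio at \<open>b = 2\<close> tells the two
  indices apart.\<close>

lemma regular_variation_two_powers:
  assumes reg: "varies_regularly_at_0 J \<alpha>" and "r < p" and J: "\<And>s. 0 < s \<Longrightarrow> J s = u * s powr p + v * s powr r"
    and nz: "\<And>s. 0 < s \<Longrightarrow> J s \<noteq> 0"
  shows "\<alpha> = (if v = 0 then p else r)"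
proof -
  have lim: "((\<lambda>x. J (2 * x) / J x) \<longlongrightarrow> 2 powr \<alpha>) (at_right 0)"
    using reg unfolding varies_regularly_at_0_def by (rule allE[of _ 2]) simp
  have ev: "\<forall>\<^sub>F x in at_right 0. 0 < (x::real)" by (rule eventually_at_right_less)
  have lim2: "((\<lambda>x. J (2 * x) / J x) \<longlongrightarrow> 2 powr (if v = 0 then p else r)) (at_right 0)"
  proof (cases "v = 0")
    case True
    have "\<forall>\<^sub>F x in at_right 0. 2 powr p = J (2 * x) / J x"
      using ev
    proof eventually_elim
      case (elim x)
      then show ?case using J[of "2 * x"] J[of x] nz[of x] True by (simp add: powr_mult)
    qed
    then have "((\<lambda>x. J (2 * x) / J x) \<longlongrightarrow> 2 powr p) (at_right 0)"
      by (rule Lim_transform_eventually[OF tendsto_const])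
    then show ?thesis using True by simp
  next
    case False
    have z: "((\<lambda>x. x powr (p - r)) \<longlongrightarrow> 0) (at_right 0)" using \<open>r < p\<close> by real_asymp
    have "((\<lambda>x. (u * 2 powr p * x powr (p - r) + v * 2 powr r) / (u * x powr (p - r) + v))
        \<longlongrightarrow> (u * 2 powr p * 0 + v * 2 powr r) / (u * 0 + v)) (at_right 0)"
      using False by (intro tendsto_intros z) auto
    then have "((\<lambda>x. (u * 2 powr p * x powr (p - r) + v * 2 powr r) / (u * x powr (p - r) + v)) \<longlongrightarrow> 2 powr r) (at_right 0)"
      using False by simp
    then have "((\<lambda>x. J (2 * x) / J x) \<longlongrightarrow> 2 powr r) (at_right 0)"
    proof (rule Lim_transform_eventually)
      show "\<forall>\<^sub>F x in at_right 0. (u * 2 powr p * x powr (p - r) + v * 2 powr r) / (u * x powr (p - r) + v) = J (2 * x) / J x"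
        using ev
      proof eventually_elim
        case (elim x)
        have p: "x powr p = x powr (p - r) * x powr r" by (simp flip: powr_add)
        have "J (2 * x) = (u * 2 powr p * x powr (p - r) + v * 2 powr r) * x powr r"
          using J[of "2 * x"] elim by (simp add: powr_mult p algebra_simps)
        moreover have "J x = (u * x powr (p - r) + v) * x powr r"
          using J[of x] elim by (simp add: p algebra_simps)
        ultimately show ?case using elim by simp
      qed
    qed
    then show ?thesis using False by simp
  qed
  have "2 powr \<alpha> = 2 powr (if v = 0 then p else r)"
    using tendsto_unique[OF _ lim lim2] by simp
  then show ?thesis by (subst (asm) powr_inj) auto
qed

text \<open>Substituting \<open>b = s / G\<^sub>1 x\<close> at two points with different ratios and subtracting eliminates \<open>J\<^sub>1\<close>. What
  remains is the scaling equation for \<open>J\<^sub>2\<close> whose factor is the quotient of the two ratios.\<close>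

lemma powers_if_ratio_not_constant:
  fixes J\<^sub>1 J\<^sub>2 G\<^sub>1 G\<^sub>2 :: "real \<Rightarrow> real"
  assumes eq: "\<And>x b. 0 < x \<Longrightarrow> 0 \<le> b \<Longrightarrow> J\<^sub>1 (b * G\<^sub>1 x) + J\<^sub>2 (b * G\<^sub>2 x) = x * (\<eta>\<^sub>1 * b powr p + \<eta>\<^sub>2 * b powr r)"
    and G: "\<And>x. 0 < x \<Longrightarrow> 0 < G\<^sub>1 x" "\<And>x. 0 < x \<Longrightarrow> 0 < G\<^sub>2 x"
    and p: "0 < p" "0 < r" and J2: "(J\<^sub>2 \<longlongrightarrow> 0) (at_right 0)"
    and xy: "0 < x" "0 < y" "G\<^sub>2 x / G\<^sub>1 x \<noteq> G\<^sub>2 y / G\<^sub>1 y"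
  obtains u\<^sub>1 v\<^sub>1 u\<^sub>2 v\<^sub>2 where
    "\<And>s. 0 < s \<Longrightarrow> J\<^sub>1 s = u\<^sub>1 * s powr p + v\<^sub>1 * s powr r"
    "\<And>s. 0 < s \<Longrightarrow> J\<^sub>2 s = u\<^sub>2 * s powr p + v\<^sub>2 * s powr r"
    "\<eta>\<^sub>2 = 0 \<Longrightarrow> v\<^sub>1 = 0" "\<eta>\<^sub>2 = 0 \<Longrightarrow> v\<^sub>2 = 0"
proof -
  define \<rho> where "\<rho> x = G\<^sub>2 x / G\<^sub>1 x" for x
  define A where "A x = x * \<eta>\<^sub>1 / G\<^sub>1 x powr p" for x
  define B where "B x = x * \<eta>\<^sub>2 / G\<^sub>1 x powr r" for x
  have \<rho>: "0 < \<rho> x" if "0 < x" for x using G that by (simp add: \<rho>_def)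
  have e: "J\<^sub>1 s + J\<^sub>2 (s * \<rho> x) = A x * s powr p + B x * s powr r" if "0 < x" "0 < s" for x s
    using eq[of x "s / G\<^sub>1 x"] G(1)[OF that(1)] that
    by (simp add: \<rho>_def A_def B_def powr_divide algebra_simps)
  define t where "t = \<rho> x / \<rho> y"
  have t: "0 < t" "t \<noteq> 1" using \<rho>[OF xy(1)] \<rho>[OF xy(2)] xy(3) by (auto simp: t_def \<rho>_def[symmetric])
  define A' where "A' = (A x - A y) / \<rho> y powr p"
  define B' where "B' = (B x - B y) / \<rho> y powr r"
  have diff: "J\<^sub>2 (s * t) - J\<^sub>2 s = A' * s powr p + B' * s powr r" if "0 < s" for s
    using e[OF xy(1), of "s / \<rho> y"] e[OF xy(2), of "s / \<rho> y"] that \<rho>[OF xy(2)]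
    by (simp add: t_def A'_def B'_def powr_divide diff_divide_distrib algebra_simps)
  define P where "P = A' / (t powr p - 1)"
  define R where "R = B' / (t powr r - 1)"
  have J2': "J\<^sub>2 s = P * s powr p + R * s powr r" if "0 < s" for s
    unfolding P_def R_def by (rule scaling_equation_solution[OF J2 t p _ that]) (rule diff)
  have J1': "J\<^sub>1 s = (A x - P * \<rho> x powr p) * s powr p + (B x - R * \<rho> x powr r) * s powr r" if "0 < s" for s
    using e[OF xy(1) that] J2'[of "s * \<rho> x"] that \<rho>[OF xy(1)]
    by (simp add: powr_mult algebra_simps)
  show thesis
    by (rule that[OF J1' J2']) (auto simp: R_def B'_def B_def)
qed

section \<open>Generating pairs in terms of Laplace exponents\<close>

locale levy_martingale_pair =
  fixes M :: "'w measure" and Z :: "real \<Rightarrow> 'w \<Rightarrow> real^2" and a :: "real^2" and Q :: "real^2^2"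
    and \<nu> :: "(real^2) measure" and J\<^sub>1 J\<^sub>2 :: "real \<Rightarrow> real" and \<alpha>\<^sub>1 \<alpha>\<^sub>2 :: real
  assumes Z_martingale: "levy_martingale M Z"
    and Z_triplet: "levy_triplet M Z a Q \<nu>"
    and Z_indep: "indep_processes M (\<lambda>t \<omega>. Z t \<omega> $ 1) (\<lambda>t \<omega>. Z t \<omega> $ 2)"
    and Z_infinite_variation: "\<forall>i. infinite_variation M (\<lambda>t \<omega>. Z t \<omega> $ i)"
    and Z_jumps: "\<forall>i. nonneg_jumps M (\<lambda>t \<omega>. Z t \<omega> $ i)"
    and J1: "is_laplace_exponent M (\<lambda>t \<omega>. Z t \<omega> $ 1) J\<^sub>1"
    and J2: "is_laplace_exponent M (\<lambda>t \<omega>. Z t \<omega> $ 2) J\<^sub>2"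
    and J1_regular: "varies_regularly_at_0 J\<^sub>1 \<alpha>\<^sub>1"
    and J2_regular: "varies_regularly_at_0 J\<^sub>2 \<alpha>\<^sub>2"
begin

text \<open>The Laplace exponent of the projection \<open>g \<bullet> Z\<close>.\<close>

definition J :: "real^2 \<Rightarrow> real \<Rightarrow> real" where
  "J g b = J\<^sub>1 (b * g $ 1) + J\<^sub>2 (b * g $ 2)"

lemma projection:
  assumes "0 \<le> g $ 1" "0 \<le> g $ 2"
  shows "spectrally_positive M (\<lambda>t \<omega>. g \<bullet> Z t \<omega>) (\<lambda>u. levy_exponent a Q \<nu> (u *\<^sub>R g)) ((Q *v g) \<bullet> g)
    (proj_measure \<nu> g) (J g)"
  unfolding J_def
  by (rule projection_spectrally_positive[OF Z_martingale Z_triplet Z_indep Z_jumps J1 J2 assms])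

lemma laplace_exponent_0:
  assumes "is_laplace_exponent M X j" shows "j 0 = 0"
proof -
  interpret prob_space M using Z_martingale by (simp add: levy_martingale_def levy_process_def)
  have "expectation (\<lambda>\<omega>. exp (- 0 * X 1 \<omega>)) = exp (1 * j 0)"
    using assms unfolding is_laplace_exponent_def by (metis order_refl zero_le_one)
  then show ?thesis by (simp add: prob_space)
qed

lemma coordinate_1: "\<exists>\<Psi> q \<kappa>. spectrally_positive M (\<lambda>t \<omega>. Z t \<omega> $ 1) \<Psi> q \<kappa> J\<^sub>1"
proof -
  have J_eq: "J (axis 1 1) = J\<^sub>1" by (simp add: J_def axis_def fun_eq_iff laplace_exponent_0[OF J2])
  have "0 \<le> axis 1 (1::real) $ (1::2)" "0 \<le> axis 1 (1::real) $ (2::2)" by (simp_all add: axis_def)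
  from projection[OF this] J_eq
  have "spectrally_positive M (\<lambda>t \<omega>. Z t \<omega> $ 1) (\<lambda>u. levy_exponent a Q \<nu> (u *\<^sub>R axis 1 1))
    ((Q *v axis 1 1) \<bullet> axis 1 1) (proj_measure \<nu> (axis 1 1)) J\<^sub>1"
    by (simp add: inner_axis')
  then show ?thesis by blast
qed

lemma coordinate_2: "\<exists>\<Psi> q \<kappa>. spectrally_positive M (\<lambda>t \<omega>. Z t \<omega> $ 2) \<Psi> q \<kappa> J\<^sub>2"
proof -
  have J_eq: "J (axis 2 1) = J\<^sub>2" by (simp add: J_def axis_def fun_eq_iff laplace_exponent_0[OF J1])
  have "0 \<le> axis 2 (1::real) $ (1::2)" "0 \<le> axis 2 (1::real) $ (2::2)" by (simp_all add: axis_def)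
  from projection[OF this] J_eq
  have "spectrally_positive M (\<lambda>t \<omega>. Z t \<omega> $ 2) (\<lambda>u. levy_exponent a Q \<nu> (u *\<^sub>R axis 2 1))
    ((Q *v axis 2 1) \<bullet> axis 2 1) (proj_measure \<nu> (axis 2 1)) J\<^sub>2"
    by (simp add: inner_axis')
  then show ?thesis by blast
qed

lemma laplace_exponents_0: "J\<^sub>1 0 = 0" "J\<^sub>2 0 = 0"
  using laplace_exponent_0 J1 J2 by blast+

lemma laplace_exponents_pos: "0 < b \<Longrightarrow> 0 < J\<^sub>1 b" "0 < b \<Longrightarrow> 0 < J\<^sub>2 b"
  using coordinate_1 coordinate_2 spectrally_positive.J_pos[OF _ J1_regular] spectrally_positive.J_pos[OF _ J2_regular]
  by blast+

lemma J2_tendsto_0: "(J\<^sub>2 \<longlongrightarrow> 0) (at_right 0)"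
proof (rule tendsto_sandwich[OF _ _ tendsto_const])
  obtain \<Psi> q \<kappa> where "spectrally_positive M (\<lambda>t \<omega>. Z t \<omega> $ 2) \<Psi> q \<kappa> J\<^sub>2" using coordinate_2 by blast
  then interpret C: spectrally_positive M "\<lambda>t \<omega>. Z t \<omega> $ 2" \<Psi> q \<kappa> J\<^sub>2 .
  have ev: "\<forall>\<^sub>F x in at_right 0. x \<in> {0<..<1::real}" by (rule eventually_at_right_real) simp
  then show "\<forall>\<^sub>F x in at_right 0. 0 \<le> J\<^sub>2 x" by eventually_elim (auto intro: C.J_nonneg)
  show "\<forall>\<^sub>F x in at_right 0. J\<^sub>2 x \<le> x * J\<^sub>2 1"
    using ev by eventually_elim (use C.J_star_shaped[of _ 1] in auto)
  show "((\<lambda>x. x * J\<^sub>2 1) \<longlongrightarrow> 0) (at_right 0)" by (auto intro!: tendsto_eq_intros)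
qed

lemma proj_measure_0: "A \<in> sets borel \<Longrightarrow> A \<subseteq> {0<..} \<Longrightarrow> emeasure (proj_measure \<nu> 0) A = 0"
proof -
  assume A: "A \<in> sets borel" "A \<subseteq> {0<..}"
  have [measurable_cong]: "sets \<nu> = sets borel" using Z_triplet by (simp add: levy_triplet_def)
  have "emeasure (proj_measure \<nu> 0) A = emeasure \<nu> ((\<lambda>y. 0 \<bullet> y) -` A \<inter> space \<nu>)"
    unfolding proj_measure_def by (rule emeasure_distr[OF _ A(1)]) measurable
  also have "(\<lambda>y. 0 \<bullet> y) -` A \<inter> space \<nu> = {}" using A by auto
  finally show ?thesis by simp
qed

lemma stable_combination_iff:
  assumes g: "0 < g $ 1" "0 < g $ 2" and \<alpha>: "1 < \<alpha>" "\<alpha> \<le> 2"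
  shows "stable_process M \<alpha> (\<lambda>t \<omega>. g \<bullet> Z t \<omega>) \<longleftrightarrow> (\<exists>\<gamma>>0. \<forall>b\<ge>0. J g b = \<gamma> * b powr \<alpha>)"
proof -
  interpret sp: spectrally_positive M "\<lambda>t \<omega>. g \<bullet> Z t \<omega>" "\<lambda>u. levy_exponent a Q \<nu> (u *\<^sub>R g)"
    "(Q *v g) \<bullet> g" "proj_measure \<nu> g" "J g" using g by (intro projection) auto
  have "0 < J g 1" using g laplace_exponents_pos by (simp add: J_def add_pos_pos)
  then show ?thesis
    using sp.stable_if_power[OF \<alpha>] sp.power_if_stable[OF \<alpha>] by blast
qed

text \<open>At \<open>x = 0\<close> the data say that the projection on \<open>G 0\<close> has no Gaussian part, and by assumption its Levy
  measure has a finite first moment. Its exponent is then linearly bounded, and so is \<open>J\<^sub>i\<close> for each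
  positive coordinate \<open>i\<close> of \<open>G 0\<close>, which would give \<open>Z\<^sub>i\<close> finite variation.\<close>

lemma generating_data_zero:
  assumes nn: "0 \<le> G 0 $ 1" "0 \<le> G 0 $ 2"
    and fin: "(\<integral>\<^sup>+ v\<in>{0<..}. ennreal v \<partial>(proj_measure \<nu> (G 0))) < \<infinity>"
    and data: "generating_data G Q \<nu> c \<mu>"
  shows "G 0 = 0"
proof -
  let ?\<kappa> = "proj_measure \<nu> (G 0)"
  interpret sp: spectrally_positive M "\<lambda>t \<omega>. G 0 \<bullet> Z t \<omega>" "\<lambda>u. levy_exponent a Q \<nu> (u *\<^sub>R G 0)"
    "(Q *v G 0) \<bullet> G 0" "?\<kappa>" "J (G 0)" using nn by (rule projection)
  have q: "(Q *v G 0) \<bullet> G 0 = 0" using data by (simp add: generating_data_def)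
  have "(\<integral>\<^sup>+ v. ennreal (v * indicator {0<..} v) \<partial>?\<kappa>) = (\<integral>\<^sup>+ v\<in>{0<..}. ennreal v \<partial>?\<kappa>)"
    by (intro nn_integral_cong) (auto simp: indicator_def)
  then have int: "integrable ?\<kappa> (\<lambda>v. v * indicator {0<..} v)"
    using fin by (intro integrableI_nonneg) (auto simp: indicator_def)
  define m where "m = (LINT v|?\<kappa>. v * indicator {0<..} v)"
  have bound: "J (G 0) b \<le> b * m" if b: "0 \<le> b" for b
  proof -
    have "J (G 0) b = (LINT v|?\<kappa>. comp_exp (b * v))"
      using sp.laplace_exponent_formula(2)[OF b] q by simp
    also have "\<dots> \<le> (LINT v|?\<kappa>. b * (v * indicator {0<..} v))"
    proof (rule integral_mono_AE)
      show "AE v in ?\<kappa>. comp_exp (b * v) \<le> b * (v * indicator {0<..} v)"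
        using sp.levy_measure_nonneg
      proof eventually_elim
        case (elim v)
        then show ?case using b comp_exp_le[of "b * v"] by (cases "v = 0") auto
      qed
    qed (use int b sp.laplace_exponent_formula(1) in auto)
    finally show ?thesis by (simp add: m_def)
  qed
  have nonneg: "0 \<le> J\<^sub>1 b" "0 \<le> J\<^sub>2 b" if "0 \<le> b" for b
    using that laplace_exponents_pos[of b] laplace_exponents_0 by (cases "b = 0"; simp add: less_imp_le)+
  have 1: "\<not> 0 < G 0 $ 1"
  proof
    assume g: "0 < G 0 $ 1"
    have "J\<^sub>1 b \<le> b * (m / G 0 $ 1)" if "0 \<le> b" for b
      using bound[of "b / G 0 $ 1"] nonneg(2)[of "b / G 0 $ 1 * G 0 $ 2"] g nn that by (simp add: J_def)
    then show False
      using coordinate_1 Z_infinite_variation spectrally_positive.finite_variation_if_linear_bound by blast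
  qed
  have 2: "\<not> 0 < G 0 $ 2"
  proof
    assume g: "0 < G 0 $ 2"
    have "J\<^sub>2 b \<le> b * (m / G 0 $ 2)" if "0 \<le> b" for b
      using bound[of "b / G 0 $ 2"] nonneg(1)[of "b / G 0 $ 2 * G 0 $ 1"] g nn that by (simp add: J_def)
    then show False
      using coordinate_2 Z_infinite_variation spectrally_positive.finite_variation_if_linear_bound by blast
  qed
  from 1 2 nn show ?thesis by (simp add: vec_eq_iff forall_2)
qed

text \<open>For \<open>G 0 = 0\<close> the image measure at \<open>x = 0\<close> vanishes on \<open>(0, \<infinity>)\<close>, so the Gaussian variance and the Levy
  measure in direction \<open>G x\<close> are \<open>2 c x\<close> and \<open>x \<mu>\<close>.\<close>

lemma generating_data_equation:
  assumes data: "generating_data G Q \<nu> c \<mu>" and G0: "G 0 = 0"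
    and nn: "0 \<le> G x $ 1" "0 \<le> G x $ 2" and x: "0 \<le> x" and b: "0 \<le> b"
  shows "J (G x) b = x * J_tilde c \<mu> b"
proof -
  let ?\<kappa> = "proj_measure \<nu> (G x)"
  interpret sp: spectrally_positive M "\<lambda>t \<omega>. G x \<bullet> Z t \<omega>" "\<lambda>u. levy_exponent a Q \<nu> (u *\<^sub>R G x)"
    "(Q *v G x) \<bullet> G x" "?\<kappa>" "J (G x)" using nn by (rule projection)
  have d: "sets \<mu> = sets borel" using data unfolding generating_data_def by (elim conjE)
  have "\<forall>x\<ge>0. \<forall>A\<in>sets borel. A \<subseteq> {0<..} \<longrightarrow> emeasure (proj_measure \<nu> (G x)) A
      = emeasure (proj_measure \<nu> (G 0)) A + ennreal x * emeasure \<mu> A"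
    using data unfolding generating_data_def by (elim conjE)
  note D = this[rule_format, OF x]
  have "\<forall>x\<ge>0. (Q *v G x) \<bullet> G x / 2 = c * x" using data unfolding generating_data_def by (elim conjE)
  from this[rule_format, OF x]
  have q: "(Q *v G x) \<bullet> G x = 2 * (c * x)" by simp
  have [measurable_cong]: "sets \<mu> = sets borel" by (rule d)
  let ?I = "indicator {0<..} :: real \<Rightarrow> ennreal"
  have dens: "density ?\<kappa> ?I = scale_measure (ennreal x) (density \<mu> ?I)"
  proof (rule measure_eqI)
    fix A assume "A \<in> sets (density ?\<kappa> ?I)"
    then have A: "A \<in> sets borel" by (simp add: sp.sets_\<kappa>)
    then have E: "emeasure (density N ?I) A = emeasure N (A \<inter> {0<..})" if "sets N = sets borel" for N :: "real measure"
    proof -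
      have "{0<..} \<in> sets N" "A \<in> sets N" unfolding that using A by simp_all
      from emeasure_restricted[OF this] show ?thesis by (simp only: Int_commute)
    qed
    have "emeasure ?\<kappa> (A \<inter> {0<..}) = emeasure (proj_measure \<nu> (G 0)) (A \<inter> {0<..}) + ennreal x * emeasure \<mu> (A \<inter> {0<..})"
      using A by (intro D) auto
    then show "emeasure (density ?\<kappa> ?I) A = emeasure (scale_measure (ennreal x) (density \<mu> ?I)) A"
      using A by (simp add: E sp.sets_\<kappa> d G0 proj_measure_0)
  qed (simp add: sp.sets_\<kappa> d)
  have E: "(\<integral>\<^sup>+v. f v * ?I v \<partial>N) = (\<integral>\<^sup>+v. f v \<partial>density N ?I)"
    if "sets N = sets borel" "f \<in> borel_measurable borel" for N :: "real measure" and f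
  proof -
    note [measurable_cong] = that(1) and [measurable] = that(2)
    have "(\<integral>\<^sup>+v. f v \<partial>density N ?I) = (\<integral>\<^sup>+v. ?I v * f v \<partial>N)"
      by (rule nn_integral_density) measurable
    then show ?thesis by (simp only: mult.commute)
  qed
  have "(\<integral>\<^sup>+v. ennreal (comp_exp (b * v)) \<partial>?\<kappa>) = (\<integral>\<^sup>+v. ennreal (comp_exp (b * v)) * ?I v \<partial>?\<kappa>)"
    using sp.levy_measure_nonneg by (intro nn_integral_cong_AE, eventually_elim) (auto simp: indicator_def)
  also have "\<dots> = ennreal x * (\<integral>\<^sup>+v. ennreal (comp_exp (b * v)) * ?I v \<partial>\<mu>)"
    using d by (simp add: E sp.sets_\<kappa> dens nn_integral_scale_measure)
  finally have nn: "(\<integral>\<^sup>+v. ennreal (comp_exp (b * v)) \<partial>?\<kappa>) = ennreal x * (\<integral>\<^sup>+v. ennreal (comp_exp (b * v)) * ?I v \<partial>\<mu>)" .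
  have "(LINT v|?\<kappa>. comp_exp (b * v)) = enn2real (\<integral>\<^sup>+v. ennreal (comp_exp (b * v)) \<partial>?\<kappa>)"
    by (intro integral_eq_nn_integral) (auto simp: comp_exp_nonneg)
  also have "\<dots> = x * enn2real (\<integral>\<^sup>+v. ennreal (comp_exp (b * v)) * ?I v \<partial>\<mu>)"
    using x by (simp add: nn enn2real_mult)
  also have "(\<integral>\<^sup>+v. ennreal (comp_exp (b * v)) * ?I v \<partial>\<mu>) = (\<integral>\<^sup>+v. ennreal (indicator {0<..} v * comp_exp (b * v)) \<partial>\<mu>)"
    by (intro nn_integral_cong) (auto simp: indicator_def)
  also have "enn2real \<dots> = (LINT v|\<mu>. indicator {0<..} v * comp_exp (b * v))"
    by (intro integral_eq_nn_integral[symmetric]) (auto simp: comp_exp_nonneg)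
  also have "\<dots> = (LINT v:{0<..}|\<mu>. exp (- b * v) - 1 + b * v)"
    by (simp add: set_lebesgue_integral_def comp_exp_def)
  finally have I: "(LINT v|?\<kappa>. comp_exp (b * v)) = x * (LINT v:{0<..}|\<mu>. exp (- b * v) - 1 + b * v)" .
  show ?thesis
    using sp.laplace_exponent_formula(2)[OF b] unfolding I q J_tilde_def by (simp add: algebra_simps)
qed

text \<open>The exponent determines the Gaussian variance and the Levy measure on \<open>(0, \<infinity>)\<close>, so both are
  proportional to \<open>x\<close> as well; half the variance and the measure at \<open>x = 1\<close> serve as \<open>c\<close> and \<open>\<mu>\<close>.\<close>

lemma generating_pair_if_proportional:
  assumes G0: "G 0 = 0" and nn: "\<And>x. 0 < x \<Longrightarrow> 0 < G x $ 1 \<and> 0 < G x $ 2"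
    and eq: "\<And>x b. 0 < x \<Longrightarrow> 0 \<le> b \<Longrightarrow> J (G x) b = x * f b"
  shows "generating_pair G Q \<nu>"
proof -
  let ?\<kappa> = "proj_measure \<nu> (G 1)" and ?q = "\<lambda>g. (Q *v g) \<bullet> g"
  have nn': "0 \<le> G x $ 1" "0 \<le> G x $ 2" if "0 \<le> x" for x
    using nn[of x] that by (cases "x = 0"; simp add: G0 less_imp_le)+
  have sp: "spectrally_positive M (\<lambda>t \<omega>. G x \<bullet> Z t \<omega>) (\<lambda>u. levy_exponent a Q \<nu> (u *\<^sub>R G x))
    (?q (G x)) (proj_measure \<nu> (G x)) (J (G x))" if "0 \<le> x" for x
    using nn'[OF that] by (rule projection)
  interpret sp1: spectrally_positive M "\<lambda>t \<omega>. G 1 \<bullet> Z t \<omega>" "\<lambda>u. levy_exponent a Q \<nu> (u *\<^sub>R G 1)"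
    "?q (G 1)" "?\<kappa>" "J (G 1)" by (rule sp) simp
  have proportional: "J (G x) b = x * J (G 1) b" if "0 \<le> x" "0 \<le> b" for x b
    using eq[of x b] eq[of 1 b] that by (cases "x = 0") (auto simp: G0 J_def laplace_exponents_0)
  have q: "?q (G x) = x * ?q (G 1)" if x: "0 \<le> x" for x
  proof -
    have "J (G x) (real (Suc n)) / (real (Suc n))\<^sup>2 = x * (J (G 1) (real (Suc n)) / (real (Suc n))\<^sup>2)" for n
      by (simp only: proportional[OF x of_nat_0_le_iff] times_divide_eq_right)
    then have "(\<lambda>n. x * (J (G 1) (real (Suc n)) / (real (Suc n))\<^sup>2)) \<longlonglongrightarrow> ?q (G x) / 2"
      using spectrally_positive.gaussian_part_limit[OF sp[OF x]] by (simp only:)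
    moreover have "(\<lambda>n. x * (J (G 1) (real (Suc n)) / (real (Suc n))\<^sup>2)) \<longlonglongrightarrow> x * (?q (G 1) / 2)"
      by (intro tendsto_mult tendsto_const sp1.gaussian_part_limit)
    ultimately have "?q (G x) / 2 = x * (?q (G 1) / 2)"
      by (rule LIMSEQ_unique)
    then show ?thesis by simp
  qed
  have meas: "emeasure (proj_measure \<nu> (G x)) A = ennreal x * emeasure ?\<kappa> A"
    if x: "0 \<le> x" and A: "A \<in> sets borel" "A \<subseteq> {0<..}" for x A
  proof (rule levy_measure_unique[OF _ _ _ _ x _ A])
    interpret spx: spectrally_positive M "\<lambda>t \<omega>. G x \<bullet> Z t \<omega>" "\<lambda>u. levy_exponent a Q \<nu> (u *\<^sub>R G x)"
      "?q (G x)" "proj_measure \<nu> (G x)" "J (G x)" using x by (rule sp)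
    fix b :: real assume b: "0 \<le> b"
    show "integrable (proj_measure \<nu> (G x)) (\<lambda>v. comp_exp (b * v))" using b by (rule spx.laplace_exponent_formula)
    show "integrable ?\<kappa> (\<lambda>v. comp_exp (b * v))" using b by (rule sp1.laplace_exponent_formula)
    show "(LINT v|proj_measure \<nu> (G x). comp_exp (b * v)) = x * (LINT v|?\<kappa>. comp_exp (b * v))"
      using spx.laplace_exponent_formula(2)[OF b] sp1.laplace_exponent_formula(2)[OF b] proportional[OF x b] q[OF x]
      by (simp add: algebra_simps)
  qed (simp_all add: proj_measure_def)
  define \<mu> where "\<mu> = density ?\<kappa> (indicator {0<..})"
  have \<mu>: "emeasure \<mu> A = emeasure ?\<kappa> (A \<inter> {0<..})" if "A \<in> sets borel" for A
  proof -
    have "{0<..} \<in> sets ?\<kappa>" "A \<in> sets ?\<kappa>" unfolding sp1.sets_\<kappa> using that by simp_all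
    from emeasure_restricted[OF this] show ?thesis unfolding \<mu>_def by (simp only: Int_commute)
  qed
  have "generating_data G Q \<nu> (?q (G 1) / 2) \<mu>"
    unfolding generating_data_def
  proof (intro conjI allI impI ballI)
    show "0 \<le> ?q (G 1) / 2" using sp1.q_nonneg by simp
    show "sets \<mu> = sets borel" by (simp add: \<mu>_def sp1.sets_\<kappa>)
    have "{..0} \<inter> {0<..} = ({} :: real set)" by auto
    then show "emeasure \<mu> {..0} = 0" by (simp add: \<mu>)
    have "(\<integral>\<^sup>+ v\<in>{0<..}. ennreal (min v (v\<^sup>2)) \<partial>\<mu>) = (\<integral>\<^sup>+ v. indicator {0<..} v * (ennreal (min v (v\<^sup>2)) * indicator {0<..} v) \<partial>?\<kappa>)"
      unfolding \<mu>_def by (rule nn_integral_density) measurable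
    also have "\<dots> \<le> (\<integral>\<^sup>+ v. ennreal (6 * comp_exp (1 * v)) \<partial>?\<kappa>)"
      using min_le_comp_exp by (intro nn_integral_mono) (auto simp: indicator_def intro!: ennreal_leI)
    also have "\<dots> < \<infinity>"
      using integrable_mult_right[OF sp1.laplace_exponent_formula(1)[OF zero_le_one], of 6] comp_exp_nonneg
      by (subst nn_integral_eq_integral) auto
    finally show "(\<integral>\<^sup>+ v\<in>{0<..}. ennreal (min v (v\<^sup>2)) \<partial>\<mu>) < \<infinity>" .
    show "?q (G x) / 2 = ?q (G 1) / 2 * x" if "0 \<le> x" for x using q[OF that] by simp
    show "emeasure (proj_measure \<nu> (G x)) A = emeasure (proj_measure \<nu> (G 0)) A + ennreal x * emeasure \<mu> A"
      if "0 \<le> x" "A \<in> sets borel" "A \<subseteq> {0<..}" for x A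
      using meas[OF that] that by (simp add: G0 proj_measure_0 \<mu> Int_absorb2)
  qed
  moreover have "(\<integral>\<^sup>+ v\<in>{0<..}. ennreal v \<partial>(proj_measure \<nu> (G 0))) = 0"
  proof -
    have "AE v in proj_measure \<nu> 0. v \<notin> {0<..}"
      using proj_measure_0[of "{0<..}"] by (intro AE_not_in) (simp add: null_sets_def proj_measure_def)
    then have "(\<integral>\<^sup>+ v\<in>{0<..}. ennreal v \<partial>(proj_measure \<nu> 0)) = (\<integral>\<^sup>+ v. 0 \<partial>(proj_measure \<nu> 0))"
      by (intro nn_integral_cong_AE, eventually_elim) auto
    then show ?thesis by (simp add: G0)
  qed
  ultimately show ?thesis by (auto simp: generating_pair_def)
qed

end

section \<open>The classification\<close>

locale generating_candidate = levy_martingale_pair M Z a Q \<nu> J\<^sub>1 J\<^sub>2 \<alpha>\<^sub>1 \<alpha>\<^sub>2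
  for M :: "'w measure" and Z a Q \<nu> J\<^sub>1 J\<^sub>2 \<alpha>\<^sub>1 \<alpha>\<^sub>2 +
  fixes G :: "real \<Rightarrow> real^2"
  assumes G_cont: "continuous_on {0..} G"
    and G_pos: "\<forall>x>0. G x $ 1 > 0 \<and> G x $ 2 > 0"
    and indices: "2 \<ge> \<alpha>\<^sub>1" "\<alpha>\<^sub>1 \<ge> \<alpha>\<^sub>2" "\<alpha>\<^sub>2 > 1"
begin

lemma index_ranges: "1 < \<alpha>\<^sub>1" "\<alpha>\<^sub>2 \<le> 2"
  using indices by linarith+

lemma G_nonneg: "0 \<le> G x $ i" if "0 \<le> x"
proof (cases "x = 0")
  case True
  have "(G \<longlongrightarrow> G 0) (at 0 within {0..})"
    using G_cont by (simp add: continuous_on_def)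
  then have "(G \<longlongrightarrow> G 0) (at_right 0)" by (simp add: at_within_Ici_at_right)
  then have "((\<lambda>x. G x $ i) \<longlongrightarrow> G 0 $ i) (at_right 0)" by (rule tendsto_vec_nth)
  moreover have "\<forall>\<^sub>F x in at_right 0. 0 \<le> G x $ i"
    using eventually_at_right_less[of "0::real"]
  proof eventually_elim
    case (elim x)
    then show ?case using G_pos exhaust_2[of i] by (metis less_imp_le)
  qed
  ultimately show ?thesis using True by (intro tendsto_lowerbound[of _ _ "at_right 0"]) auto
next
  case False
  with that show ?thesis using G_pos exhaust_2[of i] by (metis less_imp_le order_less_le)
qed

lemma generating_pair_equation:
  assumes gen: "generating_pair G Q \<nu>" and form: "J_tilde_has_form G Q \<nu> f"
  shows "G 0 = 0" "\<And>x b. 0 \<le> x \<Longrightarrow> 0 \<le> b \<Longrightarrow> J (G x) b = x * f b"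
proof -
  obtain c \<mu> where data: "generating_data G Q \<nu> c \<mu>"
    and fin: "(\<integral>\<^sup>+ v\<in>{0<..}. ennreal v \<partial>(proj_measure \<nu> (G 0))) < \<infinity>"
    using gen unfolding generating_pair_def by blast
  show G0: "G 0 = 0" by (rule generating_data_zero[OF _ _ fin data]) (simp_all add: G_nonneg)
  fix x b :: real assume x: "0 \<le> x" and b: "0 \<le> b"
  have "J_tilde c \<mu> b = f b" using form data b unfolding J_tilde_has_form_def by blast
  then show "J (G x) b = x * f b"
    using generating_data_equation[OF data G0 G_nonneg[OF x] G_nonneg[OF x] x b] by simp
qed

lemma stable_coordinate_iff:
  assumes \<alpha>: "1 < \<alpha>" "\<alpha> \<le> 2"
  shows "stable_process M \<alpha> (\<lambda>t \<omega>. Z t \<omega> $ 1) \<longleftrightarrow> (\<exists>\<gamma>>0. \<forall>b\<ge>0. J\<^sub>1 b = \<gamma> * b powr \<alpha>)"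
    and "stable_process M \<alpha> (\<lambda>t \<omega>. Z t \<omega> $ 2) \<longleftrightarrow> (\<exists>\<gamma>>0. \<forall>b\<ge>0. J\<^sub>2 b = \<gamma> * b powr \<alpha>)"
proof -
  have pos: "0 < J\<^sub>1 1" "0 < J\<^sub>2 1" by (simp_all add: laplace_exponents_pos)
  obtain \<Psi> q \<kappa> where "spectrally_positive M (\<lambda>t \<omega>. Z t \<omega> $ 1) \<Psi> q \<kappa> J\<^sub>1" using coordinate_1 by blast
  then interpret C1: spectrally_positive M "\<lambda>t \<omega>. Z t \<omega> $ 1" \<Psi> q \<kappa> J\<^sub>1 .
  show "stable_process M \<alpha> (\<lambda>t \<omega>. Z t \<omega> $ 1) \<longleftrightarrow> (\<exists>\<gamma>>0. \<forall>b\<ge>0. J\<^sub>1 b = \<gamma> * b powr \<alpha>)"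
    using C1.stable_if_power[OF \<alpha>] C1.power_if_stable[OF \<alpha>] pos(1) by blast
  obtain \<Psi>' q' \<kappa>' where "spectrally_positive M (\<lambda>t \<omega>. Z t \<omega> $ 2) \<Psi>' q' \<kappa>' J\<^sub>2" using coordinate_2 by blast
  then interpret C2: spectrally_positive M "\<lambda>t \<omega>. Z t \<omega> $ 2" \<Psi>' q' \<kappa>' J\<^sub>2 .
  show "stable_process M \<alpha> (\<lambda>t \<omega>. Z t \<omega> $ 2) \<longleftrightarrow> (\<exists>\<gamma>>0. \<forall>b\<ge>0. J\<^sub>2 b = \<gamma> * b powr \<alpha>)"
    using C2.stable_if_power[OF \<alpha>] C2.power_if_stable[OF \<alpha>] pos(2) by blast
qed

lemma powr_root:
  fixes x y :: real
  assumes "0 < x" "0 < \<alpha>" "x powr \<alpha> = y"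
  shows "x = y powr (1 / \<alpha>)"
  using assms(1,2) by (simp add: assms(3)[symmetric] powr_powr)

definition constant_ratio :: bool where
  "constant_ratio \<longleftrightarrow> (\<forall>x>0. G x $ 2 / G x $ 1 = G 1 $ 2 / G 1 $ 1)"

lemma ray_if_constant_ratio:
  assumes const: constant_ratio and x: "0 < x"
  shows "G x = (G x $ 1 / G 1 $ 1) *\<^sub>R G 1" "J (G x) b = J (G 1) (b * (G x $ 1 / G 1 $ 1))"
proof -
  have pos: "0 < G x $ 1" "0 < G 1 $ 1" using G_pos x by auto
  have "G x $ 2 / G x $ 1 = G 1 $ 2 / G 1 $ 1" using const x unfolding constant_ratio_def by blast
  then have 2: "G x $ 2 = G x $ 1 / G 1 $ 1 * G 1 $ 2" using pos by (simp add: field_simps)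
  with pos show ray: "G x = (G x $ 1 / G 1 $ 1) *\<^sub>R G 1" by (simp add: vec_eq_iff forall_2)
  have 1: "G x $ 1 = G x $ 1 / G 1 $ 1 * G 1 $ 1" using pos by simp
  have "b * G x $ 1 = b * (G x $ 1 / G 1 $ 1) * G 1 $ 1" "b * G x $ 2 = b * (G x $ 1 / G 1 $ 1) * G 1 $ 2"
    using pos by (simp_all add: 2)
  then show "J (G x) b = J (G 1) (b * (G x $ 1 / G 1 $ 1))" unfolding J_def by (simp only:)
qed

lemma powers_if_not_constant_ratio:
  assumes not_const: "\<not> constant_ratio" and p: "0 < p" "0 < r"
    and eq: "\<And>x b. 0 \<le> x \<Longrightarrow> 0 \<le> b \<Longrightarrow> J (G x) b = x * (\<eta>\<^sub>1 * b powr p + \<eta>\<^sub>2 * b powr r)"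
  obtains u\<^sub>1 v\<^sub>1 u\<^sub>2 v\<^sub>2 where
    "\<And>s. 0 < s \<Longrightarrow> J\<^sub>1 s = u\<^sub>1 * s powr p + v\<^sub>1 * s powr r"
    "\<And>s. 0 < s \<Longrightarrow> J\<^sub>2 s = u\<^sub>2 * s powr p + v\<^sub>2 * s powr r"
    "\<eta>\<^sub>2 = 0 \<Longrightarrow> v\<^sub>1 = 0" "\<eta>\<^sub>2 = 0 \<Longrightarrow> v\<^sub>2 = 0"
proof -
  obtain x where x: "0 < x" "G x $ 2 / G x $ 1 \<noteq> G 1 $ 2 / G 1 $ 1"
    using not_const unfolding constant_ratio_def by blast
  show thesis
  proof (rule powers_if_ratio_not_constant[of J\<^sub>1 "\<lambda>x. G x $ 1" J\<^sub>2 "\<lambda>x. G x $ 2" \<eta>\<^sub>1 p \<eta>\<^sub>2 r x 1])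
    show "J\<^sub>1 (b * G x $ 1) + J\<^sub>2 (b * G x $ 2) = x * (\<eta>\<^sub>1 * b powr p + \<eta>\<^sub>2 * b powr r)" if "0 < x" "0 \<le> b" for x b
      using eq[of x b] that by (simp add: J_def)
  qed (use that x p G_pos J2_tendsto_0 in auto)
qed

lemma generating_pair_ray:
  assumes G: "\<forall>x\<ge>0. G x = (c\<^sub>0 * x powr (1 / \<alpha>\<^sub>1)) *\<^sub>R vector [g\<^sub>1, g\<^sub>2]" and pos: "0 < c\<^sub>0" "0 < g\<^sub>1" "0 < g\<^sub>2"
    and stable: "stable_process M \<alpha>\<^sub>1 (\<lambda>t \<omega>. g\<^sub>1 * Z t \<omega> $ 1 + g\<^sub>2 * Z t \<omega> $ 2)"
  shows "generating_pair G Q \<nu>"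
proof -
  define g :: "real^2" where "g = vector [g\<^sub>1, g\<^sub>2]"
  have g: "0 < g $ 1" "0 < g $ 2" using pos by (simp_all add: g_def)
  have "(\<lambda>t \<omega>. g\<^sub>1 * Z t \<omega> $ 1 + g\<^sub>2 * Z t \<omega> $ 2) = (\<lambda>t \<omega>. g \<bullet> Z t \<omega>)"
    by (simp add: g_def inner_vec_def sum_2)
  with stable have "stable_process M \<alpha>\<^sub>1 (\<lambda>t \<omega>. g \<bullet> Z t \<omega>)" by simp
  then obtain \<gamma> where \<gamma>: "\<And>b. 0 \<le> b \<Longrightarrow> J g b = \<gamma> * b powr \<alpha>\<^sub>1"
    using stable_combination_iff[OF g index_ranges(1) indices(1)] by blast
  show ?thesis
  proof (rule generating_pair_if_proportional[where f="\<lambda>b. \<gamma> * (b * c\<^sub>0) powr \<alpha>\<^sub>1"])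
    show "G 0 = 0" using G by simp
    fix x b :: real assume x: "0 < x" and b: "0 \<le> b"
    have "J (G x) b = J g (b * c\<^sub>0 * x powr (1 / \<alpha>\<^sub>1))"
      using G x by (simp add: J_def g_def mult.assoc)
    also have "\<dots> = \<gamma> * (b * c\<^sub>0 * x powr (1 / \<alpha>\<^sub>1)) powr \<alpha>\<^sub>1" using b pos by (intro \<gamma>) auto
    also have "\<dots> = x * (\<gamma> * (b * c\<^sub>0) powr \<alpha>\<^sub>1)"
      using b pos x index_ranges by (simp add: powr_mult powr_powr)
    finally show "J (G x) b = x * (\<gamma> * (b * c\<^sub>0) powr \<alpha>\<^sub>1)" .
  qed (use G_pos in auto)
qed

lemma generating_pair_stable_coordinates:
  assumes c: "0 < c\<^sub>1" "0 < c\<^sub>2" and G: "\<forall>x\<ge>0. c\<^sub>1 * (G x $ 1) powr \<alpha>\<^sub>1 + c\<^sub>2 * (G x $ 2) powr \<alpha>\<^sub>1 = \<eta> * x"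
    and J: "\<forall>b\<ge>0. J\<^sub>1 b = c\<^sub>1 * b powr \<alpha>\<^sub>1 \<and> J\<^sub>2 b = c\<^sub>2 * b powr \<alpha>\<^sub>1"
  shows "generating_pair G Q \<nu>"
proof (rule generating_pair_if_proportional[where f="\<lambda>b. \<eta> * b powr \<alpha>\<^sub>1"])
  have "c\<^sub>1 * (G 0 $ 1) powr \<alpha>\<^sub>1 + c\<^sub>2 * (G 0 $ 2) powr \<alpha>\<^sub>1 = 0" using G by simp
  moreover have "0 \<le> c\<^sub>1 * (G 0 $ 1) powr \<alpha>\<^sub>1" "0 \<le> c\<^sub>2 * (G 0 $ 2) powr \<alpha>\<^sub>1" using c by auto
  ultimately have "c\<^sub>1 * (G 0 $ 1) powr \<alpha>\<^sub>1 = 0" "c\<^sub>2 * (G 0 $ 2) powr \<alpha>\<^sub>1 = 0" by linarith+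
  then show "G 0 = 0" using c by (simp add: vec_eq_iff forall_2)
  fix x b :: real assume x: "0 < x" and b: "0 \<le> b"
  have G': "0 \<le> G x $ i" for i using x by (intro G_nonneg) simp
  have "J (G x) b = c\<^sub>1 * (b * G x $ 1) powr \<alpha>\<^sub>1 + c\<^sub>2 * (b * G x $ 2) powr \<alpha>\<^sub>1"
    using J G' b by (simp add: J_def)
  also have "\<dots> = (c\<^sub>1 * (G x $ 1) powr \<alpha>\<^sub>1 + c\<^sub>2 * (G x $ 2) powr \<alpha>\<^sub>1) * b powr \<alpha>\<^sub>1"
    using G' b by (simp add: powr_mult algebra_simps)
  also have "\<dots> = x * (\<eta> * b powr \<alpha>\<^sub>1)" using G x by simp
  finally show "J (G x) b = x * (\<eta> * b powr \<alpha>\<^sub>1)" .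
qed (use G_pos in auto)

text \<open>If the ratio is constant, \<open>G\<close> stays on the ray of \<open>G 1\<close>, and the equation at \<open>b = 1\<close> shows that it
  moves like \<open>x powr (1 / \<alpha>\<^sub>1)\<close>. Otherwise both exponents are multiples of \<open>b powr \<alpha>\<^sub>1\<close>.\<close>

theorem single_power_iff:
  assumes \<eta>: "0 < \<eta>" and form: "J_tilde_has_form G Q \<nu> (\<lambda>b. \<eta> * b powr \<alpha>\<^sub>1)"
  shows "generating_pair G Q \<nu> \<longleftrightarrow>
          (\<exists>c\<^sub>0>0. \<exists>g\<^sub>1>0. \<exists>g\<^sub>2>0.
             (\<forall>x\<ge>0. G x = (c\<^sub>0 * x powr (1 / \<alpha>\<^sub>1)) *\<^sub>R vector [g\<^sub>1, g\<^sub>2]) \<and>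
             stable_process M \<alpha>\<^sub>1 (\<lambda>t \<omega>. g\<^sub>1 * Z t \<omega> $ 1 + g\<^sub>2 * Z t \<omega> $ 2))
          \<or>
          (\<exists>c\<^sub>1>0. \<exists>c\<^sub>2>0.
             (\<forall>x\<ge>0. c\<^sub>1 * (G x $ 1) powr \<alpha>\<^sub>1 + c\<^sub>2 * (G x $ 2) powr \<alpha>\<^sub>1 = \<eta> * x) \<and>
             stable_process M \<alpha>\<^sub>1 (\<lambda>t \<omega>. Z t \<omega> $ 1) \<and>
             stable_process M \<alpha>\<^sub>1 (\<lambda>t \<omega>. Z t \<omega> $ 2) \<and>
             (\<forall>b\<ge>0. J\<^sub>1 b = c\<^sub>1 * b powr \<alpha>\<^sub>1 \<and> J\<^sub>2 b = c\<^sub>2 * b powr \<alpha>\<^sub>1))"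
    (is "?gen \<longleftrightarrow> ?a \<or> ?b")
proof
  assume ?gen
  note G0 = generating_pair_equation(1)[OF this form] and eq = generating_pair_equation(2)[OF this form]
  show "?a \<or> ?b"
  proof (cases constant_ratio)
    case True
    have pos: "0 < G 1 $ 1" "0 < G 1 $ 2" using G_pos by auto
    have vec: "vector [G 1 $ 1, G 1 $ 2] = G 1" by (simp add: vec_eq_iff forall_2)
    have "G x = (1 * x powr (1 / \<alpha>\<^sub>1)) *\<^sub>R vector [G 1 $ 1, G 1 $ 2]" if x: "0 \<le> x" for x
    proof (cases "x = 0")
      case False
      with x have x: "0 < x" by simp
      define r where "r = G x $ 1 / G 1 $ 1"
      have r: "0 < r" using G_pos x pos by (simp add: r_def)
      have "x * (\<eta> * 1 powr \<alpha>\<^sub>1) = J (G x) 1" using eq[of x 1] x by simp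
      also have "\<dots> = J (G 1) (1 * r)" unfolding r_def by (rule ray_if_constant_ratio(2)[OF True x])
      also have "\<dots> = 1 * (\<eta> * (1 * r) powr \<alpha>\<^sub>1)" using r by (intro eq) auto
      finally have "r powr \<alpha>\<^sub>1 = x" using \<eta> by simp
      then have "r = x powr (1 / \<alpha>\<^sub>1)" using r index_ranges by (intro powr_root) auto
      then show ?thesis using ray_if_constant_ratio(1)[OF True x] by (simp only: vec r_def mult_1)
    qed (simp add: G0)
    moreover have "\<forall>b\<ge>0. J (G 1) b = \<eta> * b powr \<alpha>\<^sub>1" using eq[of 1] by simp
    then have "stable_process M \<alpha>\<^sub>1 (\<lambda>t \<omega>. G 1 \<bullet> Z t \<omega>)"
      using stable_combination_iff[OF pos index_ranges(1) indices(1)] \<eta> by blast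
    then have "stable_process M \<alpha>\<^sub>1 (\<lambda>t \<omega>. G 1 $ 1 * Z t \<omega> $ 1 + G 1 $ 2 * Z t \<omega> $ 2)"
      by (simp add: inner_vec_def sum_2)
    ultimately show ?thesis using pos zero_less_one by blast
  next
    case False
    obtain u\<^sub>1 v\<^sub>1 u\<^sub>2 v\<^sub>2 where
      J: "\<And>s. 0 < s \<Longrightarrow> J\<^sub>1 s = u\<^sub>1 * s powr \<alpha>\<^sub>1 + v\<^sub>1 * s powr 1"
        "\<And>s. 0 < s \<Longrightarrow> J\<^sub>2 s = u\<^sub>2 * s powr \<alpha>\<^sub>1 + v\<^sub>2 * s powr 1"
      and v: "v\<^sub>1 = 0" "v\<^sub>2 = 0"
      by (rule powers_if_not_constant_ratio[OF False, of \<alpha>\<^sub>1 1 \<eta> 0]) (use eq index_ranges in auto)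
    have u: "0 < u\<^sub>1" "0 < u\<^sub>2" using J[of 1] v laplace_exponents_pos[of 1] by auto
    have J': "J\<^sub>1 b = u\<^sub>1 * b powr \<alpha>\<^sub>1" "J\<^sub>2 b = u\<^sub>2 * b powr \<alpha>\<^sub>1" if "0 \<le> b" for b
      using J[of b] v that laplace_exponents_0 by (cases "b = 0"; simp)+
    have G: "u\<^sub>1 * (G x $ 1) powr \<alpha>\<^sub>1 + u\<^sub>2 * (G x $ 2) powr \<alpha>\<^sub>1 = \<eta> * x" if "0 \<le> x" for x
      using eq[OF that zero_le_one] J'[OF G_nonneg[OF that]] by (simp add: J_def mult.commute)
    have "stable_process M \<alpha>\<^sub>1 (\<lambda>t \<omega>. Z t \<omega> $ 1)" "stable_process M \<alpha>\<^sub>1 (\<lambda>t \<omega>. Z t \<omega> $ 2)"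
      using stable_coordinate_iff[OF index_ranges(1) indices(1)] u J' by blast+
    with u J' G show ?thesis
      by (intro disjI2 exI[of _ u\<^sub>1] exI[of _ u\<^sub>2] conjI allI impI)
  qed
next
  assume "?a \<or> ?b"
  then show ?gen
  proof
    assume ?a
    then show ?gen by (elim exE conjE) (rule generating_pair_ray)
  next
    assume ?b
    then show ?gen by (elim exE conjE) (rule generating_pair_stable_coordinates)
  qed
qed

lemma generating_pair_two_powers:
  assumes \<eta>: "0 < \<eta>\<^sub>1" "0 < \<eta>\<^sub>2" and c: "0 < c\<^sub>1" "0 < c\<^sub>2"
    and G: "\<forall>x\<ge>0. G x $ 1 = (\<eta>\<^sub>1 / c\<^sub>1 * x) powr (1 / \<alpha>\<^sub>1) \<and> G x $ 2 = (\<eta>\<^sub>2 / c\<^sub>2 * x) powr (1 / \<alpha>\<^sub>2)"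
    and stable: "stable_process M \<alpha>\<^sub>1 (\<lambda>t \<omega>. Z t \<omega> $ 1)" "stable_process M \<alpha>\<^sub>2 (\<lambda>t \<omega>. Z t \<omega> $ 2)"
  shows "generating_pair G Q \<nu>"
proof -
  have \<alpha>pos: "0 < \<alpha>\<^sub>1" "0 < \<alpha>\<^sub>2" using indices by linarith+
  obtain \<gamma>\<^sub>1 \<gamma>\<^sub>2 where \<gamma>: "\<And>b. 0 \<le> b \<Longrightarrow> J\<^sub>1 b = \<gamma>\<^sub>1 * b powr \<alpha>\<^sub>1" "\<And>b. 0 \<le> b \<Longrightarrow> J\<^sub>2 b = \<gamma>\<^sub>2 * b powr \<alpha>\<^sub>2"
    using stable stable_coordinate_iff(1)[OF index_ranges(1) indices(1)] stable_coordinate_iff(2)[OF indices(3) index_ranges(2)]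
    by blast
  show ?thesis
  proof (rule generating_pair_if_proportional[where f="\<lambda>b. \<gamma>\<^sub>1 * (\<eta>\<^sub>1 / c\<^sub>1) * b powr \<alpha>\<^sub>1 + \<gamma>\<^sub>2 * (\<eta>\<^sub>2 / c\<^sub>2) * b powr \<alpha>\<^sub>2"])
    show "G 0 = 0" using G by (simp add: vec_eq_iff forall_2)
    fix x b :: real assume x: "0 < x" and b: "0 \<le> b"
    have "(G x $ 1) powr \<alpha>\<^sub>1 = \<eta>\<^sub>1 / c\<^sub>1 * x" "(G x $ 2) powr \<alpha>\<^sub>2 = \<eta>\<^sub>2 / c\<^sub>2 * x"
      using G x \<alpha>pos \<eta> c by (simp_all add: powr_powr)
    moreover have "0 \<le> G x $ i" for i using x by (intro G_nonneg) simp
    ultimately show "J (G x) b = x * (\<gamma>\<^sub>1 * (\<eta>\<^sub>1 / c\<^sub>1) * b powr \<alpha>\<^sub>1 + \<gamma>\<^sub>2 * (\<eta>\<^sub>2 / c\<^sub>2) * b powr \<alpha>\<^sub>2)"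
      using b by (simp add: J_def \<gamma> powr_mult algebra_simps)
  qed (use G_pos in auto)
qed

text \<open>On a ray, \<open>r = G 2 $ 1 / G 1 $ 1\<close> would satisfy both \<open>r powr \<alpha>\<^sub>1 = 2\<close> and \<open>r powr \<alpha>\<^sub>2 = 2\<close>. So \<open>J\<^sub>1\<close> and \<open>J\<^sub>2\<close>
  are combinations of the two powers. The index at 0 excludes the lower power from \<open>J\<^sub>1\<close>. The coefficient
  of the higher power in \<open>J\<^sub>2\<close> is 0: were it negative, \<open>J\<^sub>2\<close> would be negative at large arguments; were it
  positive, its contribution to the coefficient of \<open>b powr \<alpha>\<^sub>1\<close> would outgrow \<open>\<eta>\<^sub>1 x\<close>, because \<open>G x $ 2\<close> is a
  multiple of \<open>x powr (1 / \<alpha>\<^sub>2)\<close>.\<close>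

theorem two_powers_iff:
  assumes \<eta>: "0 < \<eta>\<^sub>1" "0 < \<eta>\<^sub>2" and \<alpha>: "\<alpha>\<^sub>2 < \<alpha>\<^sub>1"
    and form: "J_tilde_has_form G Q \<nu> (\<lambda>b. \<eta>\<^sub>1 * b powr \<alpha>\<^sub>1 + \<eta>\<^sub>2 * b powr \<alpha>\<^sub>2)"
  shows "generating_pair G Q \<nu> \<longleftrightarrow>
          (\<exists>c\<^sub>1>0. \<exists>c\<^sub>2>0.
             (\<forall>x\<ge>0. G x $ 1 = (\<eta>\<^sub>1 / c\<^sub>1 * x) powr (1 / \<alpha>\<^sub>1) \<and>
                     G x $ 2 = (\<eta>\<^sub>2 / c\<^sub>2 * x) powr (1 / \<alpha>\<^sub>2)) \<and>
             stable_process M \<alpha>\<^sub>1 (\<lambda>t \<omega>. Z t \<omega> $ 1) \<and>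
             stable_process M \<alpha>\<^sub>2 (\<lambda>t \<omega>. Z t \<omega> $ 2))"
    (is "?gen \<longleftrightarrow> ?c")
proof
  assume ?gen
  note G0 = generating_pair_equation(1)[OF this form] and eq = generating_pair_equation(2)[OF this form]
  show ?c
  proof -
    have \<alpha>pos: "0 < \<alpha>\<^sub>1" "0 < \<alpha>\<^sub>2" using indices by linarith+
    have not_const: "\<not> constant_ratio"
    proof
      assume const: constant_ratio
      define r where "r = G 2 $ 1 / G 1 $ 1"
      have r: "0 < r" using G_pos by (simp add: r_def)
      have e: "(\<eta>\<^sub>1 * r powr \<alpha>\<^sub>1) * b powr \<alpha>\<^sub>1 + (\<eta>\<^sub>2 * r powr \<alpha>\<^sub>2) * b powr \<alpha>\<^sub>2
        = (2 * \<eta>\<^sub>1) * b powr \<alpha>\<^sub>1 + (2 * \<eta>\<^sub>2) * b powr \<alpha>\<^sub>2" if b: "0 < b" for b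
      proof -
        have "J (G 1) (b * r) = 1 * (\<eta>\<^sub>1 * (b * r) powr \<alpha>\<^sub>1 + \<eta>\<^sub>2 * (b * r) powr \<alpha>\<^sub>2)"
          using b r by (intro eq) auto
        moreover have "J (G 2) b = 2 * (\<eta>\<^sub>1 * b powr \<alpha>\<^sub>1 + \<eta>\<^sub>2 * b powr \<alpha>\<^sub>2)"
          using b by (intro eq) auto
        moreover have "J (G 2) b = J (G 1) (b * r)"
          unfolding r_def by (rule ray_if_constant_ratio(2)[OF const]) simp
        ultimately show ?thesis using b r by (simp add: powr_mult algebra_simps)
      qed
      have "r powr \<alpha>\<^sub>1 = 2" "r powr \<alpha>\<^sub>2 = 2"
        using powr_coefficients_unique[OF \<alpha> e] \<eta> by auto
      then have "r powr (\<alpha>\<^sub>1 - \<alpha>\<^sub>2) = 1" using r by (simp add: powr_diff)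
      then have "r = 1" using r \<alpha> powr_eq_one_iff_gen[of r "\<alpha>\<^sub>1 - \<alpha>\<^sub>2"] by (cases "r = 1") auto
      with \<open>r powr \<alpha>\<^sub>1 = 2\<close> show False by simp
    qed
    obtain u\<^sub>1 v\<^sub>1 u\<^sub>2 v\<^sub>2 where
      J: "\<And>s. 0 < s \<Longrightarrow> J\<^sub>1 s = u\<^sub>1 * s powr \<alpha>\<^sub>1 + v\<^sub>1 * s powr \<alpha>\<^sub>2"
        "\<And>s. 0 < s \<Longrightarrow> J\<^sub>2 s = u\<^sub>2 * s powr \<alpha>\<^sub>1 + v\<^sub>2 * s powr \<alpha>\<^sub>2"
      by (rule powers_if_not_constant_ratio[OF not_const \<alpha>pos eq]) (assumption | rule that)+
    have nz: "J\<^sub>1 s \<noteq> 0" "J\<^sub>2 s \<noteq> 0" if "0 < s" for s using laplace_exponents_pos[OF that] by auto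
    have v1: "v\<^sub>1 = 0"
      using regular_variation_two_powers[OF J1_regular \<alpha> J(1) nz(1)] \<alpha> by (auto split: if_splits)
    then have u1: "0 < u\<^sub>1" using J(1)[of 1] laplace_exponents_pos(1)[of 1] by simp
    have coef: "u\<^sub>1 * (G x $ 1) powr \<alpha>\<^sub>1 + u\<^sub>2 * (G x $ 2) powr \<alpha>\<^sub>1 = x * \<eta>\<^sub>1" "v\<^sub>2 * (G x $ 2) powr \<alpha>\<^sub>2 = x * \<eta>\<^sub>2"
      if x: "0 < x" for x
    proof -
      have G: "0 < G x $ 1" "0 < G x $ 2" using G_pos x by auto
      have e: "(u\<^sub>1 * (G x $ 1) powr \<alpha>\<^sub>1 + u\<^sub>2 * (G x $ 2) powr \<alpha>\<^sub>1) * b powr \<alpha>\<^sub>1 + (v\<^sub>2 * (G x $ 2) powr \<alpha>\<^sub>2) * b powr \<alpha>\<^sub>2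
        = (x * \<eta>\<^sub>1) * b powr \<alpha>\<^sub>1 + (x * \<eta>\<^sub>2) * b powr \<alpha>\<^sub>2" if b: "0 < b" for b
        using eq[of x b] J(1)[of "b * G x $ 1"] J(2)[of "b * G x $ 2"] x b G v1
        by (simp add: J_def powr_mult algebra_simps)
      show "u\<^sub>1 * (G x $ 1) powr \<alpha>\<^sub>1 + u\<^sub>2 * (G x $ 2) powr \<alpha>\<^sub>1 = x * \<eta>\<^sub>1" "v\<^sub>2 * (G x $ 2) powr \<alpha>\<^sub>2 = x * \<eta>\<^sub>2"
        using powr_coefficients_unique[OF \<alpha> e] by auto
    qed
    have "0 < v\<^sub>2 * (G 1 $ 2) powr \<alpha>\<^sub>2" using coef(2)[of 1] \<eta> by simp
    then have v2: "0 < v\<^sub>2" by (simp add: zero_less_mult_iff)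
    have G2: "G x $ 2 = (\<eta>\<^sub>2 / v\<^sub>2 * x) powr (1 / \<alpha>\<^sub>2)" if x: "0 < x" for x
      using coef(2)[OF x] v2 G_pos x \<alpha>pos by (intro powr_root) (auto simp: field_simps)
    have "\<not> u\<^sub>2 < 0"
    proof
      assume "u\<^sub>2 < 0"
      then obtain s where s: "0 < s" "v\<^sub>2 * s powr \<alpha>\<^sub>2 < - u\<^sub>2 * s powr \<alpha>\<^sub>1"
        using higher_power_not_dominated[OF \<alpha>, of "- u\<^sub>2" v\<^sub>2] by auto
      then show False using J(2)[OF s(1)] laplace_exponents_pos(2)[OF s(1)] by simp
    qed
    moreover have "\<not> 0 < u\<^sub>2"
    proof
      assume u2: "0 < u\<^sub>2"
      \<comment> \<open>\<open>C x powr (\<alpha>\<^sub>1 / \<alpha>\<^sub>2)\<close> is the contribution of \<open>G x $ 2\<close> to the coefficient of \<open>b powr \<alpha>\<^sub>1\<close>\<close>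
      define C where "C = u\<^sub>2 * (\<eta>\<^sub>2 / v\<^sub>2) powr (\<alpha>\<^sub>1 / \<alpha>\<^sub>2)"
      have "0 < C" using u2 \<eta> v2 by (simp add: C_def)
      moreover have "1 < \<alpha>\<^sub>1 / \<alpha>\<^sub>2" using \<alpha> \<alpha>pos by simp
      ultimately obtain x where x: "0 < x" "\<eta>\<^sub>1 * x powr 1 < C * x powr (\<alpha>\<^sub>1 / \<alpha>\<^sub>2)"
        using higher_power_not_dominated by blast
      have "(G x $ 2) powr \<alpha>\<^sub>1 = (\<eta>\<^sub>2 / v\<^sub>2 * x) powr (\<alpha>\<^sub>1 / \<alpha>\<^sub>2)"
        unfolding G2[OF x(1)] by (simp add: powr_powr)
      also have "\<dots> = (\<eta>\<^sub>2 / v\<^sub>2) powr (\<alpha>\<^sub>1 / \<alpha>\<^sub>2) * x powr (\<alpha>\<^sub>1 / \<alpha>\<^sub>2)"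
        by (rule powr_mult)
      finally have "C * x powr (\<alpha>\<^sub>1 / \<alpha>\<^sub>2) = u\<^sub>2 * (G x $ 2) powr \<alpha>\<^sub>1"
        by (simp add: C_def)
      moreover have "0 < G x $ 1" using G_pos x(1) by blast
      then have "0 < u\<^sub>1 * (G x $ 1) powr \<alpha>\<^sub>1" using u1 by simp
      moreover have "\<eta>\<^sub>1 * x powr 1 = x * \<eta>\<^sub>1" using x(1) by simp
      ultimately show False using coef(1)[OF x(1)] x(2) by linarith
    qed
    ultimately have u2: "u\<^sub>2 = 0" by linarith
    have G1: "G x $ 1 = (\<eta>\<^sub>1 / u\<^sub>1 * x) powr (1 / \<alpha>\<^sub>1)" if x: "0 < x" for x
      using coef(1)[OF x] u1 u2 G_pos x \<alpha>pos by (intro powr_root) (auto simp: field_simps)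
    have G: "G x $ 1 = (\<eta>\<^sub>1 / u\<^sub>1 * x) powr (1 / \<alpha>\<^sub>1)" "G x $ 2 = (\<eta>\<^sub>2 / v\<^sub>2 * x) powr (1 / \<alpha>\<^sub>2)" if "0 \<le> x" for x
      using G1[of x] G2[of x] that by (cases "x = 0"; simp add: G0)+
    have "J\<^sub>1 b = u\<^sub>1 * b powr \<alpha>\<^sub>1" "J\<^sub>2 b = v\<^sub>2 * b powr \<alpha>\<^sub>2" if "0 \<le> b" for b
      using J[of b] v1 u2 that laplace_exponents_0 by (cases "b = 0"; simp)+
    then have "stable_process M \<alpha>\<^sub>1 (\<lambda>t \<omega>. Z t \<omega> $ 1)" "stable_process M \<alpha>\<^sub>2 (\<lambda>t \<omega>. Z t \<omega> $ 2)"
      using stable_coordinate_iff(1)[OF index_ranges(1) indices(1)] stable_coordinate_iff(2)[OF indices(3) index_ranges(2)] u1 v2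
      by blast+
    with u1 v2 G show ?thesis
      by (intro exI[of _ u\<^sub>1] exI[of _ v\<^sub>2] conjI allI impI)
  qed
next
  assume ?c
  then show ?gen by (elim exE conjE) (rule generating_pair_two_powers[OF \<eta>])
qed

end

theorem theorem3p8:
  fixes M :: "'w measure"
    and Z :: "real \<Rightarrow> 'w \<Rightarrow> real^2"
    and G :: "real \<Rightarrow> real^2"
    and a :: "real^2" and Q :: "real^2^2" and \<nu> :: "(real^2) measure"
    and J\<^sub>1 J\<^sub>2 :: "real \<Rightarrow> real"
    and \<alpha>\<^sub>1 \<alpha>\<^sub>2 :: real
  assumes G_cont: "continuous_on {0..} G"
    and G_pos: "\<forall>x>0. G x $ 1 > 0 \<and> G x $ 2 > 0"
    and G_ratio: "(\<lambda>x. G x $ 2 / G x $ 1) C1_differentiable_on {0<..}"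
    and Z_martingale: "levy_martingale M Z"
    and Z_triplet: "levy_triplet M Z a Q \<nu>"
    and Z_indep: "indep_processes M (\<lambda>t \<omega>. Z t \<omega> $ 1) (\<lambda>t \<omega>. Z t \<omega> $ 2)"
    and Z_infinite_variation: "\<forall>i. infinite_variation M (\<lambda>t \<omega>. Z t \<omega> $ i)"
    and Z_jumps: "\<forall>i. nonneg_jumps M (\<lambda>t \<omega>. Z t \<omega> $ i)"
    and J1: "is_laplace_exponent M (\<lambda>t \<omega>. Z t \<omega> $ 1) J\<^sub>1"
    and J2: "is_laplace_exponent M (\<lambda>t \<omega>. Z t \<omega> $ 2) J\<^sub>2"
    and J1_regular: "varies_regularly_at_0 J\<^sub>1 \<alpha>\<^sub>1"
    and J2_regular: "varies_regularly_at_0 J\<^sub>2 \<alpha>\<^sub>2"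
    and indices: "2 \<ge> \<alpha>\<^sub>1" "\<alpha>\<^sub>1 \<ge> \<alpha>\<^sub>2" "\<alpha>\<^sub>2 > 1"
  shows
    "(\<forall>\<eta>\<^sub>1>0. J_tilde_has_form G Q \<nu> (\<lambda>b. \<eta>\<^sub>1 * b powr \<alpha>\<^sub>1) \<longrightarrow>
        (generating_pair G Q \<nu> \<longleftrightarrow>
          (\<exists>c\<^sub>0>0. \<exists>g\<^sub>1>0. \<exists>g\<^sub>2>0.
             (\<forall>x\<ge>0. G x = (c\<^sub>0 * x powr (1 / \<alpha>\<^sub>1)) *\<^sub>R vector [g\<^sub>1, g\<^sub>2]) \<and>
             stable_process M \<alpha>\<^sub>1 (\<lambda>t \<omega>. g\<^sub>1 * Z t \<omega> $ 1 + g\<^sub>2 * Z t \<omega> $ 2))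
          \<or>
          (\<exists>c\<^sub>1>0. \<exists>c\<^sub>2>0.
             (\<forall>x\<ge>0. c\<^sub>1 * (G x $ 1) powr \<alpha>\<^sub>1 + c\<^sub>2 * (G x $ 2) powr \<alpha>\<^sub>1 = \<eta>\<^sub>1 * x) \<and>
             stable_process M \<alpha>\<^sub>1 (\<lambda>t \<omega>. Z t \<omega> $ 1) \<and>
             stable_process M \<alpha>\<^sub>1 (\<lambda>t \<omega>. Z t \<omega> $ 2) \<and>
             (\<forall>b\<ge>0. J\<^sub>1 b = c\<^sub>1 * b powr \<alpha>\<^sub>1 \<and> J\<^sub>2 b = c\<^sub>2 * b powr \<alpha>\<^sub>1))))
     \<and>
     (\<forall>\<eta>\<^sub>1>0. \<forall>\<eta>\<^sub>2>0. \<alpha>\<^sub>1 > \<alpha>\<^sub>2 \<longrightarrow>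
        J_tilde_has_form G Q \<nu> (\<lambda>b. \<eta>\<^sub>1 * b powr \<alpha>\<^sub>1 + \<eta>\<^sub>2 * b powr \<alpha>\<^sub>2) \<longrightarrow>
        (generating_pair G Q \<nu> \<longleftrightarrow>
          (\<exists>c\<^sub>1>0. \<exists>c\<^sub>2>0.
             (\<forall>x\<ge>0. G x $ 1 = (\<eta>\<^sub>1 / c\<^sub>1 * x) powr (1 / \<alpha>\<^sub>1) \<and>
                     G x $ 2 = (\<eta>\<^sub>2 / c\<^sub>2 * x) powr (1 / \<alpha>\<^sub>2)) \<and>
             stable_process M \<alpha>\<^sub>1 (\<lambda>t \<omega>. Z t \<omega> $ 1) \<and>
             stable_process M \<alpha>\<^sub>2 (\<lambda>t \<omega>. Z t \<omega> $ 2))))"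
proof -
  interpret generating_candidate M Z a Q \<nu> J\<^sub>1 J\<^sub>2 \<alpha>\<^sub>1 \<alpha>\<^sub>2 G
    by unfold_locales (fact assms)+
  show ?thesis
    by (intro conjI allI impI) (rule single_power_iff two_powers_iff; assumption)+
qed

end
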